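(* Let $r$, $K$, $L$ be positive integers with $K\geq 2$. As $n\to\infty$ through elements of $F_r$: (a) $\displaystyle\limsup_{n\to\infty}\frac{P_1(n)}{\log n}\geq 2$; (b) $\displaystyle\limsup_{n\to\infty}\frac{Q_L(n)}{\log n}=1$; (c) $\displaystyle\limsup_{n\to\infty}\frac{P_K(n)}{\log n}\leq \lambda_K(r)^{-1}$, where the limsup is over those $n\in F_r$ with $\omega(n)\geq K$; (d) $\displaystyle\limsup_{n\to\infty}\frac{P_1(n)}{\log^2 n}\leq \frac{J_r}{r}$.
   Context: For a positive integer $r$, $S_r$ is the multiplicative arithmetic function with $S_r(p^{\alpha})=0$ if $p\leq r$ and $S_r(p^{\alpha})=p^{\alpha-1}(p-r)$ if $p>r$, for all primes $p$ and positive integers $\alpha$. $B_r=\{n\in\mathbb{N}: S_r(n)>0\}$ (positive integers whose smallest prime factor exceeds $r$, together with $1$). $F_r$ is the set of $n\in B_r$ such that $S_r(n)<S_r(m)$ for all $m\in B_r$ with $m>n$. $\omega(n)$ is the number of distinct prime factors of $n$. For $n\in F_r$, $P_k(n)$ is the $k$-th largest prime divisor of $n$ (when $\omega(n)\geq k$), and $Q_k(n)$ is the $k$-th smallest prime that is larger than $r$ and does not divide $n$. $r\#$ is the product of all primes $\leq r$ (with $1\#=1$). The Jacobsthal function $J(m)$ is the smallest positive integer $a$ such that every set of $a$ consecutive integers contains an element coprime to $m$; $J_r=J(r\#)$. $\lambda_k(r)$ is the unique positive real root of the polynomial $\frac{J_r}{r}x^k+kx-(k-1)$. *)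

theory Defs
  imports "HOL-Analysis.Analysis" "HOL-Computational_Algebra.Primes" "HOL-Library.Infinite_Set"
begin

definition S :: "nat \<Rightarrow> nat \<Rightarrow> nat" where
  "S r n = (\<Prod>p\<in>prime_factors n.
       if p \<le> r then 0 else p ^ (multiplicity p n - 1) * (p - r))"

definition B :: "nat \<Rightarrow> nat set" where
  "B r = {n. n > 0 \<and> S r n > 0}"

definition F :: "nat \<Rightarrow> nat set" where
  "F r = {n \<in> B r. \<forall>m\<in>B r. m > n \<longrightarrow> S r n < S r m}"

text \<open>k-th largest prime divisor (k \<ge> 1, meaningful when omega n \<ge> k)\<close>
definition P :: "nat \<Rightarrow> nat \<Rightarrow> nat" where
  "P k n = rev (sorted_list_of_set (prime_factors n)) ! (k - 1)"

definition Q :: "nat \<Rightarrow> nat \<Rightarrow> nat \<Rightarrow> nat" where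
  "Q r k n = enumerate {p. prime p \<and> r < p \<and> \<not> p dvd n} (k - 1)"

definition omega :: "nat \<Rightarrow> nat" where
  "omega n = card (prime_factors n)"

definition primorial :: "nat \<Rightarrow> nat" where
  "primorial r = (\<Prod>{p. prime p \<and> p \<le> r})"

definition jacobsthal :: "nat \<Rightarrow> nat" where
  "jacobsthal m = (LEAST a. a > 0 \<and> (\<forall>x::int. \<exists>i<a. coprime (x + int i) (int m)))"

definition Jr :: "nat \<Rightarrow> nat" where
  "Jr r = jacobsthal (primorial r)"

definition lambda :: "nat \<Rightarrow> nat \<Rightarrow> real" where
  "lambda k r = (THE x. x > 0 \<and>
      real (Jr r) / real r * x ^ k + real k * x - (real k - 1) = 0)"

end

theory Submission
  imports Defs "HOL-Complex_Analysis.Complex_Analysis" "HOL-Number_Theory.Prime_Powers"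
    "HOL-Real_Asymp.Real_Asymp"
begin

text \<open>
  Upper bounds: if \<open>n \<in> F r\<close>, replacing the primes \<open>P\<^sub>1, \<dots>, P\<^sub>K\<close> of \<open>n\<close> by absent primes
  \<open>Q\<^sub>1, \<dots>, Q\<^sub>j\<close> times a cofactor coprime to the primorial of \<open>r\<close>, found within \<open>J\<^sub>r\<close> of
  \<open>P\<^sub>1 \<cdots> P\<^sub>K / (Q\<^sub>1 \<cdots> Q\<^sub>j)\<close>, gives a slightly larger element of \<open>B r\<close>, whose \<open>S\<close>-value must
  exceed that of \<open>n\<close>. With \<open>K = j = 1\<close> this yields (d); with \<open>j = K - 1\<close> it says, to first order in
  \<open>1 / Q\<close>, that \<open>x = Q / P\<^sub>K\<close> makes the polynomial defining \<open>\<lambda>\<^sub>K\<close> positive, hence (c). Since all but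
  boundedly many primes in \<open>(r, Q\<^sub>L)\<close> divide \<open>n\<close>, the prime number theorem gives \<open>Q\<^sub>L \<le> (1 + o(1)) log n\<close>.

  Lower bounds: for primes \<open>q \<le> U\<close> with \<open>U - r < 2 (q - r)\<close>, the product of \<open>U\<close> and all primes strictly
  between \<open>r\<close> and \<open>q\<close> lies in \<open>F r\<close>. Taking \<open>U = q\<close> gives (b), and \<open>U\<close> close to \<open>2 q\<close> gives (a).

  The prime number theorem is proved by Newman's contour argument, applied to
  \<open>\<Sum>n. \<integral>x=n..n+1. (\<psi> n / x - 1) x powr (-1 - z)\<close>, which continues analytically past \<open>Re z = 0\<close>.
\<close>

section \<open>Power integrals over unit intervals\<close>

text \<open>Inserting one prime fewer than is removed makes all errors comparable: with
  \<open>x = Q / P\<close>, where \<open>Q\<close> is the absent prime of index \<open>K - 1\<close>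
  and \<open>P\<close> the prime divisor of index \<open>K\<close>, the cofactor overshoots by a
  relative amount of at most \<open>Jr r * x ^ K / Q\<close>, while removed and inserted primes
  weigh about \<open>r * K * x / Q\<close> and \<open>r * (K - 1) / Q\<close>. Expanding in 1 / Q
  helps only for large \<open>Q\<close>; if \<open>Q\<close> stays bounded, the same inequality
  keeps \<open>x\<close> away from 0, so that \<open>P\<close> is bounded as well. In the lower
  bounds, a competitor with an additional prime or a repeated one gains a factor of at least 2 over
  the least product of \<open>p - r\<close>; this is the origin of the condition on
  \<open>U\<close>. Squarefree competitors with equally many primes are the delicate case, resolved
  by concavity. In the analytic part, \<open>psi\<close> is used because its Dirichlet series is
  exactly the logarithmic derivative of zeta. Cutting the integral at the integers, where
  \<open>psi\<close> jumps, makes each term a combination of two values of \<open>slab\<close>,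
  hence entire; so the partial sums are entire too, as the left half of the contour demands.\<close>

definition slab :: "nat \<Rightarrow> complex \<Rightarrow> complex" where
  "slab n z = integral {real n..real n + 1} (\<lambda>x. of_real x powr (-1 - z))"

lemma continuous_on_of_real_powr:
  assumes "\<And>x. x \<in> A \<Longrightarrow> x > 0"
  shows "continuous_on A (\<lambda>x::real. (of_real x :: complex) powr w)"
  by (intro continuous_on_powr_complex continuous_intros)
     (use assms in \<open>force simp: complex_nonpos_Reals_iff\<close>)+

lemma has_vector_derivative_of_real_powr:
  assumes "x > 0"
  shows "((\<lambda>x::real. (of_real x :: complex) powr w) has_vector_derivative w * of_real x powr (w - 1)) (at x within A)"
proof -
  have "((\<lambda>x. x powr w) has_field_derivative w * of_real x powr (w - 1)) (at (complex_of_real x))"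
    using assms by (auto intro!: derivative_eq_intros simp: complex_nonpos_Reals_iff)
  then show ?thesis by (rule has_vector_derivative_real_field)
qed

lemma slab_closed_form:
  assumes "n > 0" "z \<noteq> 0"
  shows "slab n z = (of_nat n powr (-z) - of_nat (Suc n) powr (-z)) / z"
proof -
  have "((\<lambda>x. of_real x powr (-1 - z)) has_integral
      (- (of_real (real n + 1) powr (-z)) / z - (- (of_real (real n) powr (-z)) / z))) {real n..real n + 1}"
  proof (rule fundamental_theorem_of_calculus)
    fix x assume "x \<in> {real n..real n + 1}"
    then have "x > 0" using assms by auto
    from has_vector_derivative_of_real_powr[OF this, of "-z"]
    have "((\<lambda>x. (- 1 / z) * of_real x powr (-z)) has_vector_derivative
        (- 1 / z) * (- z * of_real x powr (-z - 1))) (at x within {real n..real n + 1})"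
      by (rule has_vector_derivative_mult_right)
    moreover have "(- 1 / z) * (- z * of_real x powr (-z - 1)) = of_real x powr (-1 - z)"
      using assms by (simp add: minus_diff_commute[of z 1])
    ultimately show "((\<lambda>x. - (of_real x powr (-z)) / z) has_vector_derivative of_real x powr (-1 - z))
        (at x within {real n..real n + 1})" by simp
  qed simp
  then show ?thesis
    unfolding slab_def by (simp add: integral_unique diff_divide_distrib add.commute)
qed

text \<open>Differentiation under the integral sign. It covers \<open>z = 0\<close>, the point at
  which the Tauberian theorem is evaluated and at which the closed form divides by zero.\<close>

lemma slab_holomorphic:
  assumes "n > 0"
  shows "slab n holomorphic_on UNIV"
proof -
  have pos: "x > 0" if "x \<in> cbox (real n) (real n + 1)" for x using that assms by auto
  have "(\<lambda>z. integral (cbox (real n) (real n + 1)) (\<lambda>x. of_real x powr (-1 - z))) holomorphic_on UNIV"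
  proof (rule leibniz_rule_holomorphic)
    fix z t assume "t \<in> cbox (real n) (real n + 1)"
    then show "((\<lambda>z. complex_of_real t powr (-1 - z)) has_field_derivative
        - (of_real t powr (-1 - z) * of_real (ln t))) (at z within UNIV)"
      using pos[of t]
        DERIV_chain'[OF DERIV_diff[OF DERIV_const DERIV_ident] has_field_derivative_powr_right, of "of_real t" "-1" z UNIV]
      by (simp add: Ln_of_real mult.commute)
  next
    fix z
    show "(\<lambda>x. complex_of_real x powr (-1 - z)) integrable_on cbox (real n) (real n + 1)"
      by (intro integrable_continuous continuous_on_of_real_powr) (use pos in auto)
  next
    show "continuous_on (UNIV \<times> cbox (real n) (real n + 1))
       (\<lambda>(z, t). - (complex_of_real t powr (-1 - z) * of_real (ln t)))"
      unfolding case_prod_unfold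
      by (intro continuous_intros continuous_on_powr_complex) 
         (use pos in \<open>force simp: complex_nonpos_Reals_iff\<close>)+
  qed simp
  then show ?thesis by (simp add: slab_def [abs_def])
qed

lemma norm_integral_powr_le:
  assumes "n > 0" "\<sigma> \<noteq> 0" "continuous_on {real n..real n + 1} f"
    and "\<And>x. x \<in> {real n..real n + 1} \<Longrightarrow> norm (f x :: complex) \<le> M * x powr (-1 - \<sigma>)"
  shows "norm (integral {real n..real n + 1} f) \<le> M * ((real n powr (-\<sigma>) - real (Suc n) powr (-\<sigma>)) / \<sigma>)"
proof -
  have "((\<lambda>x. M * x powr (-1 - \<sigma>)) has_integral
      (M * (- ((real n + 1) powr (-\<sigma>)) / \<sigma>) - M * (- (real n powr (-\<sigma>)) / \<sigma>))) {real n..real n + 1}"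
  proof (rule fundamental_theorem_of_calculus)
    fix x assume "x \<in> {real n..real n + 1}"
    then have "x > 0" using assms by auto
    then show "((\<lambda>x. M * (- (x powr (-\<sigma>)) / \<sigma>)) has_vector_derivative M * x powr (-1 - \<sigma>))
        (at x within {real n..real n + 1})"
      using assms(2) unfolding has_real_derivative_iff_has_vector_derivative[symmetric]
      by (auto intro!: derivative_eq_intros simp: minus_diff_commute[of \<sigma> 1])
  qed simp
  then have I: "((\<lambda>x. M * x powr (-1 - \<sigma>)) has_integral
      (M * ((real n powr (-\<sigma>) - real (Suc n) powr (-\<sigma>)) / \<sigma>))) {real n..real n + 1}"
    by (simp add: algebra_simps diff_divide_distrib)
  have "norm (integral {real n..real n + 1} f) \<le> integral {real n..real n + 1} (\<lambda>x. M * x powr (-1 - \<sigma>))"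
    by (rule integral_norm_bound_integral)
       (use assms I in \<open>auto intro!: integrable_continuous_real simp: has_integral_integrable\<close>)
  with integral_unique[OF I] show ?thesis by simp
qed

lemma norm_slab_le:
  assumes "n > 0" "Re z \<noteq> 0"
  shows "norm (slab n z) \<le> (real n powr (-Re z) - real (Suc n) powr (-Re z)) / Re z"
  unfolding slab_def
  using norm_integral_powr_le[OF assms continuous_on_of_real_powr, of "-1 - z" 1] assms
  by (simp add: norm_powr_real_powr)

text \<open>One factor 1 / x is bounded by 1 / n; it will absorb the linear growth of
  \<open>psi n\<close>.\<close>

lemma norm_slab_Suc_le:
  assumes "n > 0" "Re z \<noteq> 0"
  shows "norm (slab n (1 + z)) \<le> 1 / real n * ((real n powr (-Re z) - real (Suc n) powr (-Re z)) / Re z)"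
  unfolding slab_def
proof (rule norm_integral_powr_le[OF assms])
  fix x assume x: "x \<in> {real n..real n + 1}"
  have "norm (complex_of_real x powr (-1 - (1 + z))) = x powr (-1 - Re z) / x"
    using x assms(1) powr_diff[of x "-1 - Re z" 1] by (simp add: norm_powr_real_powr algebra_simps)
  also have "\<dots> \<le> x powr (-1 - Re z) / n"
    using x assms(1) by (intro divide_left_mono) auto
  finally show "norm (complex_of_real x powr (-1 - (1 + z))) \<le> 1 / real n * x powr (-1 - Re z)"
    by simp
qed (use assms in \<open>auto intro!: continuous_on_of_real_powr\<close>)

text \<open>By the mean value inequality \<open>x powr (-s)\<close> changes little on a unit
  interval. The extra power of \<open>n\<close> gained by subtracting the integral moves convergence
  from \<open>Re s > 1\<close> to \<open>Re s > 0\<close>.\<close>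

lemma norm_powr_minus_slab_le:
  assumes "n > 0" "Re s > 0"
  shows "norm (of_nat n powr (-s) - slab n (s - 1)) \<le> norm s * real n powr (-1 - Re s)"
proof -
  have pos: "x > 0" if "x \<in> {real n..real n + 1}" for x using that assms by auto
  have lip: "norm (of_nat n powr (-s) - complex_of_real x powr (-s)) \<le> norm s * real n powr (-1 - Re s)"
    if x: "x \<in> {real n..real n + 1}" for x
  proof -
    let ?S = "closed_segment (of_nat n) (complex_of_real x)"
    have seg: "\<exists>u. real n \<le> u \<and> z = of_real u" if "z \<in> ?S" for z
    proof -
      have "z \<in> complex_of_real ` closed_segment (real n) x"
        using that by (metis closed_segment_of_real of_real_of_nat_eq)
      then show ?thesis using x by (auto simp: closed_segment_eq_real_ivl)
    qed
    have "norm (of_nat n powr (-s) - complex_of_real x powr (-s)) \<le>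
        norm s * real n powr (-1 - Re s) * norm (of_nat n - complex_of_real x)"
    proof (rule field_differentiable_bound[where S = ?S and f' = "\<lambda>z. -s * z powr (-s - 1)"])
      fix z assume "z \<in> ?S"
      then obtain u where u: "real n \<le> u" "z = of_real u" using seg by blast
      then have "u > 0" using assms by linarith
      with u show "((\<lambda>z. z powr (-s)) has_field_derivative -s * z powr (-s - 1)) (at z within ?S)"
        by (auto intro!: derivative_eq_intros simp: complex_nonpos_Reals_iff)
      have "u powr (- Re s - 1) \<le> real n powr (- Re s - 1)"
        using u assms by (intro powr_mono2') auto
      then show "norm (-s * z powr (-s - 1)) \<le> norm s * real n powr (-1 - Re s)"
        using u \<open>u > 0\<close> by (auto simp: norm_mult norm_powr_real_powr intro!: mult_left_mono)
          (metis add.commute minus_add_cancel uminus_add_conv_diff)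
    qed auto
    also have "\<dots> \<le> norm s * real n powr (-1 - Re s) * 1"
    proof (intro mult_left_mono)
      have "norm (of_nat n - complex_of_real x) = \<bar>real n - x\<bar>"
        by (metis norm_of_real of_real_diff of_real_of_nat_eq)
      then show "norm (of_nat n - complex_of_real x) \<le> 1" using x by auto
    qed auto
    finally show ?thesis by simp
  qed
  have "((\<lambda>x. of_nat n powr (-s) - complex_of_real x powr (-s)) has_integral
      (of_nat n powr (-s) - slab n (s - 1))) {real n..real n + 1}"
  proof (intro has_integral_diff)
    show "((\<lambda>x. of_nat n powr (-s)) has_integral of_nat n powr (-s)) {real n..real n + 1}"
      using has_integral_const_real[of "of_nat n powr (-s)::complex" "real n" "real n + 1"] by simp
    show "((\<lambda>x. complex_of_real x powr (-s)) has_integral slab n (s - 1)) {real n..real n + 1}"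
      unfolding slab_def using integrable_continuous_real[OF continuous_on_of_real_powr[of "{real n..real n + 1}" "-s"]] pos
      by (simp add: integrable_integral)
  qed
  from has_integral_bound_real[OF _ finite.emptyI this, of "norm s * real n powr (-1 - Re s)"] lip
  show ?thesis by simp
qed

section \<open>The zeta function on the right half-plane\<close>

text \<open>This is zeta(s) - 1 / (s - 1): sum minus integral, paired interval by interval so that
  the differences converge on the whole right half-plane.\<close>

definition zreg :: "complex \<Rightarrow> complex" where
  "zreg s = (\<Sum>n. of_nat (Suc n) powr (-s) - slab (Suc n) (s - 1))"

lemma summable_Suc_powr: "s < -1 \<Longrightarrow> summable (\<lambda>n. real (Suc n) powr s)"
  using summable_Suc_iff[of "\<lambda>n. real n powr s"] by (simp add: summable_real_powr_iff)

lemma has_field_derivative_of_nat_powr_minus: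
  fixes s :: complex
  assumes "n > 0"
  shows "((\<lambda>s. of_nat n powr (-s)) has_field_derivative - (of_real (ln (real n)) * of_nat n powr (-s))) (at s)"
  using DERIV_chain'[of uminus "-1" s UNIV "\<lambda>z. of_nat n powr z" "Ln (of_nat n) * of_nat n powr (-s)"] assms
    has_field_derivative_powr_right[of "of_nat n" "-s"] DERIV_minus[OF DERIV_ident, of s UNIV]
  by (simp add: Ln_of_nat)

lemma
  shows zreg_sums: "Re s > 0 \<Longrightarrow> (\<lambda>n. of_nat (Suc n) powr (-s) - slab (Suc n) (s - 1)) sums zreg s"
    and zreg_holomorphic: "zreg holomorphic_on {s. Re s > 0}"
proof -
  define f where "f = (\<lambda>n s. of_nat (Suc n) powr (-s) - slab (Suc n) (s - 1))"
  let ?S = "{s. Re s > 0}"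
  have op: "open ?S" by (simp add: open_halfspace_Re_gt)
  have "\<exists>g g'. \<forall>x\<in>?S. ((\<lambda>n. f n x) sums g x) \<and> ((\<lambda>n. deriv (f n) x) sums g' x) \<and> (g has_field_derivative g' x) (at x)"
  proof (rule series_and_derivative_comparison_local[OF op])
    fix n x
    have "(\<lambda>s. slab (Suc n) (s - 1)) holomorphic_on UNIV"
      using holomorphic_on_compose[of "\<lambda>s. s - 1" UNIV "slab (Suc n)"] slab_holomorphic[of "Suc n"]
      by (simp add: o_def holomorphic_on_diff holomorphic_on_ident holomorphic_on_const holomorphic_on_subset)
    then have "f n holomorphic_on UNIV"
      unfolding f_def by (intro holomorphic_intros)
    then show "(f n has_field_derivative deriv (f n) x) (at x)"
      by (rule holomorphic_derivI) auto
  next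
    fix x assume "x \<in> ?S"
    then have x: "Re x > 0" by simp
    \<comment> \<open>The radius \<open>Re x / 2\<close> keeps \<open>Re y\<close> above
      \<open>Re x / 2\<close> on the ball, so one summable majorant serves all of it.\<close>
    define h where "h = (\<lambda>n. (norm x + Re x / 2) * real (Suc n) powr (-1 - Re x / 2))"
    have "norm (f n y) \<le> h n" if "y \<in> ball x (Re x / 2) \<inter> ?S" for n y
    proof -
      have 1: "norm (y - x) < Re x / 2" using that by (simp add: dist_norm norm_minus_commute)
      have 2: "\<bar>Re (y - x)\<bar> < Re x / 2" using abs_Re_le_cmod[of "y - x"] 1 by linarith
      have 3: "norm y \<le> norm x + Re x / 2" using norm_triangle_sub[of y x] 1 by linarith
      have "norm (f n y) \<le> norm y * real (Suc n) powr (-1 - Re y)"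
        unfolding f_def using that by (intro norm_powr_minus_slab_le) auto
      also have "\<dots> \<le> (norm x + Re x / 2) * real (Suc n) powr (-1 - Re x / 2)"
        using 2 3 x by (intro mult_mono powr_mono) (auto simp: abs_if split: if_splits)
      finally show ?thesis by (simp add: h_def)
    qed
    moreover have "summable h" unfolding h_def
      using x by (intro summable_mult summable_Suc_powr) auto
    ultimately show "\<exists>d h. 0 < d \<and> summable h \<and> (\<forall>\<^sub>F n in sequentially. \<forall>y\<in>ball x d \<inter> ?S. norm (f n y) \<le> h n)"
      using x by (intro exI[of _ "Re x / 2"] exI[of _ h]) auto
  qed
  then obtain g g' where g: "\<And>x. x \<in> ?S \<Longrightarrow> (\<lambda>n. f n x) sums g x"
    "\<And>x. x \<in> ?S \<Longrightarrow> (g has_field_derivative g' x) (at x)" by blast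
  have eq: "g x = zreg x" if "x \<in> ?S" for x
    using g(1)[OF that] by (simp add: zreg_def f_def sums_unique)
  show "(\<lambda>n. of_nat (Suc n) powr (-s) - slab (Suc n) (s - 1)) sums zreg s" if "Re s > 0"
    using g(1)[of s] eq[of s] that by (simp add: f_def)
  have "g holomorphic_on ?S"
    using g(2) op by (meson holomorphic_on_open)
  then show "zreg holomorphic_on ?S"
    by (rule holomorphic_transform) (use eq in auto)
qed

text \<open>For \<open>Re s > 1\<close> this is \<open>(s - 1) \<zeta>(s)\<close>, which unlike \<open>\<zeta>\<close> has no pole at \<open>1\<close>.\<close>

definition zetaf :: "complex \<Rightarrow> complex" where
  "zetaf s = (s - 1) * zreg s + 1"

lemma zetaf_holomorphic: "zetaf holomorphic_on {s. Re s > 0}"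
  unfolding zetaf_def[abs_def] by (intro holomorphic_intros zreg_holomorphic)

lemma zetaf_1 [simp]: "zetaf 1 = 1"
  by (simp add: zetaf_def)

lemma Suc_powr_tendsto_0:
  assumes "Re z > 0"
  shows "(\<lambda>n. of_nat (Suc n) powr (-z) :: complex) \<longlonglongrightarrow> 0"
proof (rule tendsto_norm_zero_cancel)
  have "(\<lambda>n. real (Suc n) powr (-Re z)) \<longlonglongrightarrow> 0"
    using assms by (intro tendsto_neg_powr filterlim_compose[OF filterlim_real_sequentially filterlim_Suc]) auto
  then show "(\<lambda>n. norm (of_nat (Suc n) powr (-z) :: complex)) \<longlonglongrightarrow> 0"
    by (simp add: norm_powr_real_powr del: of_nat_Suc)
qed

lemma slab_sums:
  assumes "Re z > 0"
  shows "(\<lambda>n. slab (Suc n) z) sums (1 / z)"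
proof -
  have z: "z \<noteq> 0" using assms by auto
  have "(\<lambda>n. of_nat (Suc n) powr (-z) / z) \<longlonglongrightarrow> 0 / z"
    by (intro tendsto_intros Suc_powr_tendsto_0 assms z)
  from telescope_sums'[OF this] have
    "(\<lambda>n. of_nat (Suc n) powr (-z) / z - of_nat (Suc (Suc n)) powr (-z) / z) sums (1 / z)"
    by simp
  then show ?thesis
    by (simp only: slab_closed_form[OF zero_less_Suc z] diff_divide_distrib)
qed

lemma zeta_sums:
  assumes "Re s > 1"
  shows "(\<lambda>n. of_nat (Suc n) powr (-s)) sums (zetaf s / (s - 1))"
proof -
  have "s \<noteq> 1" using assms by auto
  then have "zreg s + 1 / (s - 1) = zetaf s / (s - 1)"
    by (simp add: zetaf_def field_simps)
  then show ?thesis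
    using sums_add[OF zreg_sums slab_sums, of s "s - 1"] assms by simp
qed

text \<open>Termwise differentiation produces the coefficients \<open>ln n\<close>, which are the
  divisor sums of the von Mangoldt function.\<close>

lemma zeta_deriv_sums:
  assumes s: "Re s > 1"
  shows "(\<lambda>n. - (of_real (ln (real (Suc n))) * of_nat (Suc n) powr (-s))) sums deriv (\<lambda>s. zetaf s / (s - 1)) s"
proof -
  define f where "f = (\<lambda>n s. of_nat (Suc n) powr (-s) :: complex)"
  define f' where "f' = (\<lambda>n s. - (of_real (ln (real (Suc n))) * of_nat (Suc n) powr (-s)) :: complex)"
  let ?S = "{s. Re s > 1}"
  have op: "open ?S" by (simp add: open_halfspace_Re_gt)
  have "\<exists>g g'. \<forall>x\<in>?S. ((\<lambda>n. f n x) sums g x) \<and> ((\<lambda>n. f' n x) sums g' x) \<and> (g has_field_derivative g' x) (at x)"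
  proof (rule series_and_derivative_comparison_local[OF op])
    fix n x
    show "(f n has_field_derivative f' n x) (at x)"
      unfolding f_def f'_def by (rule has_field_derivative_of_nat_powr_minus) simp
  next
    fix x assume "x \<in> ?S"
    then have x: "Re x > 1" by simp
    define d where "d = (Re x - 1) / 2"
    define h where "h = (\<lambda>n. real (Suc n) powr (-1 - d))"
    have "norm (f n y) \<le> h n" if "y \<in> ball x d \<inter> ?S" for n y
    proof -
      have 1: "norm (y - x) < d" using that by (simp add: dist_norm norm_minus_commute)
      have 2: "\<bar>Re (y - x)\<bar> < d" using abs_Re_le_cmod[of "y - x"] 1 by linarith
      have "norm (f n y) = real (Suc n) powr (-Re y)"
        by (simp add: f_def norm_powr_real_powr del: of_nat_Suc)
      also have "\<dots> \<le> h n" unfolding h_def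
        using 2 x by (intro powr_mono) (auto simp: d_def field_simps abs_if split: if_splits)
      finally show ?thesis .
    qed
    moreover have d: "d > 0" using x by (simp add: d_def)
    moreover have "summable h" unfolding h_def
      using d by (intro summable_Suc_powr) auto
    ultimately show "\<exists>d h. 0 < d \<and> summable h \<and> (\<forall>\<^sub>F n in sequentially. \<forall>y\<in>ball x d \<inter> ?S. norm (f n y) \<le> h n)"
      by (intro exI[of _ d] exI[of _ h]) auto
  qed
  then obtain g g' where g: "\<And>x. x \<in> ?S \<Longrightarrow> (\<lambda>n. f n x) sums g x" "\<And>x. x \<in> ?S \<Longrightarrow> (\<lambda>n. f' n x) sums g' x"
    "\<And>x. x \<in> ?S \<Longrightarrow> (g has_field_derivative g' x) (at x)" by blast
  have eq: "g x = zetaf x / (x - 1)" if "x \<in> ?S" for x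
    using g(1)[OF that] zeta_sums[of x] that by (auto simp: f_def intro: sums_unique2)
  have "((\<lambda>s. zetaf s / (s - 1)) has_field_derivative g' s) (at s)"
    by (rule has_field_derivative_transform_within_open[OF g(3) op]) (use s eq in auto)
  then show ?thesis using g(2)[of s] s by (simp add: f'_def DERIV_imp_deriv)
qed

text \<open>Read off from the differentiated zeta series at a real point, where all terms have the
  same sign.\<close>

lemma summable_ln_powr:
  assumes "\<sigma> > 1"
  shows "summable (\<lambda>n. ln (real (Suc n)) * real (Suc n) powr (-\<sigma>))"
proof -
  have "summable (\<lambda>n. Re (- (of_real (ln (real (Suc n))) * of_nat (Suc n) powr (- of_real \<sigma>))))"
    using zeta_deriv_sums[of "of_real \<sigma>"] assms by (intro summable_Re) (auto simp: sums_iff)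
  moreover have "(of_nat (Suc n) powr (- of_real \<sigma>) :: complex) = of_real (real (Suc n) powr (-\<sigma>))" for n
    using powr_of_real[of "real (Suc n)" "-\<sigma>"] by simp
  ultimately have "summable (\<lambda>n. - (ln (real (Suc n)) * real (Suc n) powr (-\<sigma>)))"
    by (simp del: of_nat_Suc)
  from summable_minus[OF this] show ?thesis by (simp del: of_nat_Suc)
qed

section \<open>The Dirichlet series of the von Mangoldt function\<close>

definition mangoldt_series :: "complex \<Rightarrow> complex" where
  "mangoldt_series s = (\<Sum>n. mangoldt (Suc n) * of_nat (Suc n) powr (-s))"

lemma summable_mangoldt_powr:
  assumes "\<sigma> > 1"
  shows "summable (\<lambda>n. mangoldt (Suc n) * real (Suc n) powr (-\<sigma>))"
proof (rule summable_comparison_test'[OF summable_ln_powr[OF assms]])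
  fix n show "norm (mangoldt (Suc n) * real (Suc n) powr (-\<sigma>)) \<le> ln (real (Suc n)) * real (Suc n) powr (-\<sigma>)"
    using mangoldt_le[of "Suc n"] by (auto simp: abs_mult mult_right_mono simp del: of_nat_Suc)
qed

lemma norm_mangoldt_powr:
  "norm (mangoldt (Suc n) * of_nat (Suc n) powr (-s) :: complex) = mangoldt (Suc n) * real (Suc n) powr (-Re s)"
  by (simp add: norm_mult norm_powr_real_powr del: of_nat_Suc)

lemma mangoldt_series_sums:
  assumes "Re s > 1"
  shows "(\<lambda>n. mangoldt (Suc n) * of_nat (Suc n) powr (-s)) sums mangoldt_series s"
  unfolding mangoldt_series_def
  by (rule summable_sums, rule summable_norm_cancel) (use summable_mangoldt_powr[OF assms] in \<open>simp only: norm_mangoldt_powr\<close>)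

lemma has_sum_greaterThan_0:
  fixes f :: "nat \<Rightarrow> 'a :: banach"
  assumes "summable (\<lambda>n. norm (f (Suc n)))" "(\<lambda>n. f (Suc n)) sums s"
  shows "(f has_sum s) {0<..}"
proof -
  have "((\<lambda>n. f (Suc n)) has_sum s) UNIV"
    by (rule norm_summable_imp_has_sum[OF assms])
  moreover have "bij_betw Suc UNIV {0<..}"
    by (rule bij_betwI[of _ _ _ "\<lambda>n. n - 1"]) auto
  ultimately show ?thesis by (simp add: has_sum_reindex_bij_betw)
qed

text \<open>Dirichlet convolution: the double series over \<open>(d, m)\<close> converges
  absolutely, and regrouping by \<open>n = d * m\<close> turns the inner sums into the sum of
  \<open>mangoldt d\<close> over the divisors of \<open>n\<close>, which is
  \<open>ln n\<close>.\<close>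

lemma zeta_mult_mangoldt_series:
  assumes s: "Re s > 1"
  shows "zetaf s / (s - 1) * mangoldt_series s = - deriv (\<lambda>s. zetaf s / (s - 1)) s"
proof -
  define a :: "nat \<Rightarrow> complex" where "a = (\<lambda>n. mangoldt n * of_nat n powr (-s))"
  define b :: "nat \<Rightarrow> complex" where "b = (\<lambda>n. of_nat n powr (-s))"
  have sb: "summable (\<lambda>n. norm (b (Suc n)))"
    using summable_Suc_powr[of "-Re s"] s by (simp add: b_def norm_powr_real_powr del: of_nat_Suc)
  have sa: "summable (\<lambda>n. norm (a (Suc n)))"
    using summable_mangoldt_powr[OF s] by (simp only: a_def norm_mangoldt_powr)
  have A: "(a has_sum mangoldt_series s) {0<..}"
    by (rule has_sum_greaterThan_0[OF sa]) (use mangoldt_series_sums[OF s] in \<open>simp add: a_def\<close>)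
  have Bs: "(b has_sum (zetaf s / (s - 1))) {0<..}"
    by (rule has_sum_greaterThan_0[OF sb]) (use zeta_sums[OF s] in \<open>simp add: b_def\<close>)
  have nA: "((\<lambda>n. norm (a n)) has_sum (\<Sum>n. norm (a (Suc n)))) {0<..}"
    and nB: "((\<lambda>n. norm (b n)) has_sum (\<Sum>n. norm (b (Suc n)))) {0<..}"
    using sa sb by (auto intro!: has_sum_greaterThan_0 summable_sums)
  have "(\<lambda>(d, m). norm (a d) * norm (b m)) summable_on {0<..} \<times> {0<..}"
    by (rule summable_on_SigmaI[where g = "\<lambda>d. norm (a d) * (\<Sum>n. norm (b (Suc n)))"])
       (auto intro!: has_sum_cmult_right nB has_sum_imp_summable[OF has_sum_cmult_left[OF nA]])
  then have "(\<lambda>x. norm (case x of (d, m) \<Rightarrow> a d * b m)) summable_on {0<..} \<times> {0<..}"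
    by (simp add: case_prod_unfold norm_mult)
  then have "(\<lambda>(d, m). a d * b m) summable_on {0<..} \<times> {0<..}"
    by (rule abs_summable_summable)
  then have "((\<lambda>(d, m). a d * b m) has_sum (mangoldt_series s * (zetaf s / (s - 1)))) ({0<..} \<times> {0<..})"
    by (intro has_sum_SigmaI[where g = "\<lambda>d. a d * (zetaf s / (s - 1))"])
       (auto simp del: times_divide_eq_right intro!: has_sum_cmult_right has_sum_cmult_left A Bs)
  also have "?this \<longleftrightarrow> ((\<lambda>(n, d). mangoldt d * of_nat n powr (-s)) has_sum (mangoldt_series s * (zetaf s / (s - 1))))
      (SIGMA n:{0<..}. {d. d dvd n})"
  proof (rule has_sum_reindex_bij_witness[of _ "\<lambda>(n, d). (d, n div d)" "\<lambda>(d, m). (d * m, d)"])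
    fix y assume "y \<in> (SIGMA n:{0<..}. {d. d dvd (n::nat)})"
    then show "(case y of (n, d) \<Rightarrow> (d, n div d)) \<in> {0<..} \<times> {0<..}"
      by (auto simp: div_greater_zero_iff dest: dvd_imp_le dvd_pos_nat)
  next
    fix x :: "nat \<times> nat" assume "x \<in> {0<..} \<times> {0<..}"
    then show "(case case x of (d, m) \<Rightarrow> (d * m, d) of (n, d) \<Rightarrow> mangoldt d * of_nat n powr (-s)) = (case x of (d, m) \<Rightarrow> a d * b m)"
      by (auto simp: a_def b_def powr_times_real)
  qed auto
  finally have "((\<lambda>n. \<Sum>d | d dvd n. mangoldt d * of_nat n powr (-s)) has_sum (mangoldt_series s * (zetaf s / (s - 1)))) {0<..}"
    by (rule has_sum_SigmaD) (auto intro!: has_sum_finiteI)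
  also have "?this \<longleftrightarrow> ((\<lambda>n. of_real (ln (real n)) * of_nat n powr (-s)) has_sum (mangoldt_series s * (zetaf s / (s - 1)))) {0<..}"
    by (intro has_sum_cong) (auto simp: sum_distrib_right[symmetric] mangoldt_sum)
  finally have 1: "((\<lambda>n. of_real (ln (real n)) * of_nat n powr (-s)) has_sum (mangoldt_series s * (zetaf s / (s - 1)))) {0<..}" .
  have 2: "((\<lambda>n. of_real (ln (real n)) * of_nat n powr (-s)) has_sum - deriv (\<lambda>s. zetaf s / (s - 1)) s) {0<..}"
  proof (rule has_sum_greaterThan_0)
    show "summable (\<lambda>n. norm (of_real (ln (real (Suc n))) * of_nat (Suc n) powr (-s) :: complex))"
      using summable_ln_powr[OF s] by (simp add: norm_mult norm_powr_real_powr del: of_nat_Suc)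
    show "(\<lambda>n. of_real (ln (real (Suc n))) * of_nat (Suc n) powr (-s)) sums - deriv (\<lambda>s. zetaf s / (s - 1)) s"
      using sums_minus[OF zeta_deriv_sums[OF s]] by simp
  qed
  show ?thesis using has_sum_unique[OF 1 2] by (simp add: mult.commute)
qed

text \<open>Kept in product form because \<open>zetaf\<close> is not yet known to be nonzero; the
  factor \<open>s - 1\<close> hidden in \<open>zetaf\<close> accounts for the term
  \<open>zetaf s / (s - 1)\<close>.\<close>

lemma mangoldt_series_zetaf:
  assumes s: "Re s > 1"
  shows "mangoldt_series s * zetaf s = zetaf s / (s - 1) - deriv zetaf s"
proof -
  have ne: "s \<noteq> 1" using s by auto
  have "(zetaf has_field_derivative deriv zetaf s) (at s)"
    using holomorphic_derivI[OF zetaf_holomorphic, of s] s by (simp add: open_halfspace_Re_gt)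
  then have "((\<lambda>s. zetaf s / (s - 1)) has_field_derivative (deriv zetaf s * (s - 1) - zetaf s) / (s - 1)^2) (at s)"
    using ne by (auto intro!: derivative_eq_intros simp: power2_eq_square)
  from DERIV_imp_deriv[OF this] zeta_mult_mangoldt_series[OF s]
  have "zetaf s / (s - 1) * mangoldt_series s = - ((deriv zetaf s * (s - 1) - zetaf s) / (s - 1)^2)" by simp
  then have "zetaf s / (s - 1) * mangoldt_series s * (s - 1) = - ((deriv zetaf s * (s - 1) - zetaf s) / (s - 1)^2) * (s - 1)"
    by simp
  moreover have "- ((deriv zetaf s * (s - 1) - zetaf s) / (s - 1)^2) * (s - 1) = zetaf s / (s - 1) - deriv zetaf s"
    using ne by (simp add: power2_eq_square divide_simps)
  ultimately show ?thesis using ne by (simp add: mult.commute)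
qed

section \<open>Non-vanishing on the line of real part one\<close>

text \<open>Zeros and non-zeros get the same normal form, with \<open>k = 0\<close> for the latter,
  so that one residue computation serves every point. At a zero the order is finite because
  \<open>zetaf\<close> takes the value 1 at 1 and so is not constant.\<close>

lemma zetaf_local_factor:
  assumes "Re s0 > 0"
  obtains k h r where "r > 0" "ball s0 r \<subseteq> {s. Re s > 0}" "h holomorphic_on ball s0 r"
    "\<And>w. w \<in> ball s0 r \<Longrightarrow> zetaf w = (w - s0) ^ k * h w" "\<And>w. w \<in> ball s0 r \<Longrightarrow> h w \<noteq> 0"
    "k > 0 \<longleftrightarrow> zetaf s0 = 0"
proof (cases "zetaf s0 = 0")
  case True
  have "\<not> zetaf constant_on {s. Re s > 0}"
  proof
    assume "zetaf constant_on {s. Re s > 0}"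
    then obtain c where "\<forall>x\<in>{s. Re s > 0}. zetaf x = c" by (auto simp: constant_on_def)
    then have "zetaf s0 = c" "zetaf 1 = c" using assms by (simp_all del: zetaf_1)
    with True show False by simp
  qed
  moreover have "connected {s. Re s > 0}" 
    by (intro convex_connected convex_halfspace_Re_gt)
  ultimately show ?thesis
  proof (rule_tac holomorphic_factor_zero_nonconstant[OF zetaf_holomorphic open_halfspace_Re_gt])
    fix g r n
    assume "0 < n"  "0 < r"  "ball s0 r \<subseteq> {s. Re s > 0}" "g holomorphic_on ball s0 r"
      "\<And>w. w \<in> ball s0 r \<Longrightarrow> zetaf w = (w - s0)^n * g w" "\<And>w. w \<in> ball s0 r \<Longrightarrow> g w \<noteq> 0"
    with True show ?thesis by (intro that[of r g n]) simp_all
  qed (use assms True in simp_all)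
next
  case False
  have op: "open {s. Re s > 0}" by (simp add: open_halfspace_Re_gt)
  have "isCont zetaf s0"
    using holomorphic_on_imp_continuous_on[OF zetaf_holomorphic] assms op
    by (simp add: continuous_on_eq_continuous_at)
  from continuous_at_avoid[OF this False] obtain e where e: "e > 0" "\<And>y. dist s0 y < e \<Longrightarrow> zetaf y \<noteq> 0"
    by blast
  obtain d where d: "d > 0" "ball s0 d \<subseteq> {s. Re s > 0}"
    using op assms by (metis mem_Collect_eq open_contains_ball_eq)
  show ?thesis
  proof (rule that[of "min d e" zetaf 0])
    show "ball s0 (min d e) \<subseteq> {s. Re s > 0}" using d by auto
    then show "zetaf holomorphic_on ball s0 (min d e)"
      by (rule holomorphic_on_subset[OF zetaf_holomorphic])
  qed (use d e False in auto)
qed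

text \<open>The negative logarithmic derivative of zeta has residue \<open>-k\<close> at a zero of
  order \<open>k\<close> and residue 1 at the simple pole of zeta; the residue is approached from
  the right along a horizontal line.\<close>

lemma mangoldt_series_residue:
  assumes s0: "Re s0 \<ge> 1"
  shows "\<exists>k::nat. (k > 0 \<longleftrightarrow> zetaf s0 = 0) \<and>
    ((\<lambda>\<epsilon>::real. of_real \<epsilon> * mangoldt_series (s0 + of_real \<epsilon>)) \<longlongrightarrow> (if s0 = 1 then 1 else 0) - of_nat k) (at_right 0)"
proof -
  have "Re s0 > 0" using s0 by simp
  then obtain k h r where r: "r > 0" "ball s0 r \<subseteq> {s. Re s > 0}" and h: "h holomorphic_on ball s0 r"
    "\<And>w. w \<in> ball s0 r \<Longrightarrow> zetaf w = (w - s0) ^ k * h w" "\<And>w. w \<in> ball s0 r \<Longrightarrow> h w \<noteq> 0"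
    and k: "k > 0 \<longleftrightarrow> zetaf s0 = 0" by (rule zetaf_local_factor) blast
  \<comment> \<open>Multiplied through by \<open>w - s0\<close> and \<open>zetaf w\<close>, the
    logarithmic derivative makes sense at \<open>s0\<close> and for \<open>k = 0\<close>
    alike.\<close>
  have log_deriv: "(w - s0) * deriv zetaf w = (of_nat k + (w - s0) * (deriv h w / h w)) * zetaf w"
    if w: "w \<in> ball s0 r" for w
  proof -
    have "(h has_field_derivative deriv h w) (at w)"
      using holomorphic_derivI[OF h(1) open_ball w] by simp
    then have "((\<lambda>w. (w - s0) ^ k * h w) has_field_derivative
        of_nat k * (w - s0) ^ (k - 1) * h w + (w - s0) ^ k * deriv h w) (at w)"
      by (auto intro!: derivative_eq_intros)
    then have "(zetaf has_field_derivative of_nat k * (w - s0) ^ (k - 1) * h w + (w - s0) ^ k * deriv h w) (at w)"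
      by (rule has_field_derivative_transform_within_open[OF _ open_ball w]) (use h in auto)
    from DERIV_imp_deriv[OF this]
    have eq: "deriv zetaf w = of_nat k * (w - s0) ^ (k - 1) * h w + (w - s0) ^ k * deriv h w" .
    have "(w - s0) * deriv zetaf w = of_nat k * ((w - s0) ^ k * h w) + (w - s0) * ((w - s0) ^ k * deriv h w)"
      unfolding eq by (cases k) (simp_all add: algebra_simps)
    also have "(w - s0) ^ k * deriv h w = deriv h w / h w * zetaf w"
      using h(2,3)[OF w] by simp
    finally show ?thesis
      unfolding h(2)[OF w, symmetric] by (simp add: algebra_simps)
  qed
  have ev: "eventually (\<lambda>\<epsilon>. of_real \<epsilon> * mangoldt_series (s0 + of_real \<epsilon>) =
      of_real \<epsilon> / (s0 + of_real \<epsilon> - 1) - of_nat k - of_real \<epsilon> * (deriv h (s0 + of_real \<epsilon>) / h (s0 + of_real \<epsilon>))) (at_right (0::real))"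
    using eventually_at_right_real[OF r(1)]
  proof eventually_elim
    case (elim \<epsilon>)
    define w where "w = s0 + of_real \<epsilon>"
    have w: "w \<in> ball s0 r" and e: "w - s0 = of_real \<epsilon>" using elim by (auto simp: w_def dist_norm)
    have Re: "Re w > 1" using elim s0 by (simp add: w_def)
    have nz: "zetaf w \<noteq> 0" using h(2,3)[OF w] elim e by auto
    have "of_real \<epsilon> * mangoldt_series w * zetaf w = of_real \<epsilon> * (zetaf w / (w - 1) - deriv zetaf w)"
      using mangoldt_series_zetaf[OF Re] by simp
    also have "\<dots> = (of_real \<epsilon> / (w - 1) - of_nat k - of_real \<epsilon> * (deriv h w / h w)) * zetaf w"
      using log_deriv[OF w] unfolding e by (simp add: algebra_simps)
    finally show ?case using nz by (simp add: w_def)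
  qed
  have lim_w: "((\<lambda>\<epsilon>::real. s0 + of_real \<epsilon>) \<longlongrightarrow> s0) (at_right 0)"
    by (auto intro!: tendsto_eq_intros)
  have s0b: "s0 \<in> ball s0 r" using r by simp
  have cont: "isCont h s0" "isCont (deriv h) s0"
    using holomorphic_on_imp_continuous_on[OF h(1)] holomorphic_on_imp_continuous_on[OF holomorphic_deriv[OF h(1) open_ball]] s0b
    by (auto simp: continuous_on_eq_continuous_at)
  have "((\<lambda>\<epsilon>. deriv h (s0 + of_real \<epsilon>) / h (s0 + of_real \<epsilon>)) \<longlongrightarrow> deriv h s0 / h s0) (at_right (0::real))"
    by (rule tendsto_divide[OF isCont_tendsto_compose[OF cont(2) lim_w] isCont_tendsto_compose[OF cont(1) lim_w] h(3)[OF s0b]])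
  moreover have "((\<lambda>\<epsilon>::real. of_real \<epsilon> / (s0 + of_real \<epsilon> - 1)) \<longlongrightarrow> (if s0 = 1 then 1 else 0)) (at_right 0)"
  proof (cases "s0 = 1")
    case True
    have "eventually (\<lambda>\<epsilon>::real. of_real \<epsilon> / (s0 + of_real \<epsilon> - 1) = 1) (at_right 0)"
      using eventually_at_right_less[of 0] by eventually_elim (simp add: True)
    from tendsto_eventually[OF this] show ?thesis by (simp only: True simp_thms if_True)
  next
    case False
    then show ?thesis by (auto intro!: tendsto_eq_intros)
  qed
  ultimately have "((\<lambda>\<epsilon>. of_real \<epsilon> / (s0 + of_real \<epsilon> - 1) - of_nat k - of_real \<epsilon> * (deriv h (s0 + of_real \<epsilon>) / h (s0 + of_real \<epsilon>)))
     \<longlongrightarrow> (if s0 = 1 then 1 else 0) - of_nat k - of_real 0 * (deriv h s0 / h s0)) (at_right (0::real))"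
    by (intro tendsto_diff tendsto_mult tendsto_const tendsto_of_real) auto
  then have "((\<lambda>\<epsilon>::real. of_real \<epsilon> * mangoldt_series (s0 + of_real \<epsilon>)) \<longlongrightarrow> (if s0 = 1 then 1 else 0) - of_nat k) (at_right 0)"
    using ev by (subst tendsto_cong[OF ev]) simp
  with k show ?thesis by blast
qed

lemma Re_mangoldt_powr:
  "Re (mangoldt (Suc n) * of_nat (Suc n) powr (- Complex \<sigma> t)) =
     mangoldt (Suc n) * real (Suc n) powr (-\<sigma>) * cos (t * ln (real (Suc n)))"
proof -
  have "(of_nat (Suc n) :: complex) powr (- Complex \<sigma> t) = exp (- Complex \<sigma> t * of_real (ln (real (Suc n))))"
    using Ln_of_nat[of "Suc n"] by (simp add: powr_def del: of_nat_Suc)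
  then have "Re ((of_nat (Suc n) :: complex) powr (- Complex \<sigma> t)) = real (Suc n) powr (-\<sigma>) * cos (t * ln (real (Suc n)))"
    by (simp add: Re_exp powr_def)
  moreover have "Re (mangoldt (Suc n) * z) = mangoldt (Suc n) * Re z" for z
    by (simp)
  ultimately show ?thesis by (simp only: mult.assoc)
qed

text \<open>Termwise from \<open>3 + 4 * cos x + cos (2 * x) = 2 * (1 + cos x)\<^sup>2\<close> with
  \<open>x = t * ln n\<close>, as the coefficients are non-negative.\<close>

lemma mangoldt_series_3_4_1:
  assumes "\<sigma> > 1"
  shows "3 * Re (mangoldt_series (of_real \<sigma>)) + 4 * Re (mangoldt_series (Complex \<sigma> t)) + Re (mangoldt_series (Complex \<sigma> (2 * t))) \<ge> 0"
proof -
  define u where "u = (\<lambda>n t. mangoldt (Suc n) * real (Suc n) powr (-\<sigma>) * cos (t * ln (real (Suc n))))"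
  have sums: "(\<lambda>n. u n t) sums Re (mangoldt_series (Complex \<sigma> t))" for t
    unfolding u_def Re_mangoldt_powr[symmetric] 
    using assms by (intro sums_Re mangoldt_series_sums) simp
  have "(\<lambda>n. 3 * u n 0 + 4 * u n t + u n (2 * t)) sums (3 * Re (mangoldt_series (Complex \<sigma> 0)) +
     4 * Re (mangoldt_series (Complex \<sigma> t)) + Re (mangoldt_series (Complex \<sigma> (2 * t))))"
    by (intro sums_add sums_mult sums)
  moreover have "3 * u n 0 + 4 * u n t + u n (2 * t) \<ge> 0" for n
  proof -
    define x where "x = t * ln (real (Suc n))"
    have "3 * u n 0 + 4 * u n t + u n (2 * t) = mangoldt (Suc n) * real (Suc n) powr (-\<sigma>) * (3 + 4 * cos x + cos (2 * x))"
      by (simp add: u_def x_def algebra_simps)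
    also have "3 + 4 * cos x + cos (2 * x) = 2 * (1 + cos x)\<^sup>2"
      unfolding cos_double_cos by (simp add: power2_eq_square algebra_simps)
    finally show ?thesis by (simp add: mangoldt_nonneg)
  qed
  ultimately have "0 \<le> 3 * Re (mangoldt_series (Complex \<sigma> 0)) +
     4 * Re (mangoldt_series (Complex \<sigma> t)) + Re (mangoldt_series (Complex \<sigma> (2 * t)))"
    by (rule sums_le[OF _ sums_zero, rotated])
  then show ?thesis by (simp only: complex_of_real_def)
qed

lemma norm_mangoldt_series_le:
  assumes "Re s \<ge> \<sigma>" "\<sigma> > 1"
  shows "norm (mangoldt_series s) \<le> (\<Sum>n. mangoldt (Suc n) * real (Suc n) powr (-\<sigma>))"
proof -
  have s: "Re s > 1" using assms by simp
  have "norm (mangoldt_series s) \<le> (\<Sum>n. norm (mangoldt (Suc n) * of_nat (Suc n) powr (-s) :: complex))"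
    unfolding mangoldt_series_def
    by (rule summable_norm) (use summable_mangoldt_powr[OF s] in \<open>simp only: norm_mangoldt_powr\<close>)
  also have "\<dots> \<le> (\<Sum>n. mangoldt (Suc n) * real (Suc n) powr (-\<sigma>))"
    unfolding norm_mangoldt_powr
    by (intro suminf_le summable_mangoldt_powr mult_left_mono powr_mono) (use s assms in \<open>auto simp: mangoldt_nonneg\<close>)
  finally show ?thesis .
qed

text \<open>For \<open>Re s0 > 1\<close> the Mangoldt series is bounded near \<open>s0\<close>, so
  its residue \<open>-k\<close> vanishes. On the line, the residues at 1, 1 + it and 1 + 2it are 1,
  \<open>-k\<close> and \<open>-k2\<close>; the 3-4-1 inequality gives
  \<open>3 - 4 * k - k2 \<ge> 0\<close>, which fails for \<open>k \<ge> 1\<close>.\<close>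

theorem zetaf_nonzero:
  assumes s0: "Re s0 \<ge> 1"
  shows "zetaf s0 \<noteq> 0"
proof
  assume zero: "zetaf s0 = 0"
  then have ne1: "s0 \<noteq> 1" by auto
  obtain k where k: "k > 0"
    and lim: "((\<lambda>\<epsilon>::real. of_real \<epsilon> * mangoldt_series (s0 + of_real \<epsilon>)) \<longlongrightarrow> - of_nat k) (at_right 0)"
    using mangoldt_series_residue[OF s0] zero ne1 by auto
  consider "Re s0 > 1" | "Re s0 = 1" using s0 by linarith
  then show False
  proof cases
    case 1
    define C where "C = (\<Sum>n. mangoldt (Suc n) * real (Suc n) powr (-Re s0))"
    have "((\<lambda>\<epsilon>::real. of_real \<epsilon> * mangoldt_series (s0 + of_real \<epsilon>)) \<longlongrightarrow> 0) (at_right 0)"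
    proof (rule Lim_null_comparison)
      show "eventually (\<lambda>\<epsilon>::real. norm (of_real \<epsilon> * mangoldt_series (s0 + of_real \<epsilon>)) \<le> \<epsilon> * C) (at_right 0)"
        using eventually_at_right_less[of 0]
      proof eventually_elim
        case (elim \<epsilon>)
        then show ?case unfolding norm_mult C_def
          by (intro mult_mono norm_mangoldt_series_le) (use 1 in auto)
      qed
      show "((\<lambda>\<epsilon>. \<epsilon> * C) \<longlongrightarrow> 0) (at_right 0)" by (auto intro!: tendsto_eq_intros)
    qed
    with lim have "- of_nat k = (0::complex)" by (intro tendsto_unique[OF _ lim]) auto
    with k show False by simp
  next
    case 2
    define t where "t = Im s0"
    have s0_eq: "s0 = Complex 1 t" using 2 by (simp add: t_def complex_eq_iff)
    with ne1 have "t \<noteq> 0" by (auto simp: complex_eq_iff)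
    have k1: "((\<lambda>\<epsilon>::real. of_real \<epsilon> * mangoldt_series (1 + of_real \<epsilon>)) \<longlongrightarrow> 1) (at_right 0)"
      using mangoldt_series_residue[of 1] by auto
    obtain k2 where k2: "((\<lambda>\<epsilon>::real. of_real \<epsilon> * mangoldt_series (Complex 1 (2 * t) + of_real \<epsilon>)) \<longlongrightarrow> - of_nat k2) (at_right 0)"
      using mangoldt_series_residue[of "Complex 1 (2 * t)"] \<open>t \<noteq> 0\<close> by (auto simp: complex_eq_iff)
    have "((\<lambda>\<epsilon>::real. 3 * Re (of_real \<epsilon> * mangoldt_series (1 + of_real \<epsilon>)) + 4 * Re (of_real \<epsilon> * mangoldt_series (s0 + of_real \<epsilon>))
      + Re (of_real \<epsilon> * mangoldt_series (Complex 1 (2 * t) + of_real \<epsilon>))) \<longlongrightarrow>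
      3 * Re 1 + 4 * Re (- of_nat k) + Re (- of_nat k2)) (at_right 0)"
      by (intro tendsto_intros k1 k2 lim)
    moreover have "eventually (\<lambda>\<epsilon>::real. 3 * Re (of_real \<epsilon> * mangoldt_series (1 + of_real \<epsilon>)) + 4 * Re (of_real \<epsilon> * mangoldt_series (s0 + of_real \<epsilon>))
      + Re (of_real \<epsilon> * mangoldt_series (Complex 1 (2 * t) + of_real \<epsilon>)) \<ge> 0) (at_right 0)"
      using eventually_at_right_less[of 0]
    proof eventually_elim
      case (elim \<epsilon>)
      have eq: "Complex 1 u + of_real \<epsilon> = Complex (1 + \<epsilon>) u" for u by (simp add: complex_eq_iff)
      have "0 \<le> \<epsilon> * (3 * Re (mangoldt_series (of_real (1 + \<epsilon>))) + 4 * Re (mangoldt_series (Complex (1 + \<epsilon>) t))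
          + Re (mangoldt_series (Complex (1 + \<epsilon>) (2 * t))))"
        using mangoldt_series_3_4_1[of "1 + \<epsilon>" t] elim by (intro mult_nonneg_nonneg) auto
      then show ?case unfolding s0_eq eq by (simp add: algebra_simps)
    qed
    ultimately have "3 * Re 1 + 4 * Re (- of_nat k) + Re (- of_nat k2) \<ge> 0"
      by (intro tendsto_lowerbound) auto
    then have "3 - 4 * real k - real k2 \<ge> 0" by simp
    then show False using k by linarith
  qed
qed

section \<open>Newman's Tauberian theorem\<close>

text \<open>Dominated convergence: the power has modulus at most 1 and tends to 0 inside the
  segment. Working on the open parameter interval lets the endpoints lie on the imaginary axis,
  where there is no decay.\<close>

lemma contour_integral_powr_tendsto_0:
  assumes cont: "continuous_on (closed_segment a b) h"
    and neg: "\<And>x. 0 < x \<Longrightarrow> x < 1 \<Longrightarrow> Re (linepath a b x) < 0"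
  shows "(\<lambda>n. contour_integral (linepath a b) (\<lambda>z. h z * of_nat (Suc n) powr z)) \<longlonglongrightarrow> 0"
proof -
  define l where "l = linepath a b"
  have l_in: "l x \<in> closed_segment a b" if "x \<in> {0..1}" for x
    using that linepath_in_path unfolding l_def by auto
  have cl: "continuous_on {0..1} l" unfolding l_def by (intro continuous_intros)
  have chl: "continuous_on {0..1} (\<lambda>x. h (l x))"
    by (rule continuous_on_compose2[OF cont cl]) (use l_in in auto)
  define u where "u = (\<lambda>n x. h (l x) * of_nat (Suc n) powr (l x) * (b - a))"
  have cu: "continuous_on {0..1} (u n)" for n
  proof -
    have "continuous_on {0..1} (\<lambda>x. (of_nat (Suc n) :: complex) powr (l x))"
      by (intro continuous_on_powr_complex cl continuous_intros)
         (auto simp: complex_nonpos_Reals_iff simp del: of_nat_Suc)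
    then show ?thesis unfolding u_def by (intro continuous_on_mult continuous_on_const chl)
  qed
  have ci: "contour_integral (linepath a b) (\<lambda>z. h z * of_nat (Suc n) powr z) = integral {0<..<1} (u n)" for n
  proof -
    have "(u n has_integral integral {0..1} (u n)) {0..1}"
      using cu by (simp add: integrable_continuous_real integrable_integral)
    then have "((\<lambda>z. h z * of_nat (Suc n) powr z) has_contour_integral integral {0..1} (u n)) (linepath a b)"
      by (simp add: has_contour_integral_linepath u_def l_def)
    then show ?thesis by (simp add: contour_integral_unique integral_open_interval_real)
  qed
  have "bounded ((\<lambda>x. h (l x) * (b - a)) ` {0..1})"
    by (intro compact_imp_bounded compact_continuous_image continuous_intros chl) auto
  then obtain M where M: "\<And>x. x \<in> {0..1} \<Longrightarrow> norm (h (l x) * (b - a)) \<le> M"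
    unfolding bounded_iff by blast
  have nu: "norm (u n x) = norm (h (l x) * (b - a)) * real (Suc n) powr Re (l x)" for n x
    by (simp add: u_def norm_mult norm_powr_real_powr del: of_nat_Suc)
  have "(\<lambda>n. integral {0<..<1} (u n)) \<longlonglongrightarrow> integral {0<..<1} (\<lambda>_::real. 0::complex)"
  proof (rule dominated_convergence(2))
    show "u n integrable_on {0<..<1}" for n
      using cu[of n] by (simp add: integrable_on_open_interval_real integrable_continuous_real)
    show "(\<lambda>_. M) integrable_on {0<..<(1::real)}"
      by (simp add: integrable_on_open_interval_real integrable_continuous_real)
    show "norm (u n x) \<le> M" if "x \<in> {0<..<1}" for n x
    proof -
      have "real (Suc n) powr Re (l x) \<le> real (Suc n) powr 0"
        using neg[of x] that by (intro powr_mono) (auto simp: l_def)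
      then have "norm (h (l x) * (b - a)) * real (Suc n) powr Re (l x) \<le> norm (h (l x) * (b - a)) * 1"
        by (intro mult_left_mono) auto
      with M[of x] that show ?thesis unfolding nu by simp
    qed
    show "(\<lambda>n. u n x) \<longlonglongrightarrow> 0" if "x \<in> {0<..<1}" for x
    proof (rule tendsto_norm_zero_cancel)
      have "(\<lambda>n. real (Suc n) powr Re (l x)) \<longlonglongrightarrow> 0"
        using neg[of x] that
        by (intro tendsto_neg_powr filterlim_compose[OF filterlim_real_sequentially filterlim_Suc]) (auto simp: l_def)
      from tendsto_mult_right_zero[OF this] show "(\<lambda>n. norm (u n x)) \<longlonglongrightarrow> 0" by (simp only: nu)
    qed
  qed
  then show ?thesis unfolding ci by simp
qed

text \<open>On the circle \<open>1 / z\<close> is \<open>cnj z / R\<^sup>2\<close>, so the kernel is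
  \<open>2 * Re z / R\<^sup>2\<close>. It vanishes where the circle meets the imaginary axis and so
  cancels the factor \<open>1 / \<bar>Re z\<bar>\<close> in the bounds for partial sums and
  tails.\<close>

lemma norm_newman_kernel:
  assumes "norm z = R" "R > 0"
  shows "norm (1 / z + z / of_real (R\<^sup>2)) = 2 * \<bar>Re z\<bar> / R\<^sup>2"
proof -
  have nz: "z \<noteq> 0" using assms by auto
  have "z * cnj z = of_real (R\<^sup>2)" using assms by (metis complex_norm_square of_real_power)
  then have "1 / z = cnj z / of_real (R\<^sup>2)"
    using nz assms by (simp add: field_simps)
  then have "1 / z + z / of_real (R\<^sup>2) = (z + cnj z) / of_real (R\<^sup>2)" by (simp add: add_divide_distrib)
  also have "\<dots> = of_real (2 * Re z / R\<^sup>2)" by (simp add: complex_add_cnj)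
  finally show ?thesis using assms by (simp add: norm_divide norm_mult norm_power del: of_real_divide of_real_mult of_real_power)
qed

text \<open>The circle path starts at the point \<open>R\<close>, so its right half falls into a
  first and a last quarter.\<close>

lemma circlepath_integral_split:
  fixes f :: "complex \<Rightarrow> complex"
  assumes R: "R > 0" and cont: "continuous_on (sphere 0 R) f"
  shows "contour_integral (circlepath 0 R) f =
    contour_integral (part_circlepath 0 R 0 (pi/2)) f + contour_integral (part_circlepath 0 R (pi/2) (3*pi/2)) f
    + contour_integral (part_circlepath 0 R (3*pi/2) (2*pi)) f"
proof -
  define q where "q = (\<lambda>t. f (of_real R * cis t) * of_real R * \<i> * cis t)"
  have "continuous_on A (\<lambda>t. f (of_real R * cis t))" for A
    by (rule continuous_on_compose2[OF cont]) (use R in \<open>auto intro!: continuous_intros simp: norm_mult\<close>)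
  then have "continuous_on A q" for A
    unfolding q_def by (intro continuous_intros)
  then have int: "q integrable_on {a..b}" for a b by (rule integrable_continuous_real)
  have eq: "contour_integral (part_circlepath 0 R a b) f = integral {a..b} q" if "a < b" for a b
    using that by (simp add: contour_integral_part_circlepath_eq q_def)
  have "integral {0..2*pi} q = integral {0..pi/2} q + integral {pi/2..3*pi/2} q + integral {3*pi/2..2*pi} q"
    by (simp add: Henstock_Kurzweil_Integration.integral_combine[OF _ _ int])
  then show ?thesis by (simp add: circlepath_def eq)
qed

text \<open>Cauchy's formula with Newman's kernel expresses the partial sum at 0 as an integral over
  a circle. On the right half \<open>g\<close> is subtracted, on the left half the entire partial
  sum is estimated directly; both parts are O(C / R) uniformly in \<open>N\<close>. What remains is
  the integral of \<open>g\<close> over the right half, which is moved to two chords in the left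
  half-plane and there tends to 0.\<close>

lemma newman_tauberian:
  fixes c :: "nat \<Rightarrow> complex \<Rightarrow> complex"
  assumes hol: "\<And>n. c n holomorphic_on UNIV"
    and bound: "\<And>n z. Re z \<noteq> 0 \<Longrightarrow>
      norm (c n z) \<le> C * ((real (Suc n) powr (-Re z) - real (Suc (Suc n)) powr (-Re z)) / Re z)"
    and U: "open U" "{z. Re z \<ge> 0} \<subseteq> U" "g holomorphic_on U"
    and sums: "\<And>z. Re z > 0 \<Longrightarrow> (\<lambda>n. c n z) sums g z"
    and g0: "g 0 = 0"
  shows "(\<lambda>n. c n 0) sums 0"
proof -
  define f where "f = (\<lambda>N z. \<Sum>n<N. c n z)"
  have C: "C \<ge> 0"
  proof -
    have "0 \<le> C * (1 - 1 / 2)"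
      using order_trans[OF norm_ge_zero bound[of 1 0]] by (simp add: powr_minus)
    then show ?thesis by simp
  qed
  have tele: "(\<Sum>n<N. (real (Suc n) powr a - real (Suc (Suc n)) powr a) / b) = (1 - real (Suc N) powr a) / b" for a b N
    by (induction N) (auto simp: diff_divide_distrib)
  have bound_left: "norm (f N z) \<le> C * real (Suc N) powr (-Re z) / \<bar>Re z\<bar>" if z: "Re z < 0" for N z
  proof -
    have "norm (f N z) \<le> (\<Sum>n<N. C * ((real (Suc n) powr (-Re z) - real (Suc (Suc n)) powr (-Re z)) / Re z))"
      unfolding f_def by (rule sum_norm_le) (use bound z in auto)
    also have "\<dots> = C * ((1 - real (Suc N) powr (-Re z)) / Re z)"
      by (simp only: sum_distrib_left[symmetric] tele)
    also have "\<dots> \<le> C * (real (Suc N) powr (-Re z) / \<bar>Re z\<bar>)"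
      using z by (intro mult_left_mono C) (simp add: field_simps)
    finally show ?thesis by simp
  qed
  have bound_right: "norm (f N z - g z) \<le> C * real (Suc N) powr (-Re z) / \<bar>Re z\<bar>" if z: "Re z > 0" for N z
  proof -
    have lim: "(\<lambda>n. real (Suc n) powr (-Re z)) \<longlonglongrightarrow> 0"
      using z by (intro tendsto_neg_powr filterlim_compose[OF filterlim_real_sequentially filterlim_Suc]) auto
    have s1: "(\<lambda>n. c (n + N) z) sums (g z - f N z)"
      unfolding f_def using sums_iff_shift'[of "\<lambda>n. c n z" N "g z"] sums[OF z] by simp
    have "(\<lambda>n. real (Suc (n + N)) powr (-Re z)) \<longlonglongrightarrow> 0"
      by (rule LIMSEQ_ignore_initial_segment[OF lim])
    from sums_mult[OF sums_divide[OF telescope_sums'[OF this]], of C "Re z"]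
    have s2: "(\<lambda>n. C * ((real (Suc (n + N)) powr (-Re z) - real (Suc (Suc (n + N))) powr (-Re z)) / Re z)) sums
       (C * (real (Suc N) powr (-Re z) / Re z))" by simp
    have "norm (g z - f N z) \<le> C * (real (Suc N) powr (-Re z) / Re z)"
      by (rule norm_sums_le[OF s1 s2]) (rule bound, use z in simp)
    with z show ?thesis by (simp add: norm_minus_commute)
  qed
  have "(\<lambda>N. f N 0) \<longlonglongrightarrow> 0"
  proof (rule LIMSEQ_I)
    fix e :: real assume e: "e > 0"
    \<comment> \<open>After division by 2 pi the arcs contribute at most \<open>2 * C / R\<close>,
      which this choice makes at most \<open>e / 2\<close>.\<close>
    define R where "R = max 1 (4 * C / e)"
    have R: "R > 0" "2 * C / R \<le> e / 2" using e by (auto simp: R_def field_simps max_def)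
    \<comment> \<open>Compactness yields a uniform width \<open>d0\<close> by which \<open>U\<close>
      extends to the left of the imaginary axis, at bounded height.\<close>
    have "compact {z. norm z \<le> R + 1 \<and> Re z \<ge> 0}"
    proof -
      have "{z. norm z \<le> R + 1 \<and> Re z \<ge> 0} = cball 0 (R + 1) \<inter> {z. Re z \<ge> 0}" by auto
      then show ?thesis by (simp add: compact_Int_closed closed_halfspace_Re_ge)
    qed
    then obtain d0 where d0: "d0 > 0" "(\<Union>x\<in>{z. norm z \<le> R + 1 \<and> Re z \<ge> 0}. ball x d0) \<subseteq> U"
      using U(1,2) by (elim compact_subset_open_imp_ball_epsilon_subset) auto
    define D where "D = ball 0 (R + 1) \<inter> {z. Re z > - d0}"
    define d where "d = min (d0 / 2) R"
    have d: "d > 0" "d \<le> R" "d < d0" using d0 R by (auto simp: d_def min_def)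
    have D: "open D" "convex D" unfolding D_def
      by (auto intro!: convex_Int convex_halfspace_Re_gt open_halfspace_Re_gt open_Int)
    have DU: "D \<subseteq> U"
    proof
      fix z assume "z \<in> D"
      then have z: "norm z < R + 1" "Re z > - d0" by (auto simp: D_def)
      show "z \<in> U"
      proof (cases "Re z \<ge> 0")
        case True
        with U(2) show ?thesis by auto
      next
        case False
        have "norm (Complex 0 (Im z)) \<le> norm z" using abs_Im_le_cmod[of z] by (simp add: cmod_def)
        moreover have "norm (Complex 0 (Im z) - z) = - Re z" using False by (simp add: cmod_def)
        ultimately have "z \<in> (\<Union>x\<in>{z. norm z \<le> R + 1 \<and> Re z \<ge> 0}. ball x d0)"
          using z by (intro UN_I[of "Complex 0 (Im z)"]) (auto simp: dist_norm)
        then show ?thesis using d0(2) by (rule rev_subsetD)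
      qed
    qed
    \<comment> \<open>This is \<open>g\<close> times the kernel, with the singularity at 0 filled
      in; it is removable because \<open>g 0 = 0\<close>.\<close>
    define h where "h = (\<lambda>z. (if z = 0 then deriv g 0 else (g z - g 0) / (z - 0)) * (1 + z\<^sup>2 / of_real (R\<^sup>2)))"
    have h: "h holomorphic_on D"
      unfolding h_def using holomorphic_on_subset[OF U(3) DU] D R
      by (intro holomorphic_intros pole_lemma_open) auto
    define X where "X = (\<lambda>N z. (of_nat (Suc N) :: complex) powr z)"
    have X: "X N holomorphic_on A" for N A unfolding X_def by (intro holomorphic_intros)
    define K where "K = (\<lambda>z. 1 / z + z / of_real (R\<^sup>2) :: complex)"
    have gK: "g z * K z = h z" if "z \<noteq> 0" for z
      using that R by (simp add: h_def K_def g0 field_simps power2_eq_square)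
    have in_D: "z \<in> D" if "norm z \<le> R" "Re z \<ge> -d" for z
      using that R d by (auto simp: D_def)
    let ?A1 = "part_circlepath 0 R 0 (pi/2)" and ?A2 = "part_circlepath 0 R (pi/2) (3*pi/2)"
      and ?A3 = "part_circlepath 0 R (3*pi/2) (2*pi)"
    have arc: "norm z = R" if "z \<in> path_image (part_circlepath 0 R a b)" for z a b
      using path_image_part_circlepath_subset'[of R 0 a b] that R by auto
    have arc1: "Re z \<ge> 0" if "z \<in> path_image ?A1" for z
      using that R by (auto simp: path_image_part_circlepath' closed_segment_eq_real_ivl intro!: mult_nonneg_nonneg cos_ge_zero)
    have arc3: "Re z \<ge> 0" if z: "z \<in> path_image ?A3" for z
    proof -
      obtain t where t: "t \<in> {3*pi/2..2*pi}" "z = R * cis t"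
        using z by (auto simp: path_image_part_circlepath' closed_segment_eq_real_ivl)
      have "cos t = cos (t - 2 * pi)" by (simp add: cos_diff)
      also have "\<dots> \<ge> 0" using t by (intro cos_ge_zero) auto
      finally show ?thesis using t R by simp
    qed
    have arc2: "Re z \<le> 0" if z: "z \<in> path_image ?A2" for z
    proof -
      obtain t where t: "t \<in> {pi/2..3*pi/2}" "z = R * cis t"
        using z by (auto simp: path_image_part_circlepath' closed_segment_eq_real_ivl)
      have "cos (t - pi) \<ge> 0" using t by (intro cos_ge_zero) auto
      then have "cos t \<le> 0" by (simp add: cos_diff)
      then show ?thesis using t R by (simp add: mult_nonneg_nonpos)
    qed
    \<comment> \<open>The growth factors cancel, and so do the two occurrences of
      \<open>\<bar>Re z\<bar>\<close>. On the imaginary axis the kernel itself is 0, so there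
      \<open>w\<close> needs no bound.\<close>
    have est: "norm (w * (X N z * K z)) \<le> 2 * C / R\<^sup>2"
      if z: "norm z = R" and w: "Re z \<noteq> 0 \<Longrightarrow> norm w \<le> C * real (Suc N) powr (-Re z) / \<bar>Re z\<bar>" for w z N
    proof (cases "Re z = 0")
      case True
      then show ?thesis using norm_newman_kernel[OF z] R C by (simp add: K_def norm_mult)
    next
      case False
      have "norm (w * (X N z * K z)) = norm w * (real (Suc N) powr (Re z) * (2 * \<bar>Re z\<bar> / R\<^sup>2))"
        using norm_newman_kernel[OF z] R by (simp add: K_def X_def norm_mult norm_powr_real_powr del: of_nat_Suc)
      also have "\<dots> \<le> C * real (Suc N) powr (-Re z) / \<bar>Re z\<bar> * (real (Suc N) powr (Re z) * (2 * \<bar>Re z\<bar> / R\<^sup>2))"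
        by (intro mult_right_mono w False) auto
      also have "\<dots> = 2 * C / R\<^sup>2"
        using False by (simp add: powr_minus field_simps del: of_nat_Suc)
      finally show ?thesis .
    qed
    define I where "I = (\<lambda>N. contour_integral (linepath (- \<i> * R) (- of_real d)) (\<lambda>z. h z * X N z)
       + contour_integral (linepath (- of_real d) (\<i> * R)) (\<lambda>z. h z * X N z))"
    have seg: "closed_segment (- \<i> * R) (- of_real d) \<subseteq> D" "closed_segment (- of_real d) (\<i> * R) \<subseteq> D"
      using R d by (simp_all add: closed_segment_subset in_D D norm_mult)
    have "I \<longlonglongrightarrow> 0 + 0" unfolding I_def X_def
      by (intro tendsto_add contour_integral_powr_tendsto_0
           holomorphic_on_imp_continuous_on[OF holomorphic_on_subset[OF h]] seg)
         (use d in \<open>auto simp: linepath_def\<close>)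
    then have "eventually (\<lambda>N. norm (I N) < e) sequentially"
      using e by (auto simp: tendsto_iff)
    moreover have "norm (f N 0) < e" if IN: "norm (I N) < e" for N
    proof -
      have fh: "f N holomorphic_on A" for A
        unfolding f_def using hol by (intro holomorphic_intros) (auto intro: holomorphic_on_subset)
      define \<phi> where "\<phi> = (\<lambda>z. f N z * X N z * (1 + z\<^sup>2 / of_real (R\<^sup>2)))"
      have "\<phi> holomorphic_on cball 0 R" unfolding \<phi>_def
        using R by (intro holomorphic_intros fh X) auto
      from Cauchy_integral_circlepath_simple[OF this, of 0] R
      have "((\<lambda>u. \<phi> u / u) has_contour_integral 2 * of_real pi * \<i> * \<phi> 0) (circlepath 0 R)" by simp
      then have "((\<lambda>u. f N u * (X N u * K u)) has_contour_integral 2 * of_real pi * \<i> * \<phi> 0) (circlepath 0 R)"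
        by (rule has_contour_integral_eq) (use R in \<open>auto simp: \<phi>_def K_def field_simps power2_eq_square\<close>)
      moreover have "\<phi> 0 = f N 0" by (simp add: \<phi>_def X_def del: of_nat_Suc)
      ultimately have cauchy: "contour_integral (circlepath 0 R) (\<lambda>u. f N u * (X N u * K u)) = 2 * of_real pi * \<i> * f N 0"
        by (simp add: contour_integral_unique)
      have nz: "z \<noteq> 0" if "norm z = R" for z :: complex using that R by auto
      have cK: "continuous_on A (\<lambda>u. X N u * K u)" if "0 \<notin> A" for A
        unfolding K_def using that R
        by (intro continuous_intros holomorphic_on_imp_continuous_on[OF X]) auto
      have cf: "continuous_on A (\<lambda>u. f N u * (X N u * K u))" if "0 \<notin> A" for A
        by (intro continuous_on_mult cK that holomorphic_on_imp_continuous_on[OF fh])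
      have cg: "continuous_on A (\<lambda>u. g u * (X N u * K u))" if "0 \<notin> A" "A \<subseteq> U" for A
        by (intro continuous_on_mult cK that holomorphic_on_imp_continuous_on[OF holomorphic_on_subset[OF U(3)]])
      have split: "2 * of_real pi * \<i> * f N 0 = contour_integral ?A1 (\<lambda>u. f N u * (X N u * K u)) +
         contour_integral ?A2 (\<lambda>u. f N u * (X N u * K u)) + contour_integral ?A3 (\<lambda>u. f N u * (X N u * K u))"
        unfolding cauchy[symmetric] using R by (intro circlepath_integral_split cf) auto
      have right: "contour_integral A (\<lambda>u. f N u * (X N u * K u)) =
          contour_integral A (\<lambda>u. (f N u - g u) * (X N u * K u)) + contour_integral A (\<lambda>z. h z * X N z)"
        and right_bound: "norm (contour_integral A (\<lambda>u. (f N u - g u) * (X N u * K u))) \<le> 2 * C / R\<^sup>2 * R * \<bar>b - a\<bar>"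
        if A: "A = part_circlepath 0 R a b" and pos: "\<And>z. z \<in> path_image A \<Longrightarrow> Re z \<ge> 0" for A a b
      proof -
        have sub: "0 \<notin> path_image A" "path_image A \<subseteq> U"
          using arc[of 0 a b] pos U(2) R unfolding A by auto
        have i1: "(\<lambda>u. f N u * (X N u * K u)) contour_integrable_on A"
          and i2: "(\<lambda>u. g u * (X N u * K u)) contour_integrable_on A"
          using cf[OF sub(1)] cg[OF sub] unfolding A by (auto intro: contour_integrable_continuous_part_circlepath)
        have "contour_integral A (\<lambda>u. (f N u - g u) * (X N u * K u)) =
           contour_integral A (\<lambda>u. f N u * (X N u * K u)) - contour_integral A (\<lambda>u. g u * (X N u * K u))"
          using contour_integral_diff[OF i1 i2] by (simp add: left_diff_distrib)
        moreover have "contour_integral A (\<lambda>u. g u * (X N u * K u)) = contour_integral A (\<lambda>z. h z * X N z)"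
        proof (rule contour_integral_eq)
          fix z assume "z \<in> path_image A"
          then have "z \<noteq> 0" using sub by auto
          then show "g z * (X N z * K z) = h z * X N z" by (simp add: gK[symmetric])
        qed
        ultimately show "contour_integral A (\<lambda>u. f N u * (X N u * K u)) =
          contour_integral A (\<lambda>u. (f N u - g u) * (X N u * K u)) + contour_integral A (\<lambda>z. h z * X N z)" by simp
        show "norm (contour_integral A (\<lambda>u. (f N u - g u) * (X N u * K u))) \<le> 2 * C / R\<^sup>2 * R * \<bar>b - a\<bar>"
          unfolding A
        proof (rule contour_integral_bound_part_circlepath)
          show "(\<lambda>u. (f N u - g u) * (X N u * K u)) contour_integrable_on part_circlepath 0 R a b"
            using contour_integrable_diff[OF i1 i2] by (simp add: left_diff_distrib A)
          fix z assume z: "z \<in> path_image (part_circlepath 0 R a b)"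
          then have "Re z \<ge> 0" using pos A by auto
          then show "norm ((f N z - g z) * (X N z * K z)) \<le> 2 * C / R\<^sup>2"
            by (intro est arc[OF z] bound_right) auto
        qed (use C R in auto)
      qed
      have left: "norm (contour_integral ?A2 (\<lambda>u. f N u * (X N u * K u))) \<le> 2 * C / R\<^sup>2 * R * \<bar>3*pi/2 - pi/2\<bar>"
      proof (rule contour_integral_bound_part_circlepath)
        show "(\<lambda>u. f N u * (X N u * K u)) contour_integrable_on ?A2"
          by (intro contour_integrable_continuous_part_circlepath cf) (use arc[of 0] R in auto)
        fix z assume z: "z \<in> path_image ?A2"
        then show "norm (f N z * (X N z * K z)) \<le> 2 * C / R\<^sup>2"
          using arc2[OF z] by (intro est arc[OF z] bound_left) auto
      qed (use C R in auto)
      \<comment> \<open>\<open>D\<close> is convex, so a primitive exists and the integrals depend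
        on endpoints only: the right half circle from \<open>- \<i> * R\<close> to
        \<open>\<i> * R\<close> may be replaced by the two chords through \<open>-d\<close>.\<close>
      have "(\<lambda>z. h z * X N z) holomorphic_on D" by (intro holomorphic_intros h X)
      then obtain Pm where Pm: "\<And>x. x \<in> D \<Longrightarrow> (Pm has_field_derivative h x * X N x) (at x within D)"
        using holomorphic_convex_primitive'[OF D(2,1)] by blast
      have prim: "contour_integral A (\<lambda>z. h z * X N z) = Pm (pathfinish A) - Pm (pathstart A)"
        if "valid_path A" "path_image A \<subseteq> D" for A
        by (rule contour_integral_unique, rule contour_integral_primitive[OF Pm that])
      have ends: "pathstart ?A1 = of_real R" "pathfinish ?A1 = \<i> * R" "pathstart ?A3 = - \<i> * R" "pathfinish ?A3 = of_real R"
        unfolding pathstart_part_circlepath pathfinish_part_circlepath cis_conv_exp[symmetric]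
        using cos_3over2_pi sin_3over2_pi by (simp_all add: complex_eq_iff)
      have sub13: "path_image ?A1 \<subseteq> D" "path_image ?A3 \<subseteq> D"
        using arc arc1 arc3 d by (force intro!: in_D)+
      have "contour_integral ?A1 (\<lambda>z. h z * X N z) + contour_integral ?A3 (\<lambda>z. h z * X N z) = I N"
        unfolding I_def using seg sub13
        by (simp only: prim ends valid_path_part_circlepath valid_path_linepath path_image_linepath
              pathstart_linepath pathfinish_linepath) simp
      then have "2 * of_real pi * \<i> * f N 0 = contour_integral ?A1 (\<lambda>u. (f N u - g u) * (X N u * K u)) +
         contour_integral ?A2 (\<lambda>u. f N u * (X N u * K u)) + contour_integral ?A3 (\<lambda>u. (f N u - g u) * (X N u * K u)) + I N"
        using split right[OF refl arc1] right[OF refl arc3] by simp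
      then have "norm (2 * of_real pi * \<i> * f N 0) \<le> norm (contour_integral ?A1 (\<lambda>u. (f N u - g u) * (X N u * K u))) +
         norm (contour_integral ?A2 (\<lambda>u. f N u * (X N u * K u))) + norm (contour_integral ?A3 (\<lambda>u. (f N u - g u) * (X N u * K u))) + norm (I N)"
        by (simp only:) (intro norm_triangle_mono order_refl)
      also have "\<dots> \<le> 2 * C / R\<^sup>2 * R * \<bar>pi/2 - 0\<bar> + 2 * C / R\<^sup>2 * R * \<bar>3*pi/2 - pi/2\<bar> + 2 * C / R\<^sup>2 * R * \<bar>2*pi - 3*pi/2\<bar> + norm (I N)"
        by (intro add_mono right_bound[OF refl arc1] right_bound[OF refl arc3] left order_refl)
      also have "\<dots> = 2 * pi * (2 * C / R) + norm (I N)"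
        using R by (simp add: power2_eq_square field_simps)
      finally have "2 * pi * norm (f N 0) \<le> 2 * pi * (2 * C / R) + norm (I N)"
        by (simp add: norm_mult)
      also have "\<dots> < 2 * pi * (e / 2) + e" using R IN by (intro add_le_less_mono mult_left_mono) auto
      also have "\<dots> \<le> 2 * pi * e" using pi_gt3 e by (simp add: field_simps)
      finally show ?thesis by simp
    qed
    ultimately show "\<exists>N0. \<forall>N\<ge>N0. norm (f N 0 - 0) < e"
      by (auto simp: eventually_sequentially)
  qed
  then show ?thesis by (simp add: sums_def f_def)
qed

section \<open>Chebyshev bound\<close>

definition psi :: "nat \<Rightarrow> real" where
  "psi n = (\<Sum>k\<in>{1..n}. mangoldt k)"

lemma psi_nonneg: "psi n \<ge> 0"
  unfolding psi_def by (intro sum_nonneg mangoldt_nonneg)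

lemma psi_mono: "m \<le> n \<Longrightarrow> psi m \<le> psi n"
  unfolding psi_def by (intro sum_mono2) (auto simp: mangoldt_nonneg)

text \<open>Each \<open>ln k\<close> is a divisor sum of \<open>mangoldt\<close>, and exactly
  \<open>n div d\<close> of the numbers up to \<open>n\<close> are multiples of
  \<open>d\<close>.\<close>

lemma ln_fact_eq_mangoldt_sum:
  "ln (fact n :: real) = (\<Sum>d\<in>{1..n}. mangoldt d * real (n div d))"
proof -
  have "ln (fact n :: real) = (\<Sum>k\<in>{1..n}. ln (real k))"
    unfolding fact_prod of_nat_prod by (rule ln_prod) auto
  also have "\<dots> = (\<Sum>k\<in>{1..n}. \<Sum>d | d \<in> {1..n} \<and> d dvd k. mangoldt d)"
  proof (intro sum.cong refl)
    fix k assume k: "k \<in> {1..n}"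
    then have "ln (real k) = (\<Sum>d | d dvd k. mangoldt d)" using mangoldt_sum[of k, where 'a = real] by simp
    also have "{d. d dvd k} = {d. d \<in> {1..n} \<and> d dvd k}"
      using k by (auto dest: dvd_imp_le intro: order_trans Nat.gr0I)
    finally show "ln (real k) = (\<Sum>d | d \<in> {1..n} \<and> d dvd k. mangoldt d)" .
  qed
  also have "\<dots> = (\<Sum>d\<in>{1..n}. \<Sum>k | k \<in> {1..n} \<and> d dvd k. mangoldt d)"
    by (rule sum.swap_restrict) auto
  also have "\<dots> = (\<Sum>d\<in>{1..n}. mangoldt d * real (n div d))"
  proof (intro sum.cong refl)
    fix d assume d: "d \<in> {1..n}"
    have "{k. k \<in> {1..n} \<and> d dvd k} = (\<lambda>j. d * j) ` {1..n div d}"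
    proof (intro equalityI subsetI)
      fix k assume "k \<in> {k. k \<in> {1..n} \<and> d dvd k}"
      then obtain j where j: "k = d * j" "1 \<le> k" "k \<le> n" by (auto elim: dvdE)
      then have "j \<ge> 1" "j \<le> n div d" using d by (auto simp: less_eq_div_iff_mult_less_eq mult.commute intro: Nat.gr0I Suc_leI)
      with j show "k \<in> (\<lambda>j. d * j) ` {1..n div d}" by auto
    next
      fix k assume "k \<in> (\<lambda>j. d * j) ` {1..n div d}"
      then show "k \<in> {k. k \<in> {1..n} \<and> d dvd k}" using d
        by (auto simp: less_eq_div_iff_mult_less_eq mult.commute)
    qed
    moreover have "inj_on (\<lambda>j. d * j) {1..n div d}" using d by (auto simp: inj_on_def)
    ultimately have "card {k. k \<in> {1..n} \<and> d dvd k} = n div d" by (simp add: card_image)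
    then show "(\<Sum>k | k \<in> {1..n} \<and> d dvd k. mangoldt d) = mangoldt d * real (n div d)"
      by simp
  qed
  finally show ?thesis .
qed

text \<open>Chebyshev's argument: \<open>2 * n div d - 2 * (n div d)\<close> is never negative and
  is at least 1 for \<open>n < d \<le> 2 * n\<close>, while weighting it with
  \<open>mangoldt d\<close> gives the logarithm of the central binomial coefficient.\<close>

lemma psi_double: "psi (2 * n) - psi n \<le> 2 * real n * ln 2"
proof -
  have "psi (2 * n) - psi n = (\<Sum>k\<in>{1..2*n} - {1..n}. mangoldt k)"
    unfolding psi_def by (subst sum_diff) auto
  also have "\<dots> \<le> (\<Sum>d\<in>{1..2*n}. mangoldt d * (real (2 * n div d) - 2 * real (n div d)))"
  proof -
    have nonneg: "real (2 * n div d) - 2 * real (n div d) \<ge> 0" for d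
    proof -
      have "2 * (n div d) \<le> 2 * n div d" by (cases "d = 0") (simp_all add: less_eq_div_iff_mult_less_eq)
      then have "real (2 * (n div d)) \<le> real (2 * n div d)" by (rule of_nat_mono)
      then show ?thesis by simp
    qed
    have "(\<Sum>k\<in>{1..2*n} - {1..n}. mangoldt k) \<le> 
       (\<Sum>d\<in>{1..2*n} - {1..n}. mangoldt d * (real (2 * n div d) - 2 * real (n div d)))"
    proof (rule sum_mono)
      fix d assume "d \<in> {1..2*n} - {1..n}"
      then have "n div d = 0" "2 * n div d \<ge> 1" by (auto simp: less_eq_div_iff_mult_less_eq Suc_le_eq div_greater_zero_iff)
      then have "mangoldt d * 1 \<le> mangoldt d * (real (2 * n div d) - 2 * real (n div d))"
        by (intro mult_left_mono mangoldt_nonneg) auto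
      then show "mangoldt d \<le> mangoldt d * (real (2 * n div d) - 2 * real (n div d))" by simp
    qed
    also have "\<dots> \<le> (\<Sum>d\<in>{1..2*n}. mangoldt d * (real (2 * n div d) - 2 * real (n div d)))"
      using nonneg by (intro sum_mono2) (auto intro!: mult_nonneg_nonneg mangoldt_nonneg)
    finally show ?thesis .
  qed
  also have "\<dots> = (\<Sum>d\<in>{1..2*n}. mangoldt d * real (2 * n div d)) - 2 * (\<Sum>d\<in>{1..2*n}. mangoldt d * real (n div d))"
    by (simp add: algebra_simps sum_subtractf sum_distrib_left)
  also have "(\<Sum>d\<in>{1..2*n}. mangoldt d * real (n div d)) = (\<Sum>d\<in>{1..n}. mangoldt d * real (n div d))"
    by (rule sum.mono_neutral_right) auto
  also have "(\<Sum>d\<in>{1..2*n}. mangoldt d * real (2 * n div d)) - 2 * (\<Sum>d\<in>{1..n}. mangoldt d * real (n div d))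
      = ln (fact (2 * n)) - 2 * ln (fact n)"
    by (simp only: ln_fact_eq_mangoldt_sum)
  also have "\<dots> = ln (real (2 * n choose n))"
  proof -
    have "real (2 * n choose n) = fact (2 * n) / (fact n * fact n)"
      using binomial_fact[of n "2 * n", where 'a = real] by simp
    then show ?thesis by (simp add: ln_div ln_mult del: binomial_eq_0_iff)
  qed
  also have "\<dots> \<le> ln (2 ^ (2 * n))"
  proof -
    have "2 * n choose n \<le> 2 ^ (2 * n)" by (rule binomial_le_pow2)
    then have "real (2 * n choose n) \<le> real (2 ^ (2 * n))" by (rule of_nat_mono)
    moreover have "2 * n choose n > 0" by simp
    ultimately show ?thesis by (subst ln_le_cancel_iff) auto
  qed
  also have "\<dots> = 2 * real n * ln 2" by (simp add: ln_realpow)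
  finally show ?thesis .
qed

text \<open>Halving \<open>n\<close>. The constant 4 leaves room for replacing \<open>ln 2\<close>
  by 1 and, when \<open>n\<close> is odd, for the last term, bounded by
  \<open>ln n \<le> n - 1\<close>.\<close>

lemma psi_le: "psi n \<le> 4 * real n"
proof (induction n rule: less_induct)
  case (less n)
  consider "n = 0" | m where "n = 2 * m" "m > 0" | m where "n = 2 * m + 1"
    by (metis Suc_eq_plus1 evenE gr0I oddE mult_0_right)
  then show ?case
  proof cases
    case 1
    then show ?thesis by (simp add: psi_def)
  next
    case (2 m)
    then have "psi n \<le> 4 * real m + 2 * real m * ln 2" using psi_double[of m] less.IH[of m] by simp
    also have "\<dots> \<le> 4 * real m + 2 * real m * 1" using ln_2_less_1 by (intro add_left_mono mult_left_mono) auto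
    finally show ?thesis using 2 by simp
  next
    case (3 m)
    have "psi n = psi (2 * m) + mangoldt n" by (simp add: psi_def 3)
    also have "mangoldt n \<le> ln (real n)" using 3 by (intro mangoldt_le) auto
    also have "\<dots> \<le> real n - 1" using 3 by (intro ln_le_minus_one) auto
    also have "psi (2 * m) \<le> 4 * real m + 2 * real m * ln 2" using psi_double[of m] less.IH[of m] 3 by simp
    also have "\<dots> \<le> 4 * real m + 2 * real m * 1" using ln_2_less_1 by (intro add_left_mono mult_left_mono) auto
    finally show ?thesis using 3 by simp
  qed
qed

section \<open>The prime number theorem\<close>

text \<open>Summation by parts: \<open>slab\<close> supplies the differences of consecutive powers,
  and the boundary term vanishes in the limit by the Chebyshev bound.\<close>

lemma psi_slab_sums:
  assumes s: "Re s > 1"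
  shows "(\<lambda>n. of_real (psi (Suc n)) * slab (Suc n) s) sums (mangoldt_series s / s)"
proof -
  have s0: "s \<noteq> 0" using s by auto
  define p where "p = (\<lambda>n. of_nat n powr (-s) :: complex)"
  have part: "(\<Sum>n<N. of_real (psi (Suc n)) * slab (Suc n) s) =
      ((\<Sum>n<N. mangoldt (Suc n) * p (Suc n)) - of_real (psi N) * p (Suc N)) / s" for N
  proof (induction N)
    case 0
    then show ?case by (simp add: psi_def)
  next
    case (Suc N)
    have "mangoldt (Suc N) = psi (Suc N) - psi N" by (simp add: psi_def)
    then have m: "mangoldt (Suc N) = (of_real (psi (Suc N)) - of_real (psi N) :: complex)"
      by (metis of_real_mangoldt of_real_diff)
    have sl: "slab (Suc N) s = (p (Suc N) - p (Suc (Suc N))) / s"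
      using slab_closed_form[OF zero_less_Suc s0, of N] by (simp only: p_def)
    show ?case
      unfolding sum.lessThan_Suc Suc.IH m sl using s0 by (simp add: divide_simps) (simp add: algebra_simps)
  qed
  have "(\<lambda>N. of_real (psi N) * p (Suc N)) \<longlonglongrightarrow> 0"
  proof (rule Lim_null_comparison)
    show "eventually (\<lambda>N. norm (of_real (psi N) * p (Suc N)) \<le> 4 * norm ((of_nat (Suc N) :: complex) powr (-(s - 1)))) sequentially"
    proof (intro always_eventually allI)
      fix N
      have "norm (of_real (psi N) * p (Suc N)) = psi N * real (Suc N) powr (-Re s)"
        by (simp add: p_def norm_mult norm_powr_real_powr psi_nonneg del: of_nat_Suc)
      also have "\<dots> \<le> (4 * real (Suc N)) * real (Suc N) powr (-Re s)"
        using psi_le[of N] by (intro mult_right_mono) auto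
      also have "\<dots> = 4 * real (Suc N) powr (1 - Re s)"
        by (simp add: powr_diff powr_minus field_simps del: of_nat_Suc)
      finally show "norm (of_real (psi N) * p (Suc N)) \<le> 4 * norm ((of_nat (Suc N) :: complex) powr (-(s - 1)))"
        by (simp add: norm_powr_real_powr del: of_nat_Suc)
    qed
    show "(\<lambda>N. 4 * norm ((of_nat (Suc N) :: complex) powr (-(s - 1)))) \<longlonglongrightarrow> 0"
      using s by (intro tendsto_mult_right_zero tendsto_norm_zero Suc_powr_tendsto_0) simp
  qed
  moreover have "(\<lambda>N. \<Sum>n<N. mangoldt (Suc n) * p (Suc n)) \<longlonglongrightarrow> mangoldt_series s"
    using mangoldt_series_sums[OF s] by (simp add: sums_def p_def)
  ultimately have "(\<lambda>N. ((\<Sum>n<N. mangoldt (Suc n) * p (Suc n)) - of_real (psi N) * p (Suc N)) / s) \<longlonglongrightarrow> (mangoldt_series s - 0) / s"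
    by (intro tendsto_divide tendsto_diff tendsto_const s0)
  then show ?thesis by (simp only: sums_def part diff_0_right)
qed

text \<open>The terms are the integrals of \<open>(psi n / x - 1) / x\<close> over the unit
  intervals beginning at \<open>Suc n\<close>, with \<open>psi\<close> constant on each.
  Continuation across the critical line rests on the non-vanishing of \<open>zetaf\<close>.\<close>

lemma psi_series_summable:
  "summable (\<lambda>n. psi (Suc n) * (1 / real (Suc n) - 1 / real (Suc (Suc n))) - (ln (real (Suc (Suc n))) - ln (real (Suc n))))"
proof -
  \<comment> \<open>For \<open>Re s > 1\<close> this is
    \<open>mangoldt_series s / s - 1 / (s - 1)\<close>, written so that the pole at 1 has
    disappeared.\<close>
  define G where "G = (\<lambda>s. - (deriv zetaf s / zetaf s + 1) / s)"
  \<comment> \<open>Subtracting \<open>\<gamma> / (1 + z)\<close> makes the limit function vanish at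
    0, as \<open>newman_tauberian\<close> asks; the convergent series of
    \<open>\<gamma> * slab (Suc n) 1\<close> is added back afterwards.\<close>
  define \<gamma> where "\<gamma> = G 1"
  define c where "c = (\<lambda>n z. (of_real (psi (Suc n)) - \<gamma>) * slab (Suc n) (1 + z) - slab (Suc n) z)"
  define g where "g = (\<lambda>z. G (1 + z) - \<gamma> / (1 + z))"
  let ?V = "{s. Re s > 0} \<inter> zetaf -` (-{0})"
  have opV: "open ?V"
    by (rule continuous_open_preimage) (auto simp: open_halfspace_Re_gt holomorphic_on_imp_continuous_on[OF zetaf_holomorphic])
  have G: "G holomorphic_on ?V"
    unfolding G_def
    by (intro holomorphic_intros holomorphic_on_subset[OF holomorphic_deriv[OF zetaf_holomorphic]]
         holomorphic_on_subset[OF zetaf_holomorphic]) (auto simp: open_halfspace_Re_gt)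
  define U where "U = (\<lambda>z. 1 + z) -` ?V"
  have opU: "open U" unfolding U_def by (intro open_vimage opV continuous_intros)
  have hol_slab: "slab (Suc n) holomorphic_on A" "(\<lambda>z. slab (Suc n) (1 + z)) holomorphic_on A" for n A
  proof -
    show "slab (Suc n) holomorphic_on A" by (rule holomorphic_on_subset[OF slab_holomorphic]) auto
    have "(slab (Suc n) \<circ> (\<lambda>z. 1 + z)) holomorphic_on A"
      by (rule holomorphic_on_compose_gen[OF _ slab_holomorphic]) (auto intro!: holomorphic_intros)
    then show "(\<lambda>z. slab (Suc n) (1 + z)) holomorphic_on A" by (simp add: o_def)
  qed
  have "(\<lambda>n. c n 0) sums 0"
  proof (rule newman_tauberian)
    show "c n holomorphic_on UNIV" for n
      unfolding c_def by (intro holomorphic_intros hol_slab)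
    \<comment> \<open>Of the constant 5, the Chebyshev bound accounts for 4 and the second
      \<open>slab\<close> for 1.\<close>
    show "norm (c n z) \<le> (5 + norm \<gamma>) * ((real (Suc n) powr (-Re z) - real (Suc (Suc n)) powr (-Re z)) / Re z)"
      if z: "Re z \<noteq> 0" for n z
    proof -
      define E where "E = (real (Suc n) powr (-Re z) - real (Suc (Suc n)) powr (-Re z)) / Re z"
      have s1: "norm (slab (Suc n) z) \<le> E" unfolding E_def by (rule norm_slab_le) (use z in auto)
      then have E: "E \<ge> 0" using norm_ge_zero order_trans by blast
      have s2: "norm (slab (Suc n) (1 + z)) \<le> 1 / real (Suc n) * E" unfolding E_def by (rule norm_slab_Suc_le) (use z in auto)
      have "norm (of_real (psi (Suc n)) - \<gamma>) \<le> norm (complex_of_real (psi (Suc n))) + norm \<gamma>" by (rule norm_triangle_ineq4)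
      also have "\<dots> \<le> 4 * real (Suc n) + norm \<gamma> * real (Suc n)"
        using psi_le[of "Suc n"] psi_nonneg[of "Suc n"]
        by (intro add_mono) (auto simp: mult_le_cancel_left1)
      finally have "norm (of_real (psi (Suc n)) - \<gamma>) \<le> (4 + norm \<gamma>) * real (Suc n)" by (simp add: algebra_simps)
      then have "norm ((of_real (psi (Suc n)) - \<gamma>) * slab (Suc n) (1 + z)) \<le> ((4 + norm \<gamma>) * real (Suc n)) * (1 / real (Suc n) * E)"
        unfolding norm_mult using s2 by (intro mult_mono) auto
      also have "\<dots> = (4 + norm \<gamma>) * E" by simp
      finally have "norm (c n z) \<le> (4 + norm \<gamma>) * E + E"
        unfolding c_def using s1 by (intro norm_triangle_le_diff add_mono) auto
      then show ?thesis unfolding E_def[symmetric] by (simp add: algebra_simps)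
    qed
    show "open U" by (rule opU)
    show "{z. Re z \<ge> 0} \<subseteq> U" using zetaf_nonzero by (auto simp: U_def)
    show "g holomorphic_on U"
    proof -
      have "(G \<circ> (\<lambda>z. 1 + z)) holomorphic_on U"
        by (rule holomorphic_on_compose_gen[OF _ G]) (auto simp: U_def intro!: holomorphic_intros)
      moreover have "1 + z \<noteq> 0" if "z \<in> U" for z using that by (auto simp: U_def complex_eq_iff)
      ultimately show ?thesis unfolding g_def o_def by (intro holomorphic_intros) auto
    qed
    show "g 0 = 0" by (simp add: g_def \<gamma>_def)
    show "(\<lambda>n. c n z) sums g z" if z: "Re z > 0" for z
    proof -
      define s where "s = 1 + z"
      have s: "Re s > 1" "s \<noteq> 0" "s \<noteq> 1" "z = s - 1" "z \<noteq> 0" using z by (auto simp: s_def complex_eq_iff)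
      have nz: "zetaf s \<noteq> 0" using zetaf_nonzero s by simp
      have ms: "mangoldt_series s = 1 / (s - 1) - deriv zetaf s / zetaf s"
        using mangoldt_series_zetaf[OF s(1)] nz by (simp add: field_simps)
      have "(\<lambda>n. of_real (psi (Suc n)) * slab (Suc n) s - \<gamma> * slab (Suc n) s - slab (Suc n) z) sums
          (mangoldt_series s / s - \<gamma> * (1 / s) - 1 / z)"
        using s z by (intro sums_diff sums_mult psi_slab_sums slab_sums) auto
      moreover have "mangoldt_series s / s - \<gamma> * (1 / s) - 1 / z = g z"
      proof -
        have "1 / (s - 1) / s - 1 / (s - 1) = - 1 / s"
          using s(2,3) by (simp add: divide_simps)
        then show ?thesis
          by (simp add: g_def G_def ms s_def[symmetric] s(4) diff_divide_distrib add_divide_distrib)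
      qed
      ultimately show ?thesis by (simp add: c_def s_def left_diff_distrib)
    qed
  qed
  moreover have "(\<lambda>n. \<gamma> * slab (Suc n) 1) sums (\<gamma> * (1 / 1))"
    by (intro sums_mult slab_sums) simp
  ultimately have "summable (\<lambda>n. c n 0 + \<gamma> * slab (Suc n) 1)"
    by (intro summable_add) (auto simp: sums_iff)
  moreover have "c n 0 + \<gamma> * slab (Suc n) 1 =
     of_real (psi (Suc n) * (1 / real (Suc n) - 1 / real (Suc (Suc n))) - (ln (real (Suc (Suc n))) - ln (real (Suc n))))" for n
  proof -
    have 1: "slab (Suc n) 1 = of_real (1 / real (Suc n) - 1 / real (Suc (Suc n)))"
      by (simp add: slab_closed_form powr_minus field_simps del: of_nat_Suc)
    have "((\<lambda>x. complex_of_real (1 / x)) has_integral of_real (ln (real (Suc n) + 1) - ln (real (Suc n)))) {real (Suc n)..real (Suc n) + 1}"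
    proof (rule has_integral_of_real)
      show "((\<lambda>x. 1 / x) has_integral ln (real (Suc n) + 1) - ln (real (Suc n))) {real (Suc n)..real (Suc n) + 1}"
        by (rule fundamental_theorem_of_calculus)
           (auto intro!: derivative_eq_intros simp: has_real_derivative_iff_has_vector_derivative[symmetric])
    qed
    moreover have "complex_of_real (1 / x) = of_real x powr (-1 - 0)" if "x \<in> {real (Suc n)..real (Suc n) + 1}" for x
      using that by (auto simp: powr_minus field_simps)
    ultimately have "((\<lambda>x. of_real x powr (-1 - 0)) has_integral complex_of_real (ln (real (Suc n) + 1) - ln (real (Suc n)))) {real (Suc n)..real (Suc n) + 1}"
      by (subst has_integral_cong[of _ _ "\<lambda>x. complex_of_real (1 / x)"]) auto
    then have 2: "slab (Suc n) 0 = of_real (ln (real (Suc n) + 1) - ln (real (Suc n)))"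
      unfolding slab_def by (rule integral_unique)
    show ?thesis by (simp add: c_def 1 2 algebra_simps)
  qed
  ultimately have "summable (\<lambda>n. complex_of_real (psi (Suc n) * (1 / real (Suc n) - 1 / real (Suc (Suc n))) - (ln (real (Suc (Suc n))) - ln (real (Suc n)))))"
    by simp
  then show ?thesis by (simp only: summable_complex_of_real)
qed

text \<open>Block sums of a convergent series are small. If \<open>psi a\<close> exceeded
  \<open>(1 + \<epsilon>) * a\<close>, monotonicity would keep \<open>psi\<close> large up to about
  \<open>(1 + \<epsilon> / 2) * a\<close>, and the block would sum to at least a fixed multiple of
  \<open>\<epsilon>\<^sup>2\<close>; a deficit is excluded in the same way by a block to the
  left.\<close>

theorem psi_asymptotics: "(\<lambda>n. psi n / real n) \<longlonglongrightarrow> 1"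
proof -
  define t where "t = (\<lambda>k. psi k * (1 / real k - 1 / real (Suc k)) - (ln (real (Suc k)) - ln (real k)))"
  have "summable t"
    using psi_series_summable summable_Suc_iff[of t] by (simp add: t_def)
  then have cauchy: "\<exists>N. \<forall>a\<ge>N. \<forall>b. \<bar>sum t {a..<b}\<bar> < e" if "e > 0" for e
    using that by (simp add: summable_Cauchy)
  have tele1: "(\<Sum>k\<in>{a..<b}. 1 / real k - 1 / real (Suc k)) = 1 / real a - 1 / real b" if "a \<le> b" for a b
    using that by (induction b rule: dec_induct) auto
  have tele2: "(\<Sum>k\<in>{a..<b}. ln (real (Suc k)) - ln (real k)) = ln (real b) - ln (real a)" if "a \<le> b" for a b
    using that by (induction b rule: dec_induct) auto
  have sum_t: "sum t {a..<b} = (\<Sum>k\<in>{a..<b}. psi k * (1 / real k - 1 / real (Suc k))) - (ln (real b) - ln (real a))"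
    if "a \<le> b" for a b
    using tele2[OF that] by (simp add: t_def sum_subtractf del: of_nat_Suc)
  have diff_nonneg: "1 / real k - 1 / real (Suc k) \<ge> 0" if "k > 0" for k
    using that by (simp add: field_simps)
  have lower: "sum t {a..<b} \<ge> psi a * (1 / real a - 1 / real b) - (ln (real b) - ln (real a))" if "a \<le> b" "a > 0" for a b
  proof -
    have "psi a * (1 / real a - 1 / real b) = (\<Sum>k\<in>{a..<b}. psi a * (1 / real k - 1 / real (Suc k)))"
      by (simp only: tele1[OF that(1)] sum_distrib_left[symmetric])
    also have "\<dots> \<le> (\<Sum>k\<in>{a..<b}. psi k * (1 / real k - 1 / real (Suc k)))"
      using that by (intro sum_mono mult_right_mono psi_mono diff_nonneg) auto
    finally show ?thesis using sum_t[OF that(1)] by simp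
  qed
  have upper: "sum t {a..<b} \<le> psi b * (1 / real a - 1 / real b) - (ln (real b) - ln (real a))" if "a \<le> b" "a > 0" for a b
  proof -
    have "(\<Sum>k\<in>{a..<b}. psi k * (1 / real k - 1 / real (Suc k))) \<le> (\<Sum>k\<in>{a..<b}. psi b * (1 / real k - 1 / real (Suc k)))"
      using that by (intro sum_mono mult_right_mono psi_mono diff_nonneg) auto
    also have "\<dots> = psi b * (1 / real a - 1 / real b)"
      by (simp only: tele1[OF that(1)] sum_distrib_left[symmetric])
    finally show ?thesis using sum_t[OF that(1)] by simp
  qed
  have ev_upper: "eventually (\<lambda>n. psi n \<le> (1 + \<epsilon>) * real n) sequentially" if \<epsilon>: "0 < \<epsilon>" "\<epsilon> < 1" for \<epsilon>
  proof -
    obtain N where N: "\<And>a b. a \<ge> N \<Longrightarrow> \<bar>sum t {a..<b}\<bar> < \<epsilon>\<^sup>2 / 16"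
      using cauchy[of "\<epsilon>\<^sup>2 / 16"] \<epsilon> by auto
    have "psi a \<le> (1 + \<epsilon>) * real a" if a: "a \<ge> N" "real a \<ge> 4 / \<epsilon>" for a
    proof (rule ccontr)
      assume "\<not> psi a \<le> (1 + \<epsilon>) * real a"
      then have big: "psi a \<ge> (1 + \<epsilon>) * real a" by simp
      have a0: "real a > 0" using a(2) \<epsilon> by (smt (verit) divide_pos_pos)
      \<comment> \<open>The rounding error is at most \<open>\<epsilon> / 4 * a\<close>, so that
        \<open>x - 1\<close> stays above \<open>\<epsilon> / 2\<close> and
        \<open>1 + \<epsilon> - x\<close> above \<open>\<epsilon> / 4\<close>.\<close>
      define b where "b = nat \<lceil>(1 + \<epsilon> / 2) * real a\<rceil>"
      define x where "x = real b / real a"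
      have b1: "real b \<ge> (1 + \<epsilon> / 2) * real a" unfolding b_def by linarith
      have "real b \<le> (1 + \<epsilon> / 2) * real a + 1"
        unfolding b_def using \<epsilon> a0 by (simp add: of_nat_nat)
      moreover have "1 \<le> \<epsilon> / 4 * real a" using a(2) \<epsilon> by (simp add: field_simps)
      ultimately have b2: "real b \<le> (1 + 3 * \<epsilon> / 4) * real a" by (simp add: algebra_simps)
      have x: "1 + \<epsilon> / 2 \<le> x" "x \<le> 1 + 3 * \<epsilon> / 4" using b1 b2 a0 by (auto simp: x_def field_simps)
      have x2: "x > 0" "x \<le> 2" using x \<epsilon> by auto
      have "real a * 1 \<le> real a * (1 + \<epsilon> / 2)" using \<epsilon> by (intro mult_left_mono) auto
      then have ab: "a \<le> b" using b1 by (simp add: mult.commute)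
      have b0: "real b > 0" using ab a0 by simp
      have "\<epsilon>\<^sup>2 / 16 \<le> (\<epsilon> / 2) * (\<epsilon> / 4) / 2" by (simp add: power2_eq_square)
      also have "\<dots> \<le> (x - 1) * (1 + \<epsilon> - x) / x"
        using x x2 \<epsilon> by (intro frac_le mult_mono mult_nonneg_nonneg) auto
      also have "\<dots> = (1 + \<epsilon>) * (1 - 1 / x) - (x - 1)" using x2 by (simp add: field_simps)
      also have "\<dots> \<le> (1 + \<epsilon>) * (1 - 1 / x) - ln x" using ln_le_minus_one[of x] x2 by simp
      also have "ln x = ln (real b) - ln (real a)" using a0 b0 by (simp add: x_def ln_div)
      also have "(1 + \<epsilon>) * (1 - 1 / x) = (1 + \<epsilon>) * real a * (1 / real a - 1 / real b)"
        using a0 b0 by (simp add: x_def field_simps)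
      also have "\<dots> \<le> psi a * (1 / real a - 1 / real b)"
        using big ab a0 by (intro mult_right_mono) (auto simp: field_simps)
      also have "psi a * (1 / real a - 1 / real b) - (ln (real b) - ln (real a)) \<le> sum t {a..<b}"
        using lower[OF ab] a0 by simp
      finally show False using N[OF a(1), of b] by simp
    qed
    moreover have "eventually (\<lambda>n. n \<ge> N \<and> real n \<ge> 4 / \<epsilon>) sequentially"
      by (intro eventually_conj eventually_ge_at_top) real_asymp
    ultimately show ?thesis by (auto elim: eventually_mono)
  qed
  have ev_lower: "eventually (\<lambda>n. psi n \<ge> (1 - \<epsilon>) * real n) sequentially" if \<epsilon>: "0 < \<epsilon>" "\<epsilon> < 1" for \<epsilon>
  proof -
    obtain N where N: "\<And>a b. a \<ge> N \<Longrightarrow> \<bar>sum t {a..<b}\<bar> < \<epsilon>\<^sup>2 / 8"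
      using cauchy[of "\<epsilon>\<^sup>2 / 8"] \<epsilon> by auto
    have "psi b \<ge> (1 - \<epsilon>) * real b" if b: "b \<ge> 2 * N" "real b \<ge> 4 / \<epsilon>" for b
    proof (rule ccontr)
      assume "\<not> psi b \<ge> (1 - \<epsilon>) * real b"
      then have small: "psi b \<le> (1 - \<epsilon>) * real b" by simp
      have b0: "real b > 0" using b(2) \<epsilon> by (smt (verit) divide_pos_pos)
      \<comment> \<open>The block now ends at \<open>b\<close>. Its start is at least
        \<open>b / 2\<close>, which is why \<open>b\<close> was taken beyond
        \<open>2 * N\<close>.\<close>
      define a where "a = nat \<lceil>(1 - \<epsilon> / 2) * real b\<rceil>"
      define y where "y = real a / real b"
      have a1: "real a \<ge> (1 - \<epsilon> / 2) * real b" unfolding a_def by linarith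
      have "real a \<le> (1 - \<epsilon> / 2) * real b + 1"
        unfolding a_def using \<epsilon> b0 by (simp add: of_nat_nat)
      moreover have "1 \<le> \<epsilon> / 4 * real b" using b(2) \<epsilon> by (simp add: field_simps)
      ultimately have a2: "real a \<le> (1 - \<epsilon> / 4) * real b" by (simp add: algebra_simps)
      have y: "1 - \<epsilon> / 2 \<le> y" "y \<le> 1 - \<epsilon> / 4" using a1 a2 b0 by (auto simp: y_def field_simps)
      have y2: "y > 0" "y \<le> 1" using y \<epsilon> by auto
      have "(1 - \<epsilon> / 4) * real b \<le> 1 * real b" using \<epsilon> by (intro mult_right_mono) auto
      then have ab: "a \<le> b" using a2 by simp
      have "1 / 2 * real b \<le> (1 - \<epsilon> / 2) * real b" using \<epsilon> by (intro mult_right_mono) auto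
      then have "real a \<ge> 1 / 2 * real b" using a1 by linarith
      then have aN: "a \<ge> N" and a0: "real a > 0" using b(1) b0 by linarith+
      have "sum t {a..<b} \<le> psi b * (1 / real a - 1 / real b) - (ln (real b) - ln (real a))"
        using upper[OF ab] a0 by simp
      also have "psi b * (1 / real a - 1 / real b) \<le> (1 - \<epsilon>) * real b * (1 / real a - 1 / real b)"
        using small ab a0 b0 by (intro mult_right_mono) (auto simp: field_simps)
      also have "\<dots> = (1 - \<epsilon>) * (1 / y - 1)" using a0 b0 by (simp add: y_def field_simps)
      also have "ln (real b) - ln (real a) = - ln y" using a0 b0 by (simp add: y_def ln_div)
      also have "(1 - \<epsilon>) * (1 / y - 1) - - ln y \<le> (1 - \<epsilon>) * (1 / y - 1) - (1 - y)"
        using ln_le_minus_one[of y] y2 by simp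
      also have "\<dots> = - ((1 - y) * (y - (1 - \<epsilon>)) / y)" using y2 by (simp add: field_simps)
      also have "\<dots> \<le> - ((\<epsilon> / 4) * (\<epsilon> / 2) / 1)"
        using y y2 \<epsilon> by (intro le_imp_neg_le frac_le mult_mono mult_nonneg_nonneg) auto
      also have "\<dots> = - (\<epsilon>\<^sup>2 / 8)" by (simp add: power2_eq_square)
      finally show False using N[OF aN, of b] by simp
    qed
    moreover have "eventually (\<lambda>n. n \<ge> 2 * N \<and> real n \<ge> 4 / \<epsilon>) sequentially"
      by (intro eventually_conj eventually_ge_at_top) real_asymp
    ultimately show ?thesis by (auto elim: eventually_mono)
  qed
  show ?thesis
  proof (rule tendstoI)
    fix e :: real assume "e > 0"
    define \<epsilon> where "\<epsilon> = min (e / 2) (1 / 2)"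
    have \<epsilon>: "0 < \<epsilon>" "\<epsilon> < 1" "\<epsilon> < e" using \<open>e > 0\<close> by (auto simp: \<epsilon>_def)
    show "eventually (\<lambda>n. dist (psi n / real n) 1 < e) sequentially"
      using ev_upper[OF \<epsilon>(1,2)] ev_lower[OF \<epsilon>(1,2)] eventually_gt_at_top[of 0]
    proof eventually_elim
      case (elim n)
      then have "psi n / real n \<le> 1 + \<epsilon>" "psi n / real n \<ge> 1 - \<epsilon>" by (simp_all add: field_simps)
      with \<epsilon> show ?case by (simp add: dist_real_def)
    qed
  qed
qed

section \<open>From prime powers to primes\<close>

definition theta :: "nat \<Rightarrow> real" where
  "theta n = (\<Sum>p | prime p \<and> p \<le> n. ln (real p))"

text \<open>A prime power \<open>p ^ j \<le> n\<close> with \<open>j \<ge> 2\<close> has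
  \<open>p \<le> sqrt n\<close> and \<open>j \<le> log 2 n\<close>; counting the pairs
  \<open>(p, j)\<close> bounds the number of proper prime powers, each of weight at most
  \<open>ln n\<close>.\<close>

lemma psi_minus_theta:
  assumes "n > 0"
  shows "theta n \<le> psi n" "psi n \<le> theta n + sqrt (real n) * log 2 (real n) * ln (real n)"
proof -
  let ?A = "{p. prime p \<and> p \<le> n}"
  let ?B = "{k\<in>{1..n}. primepow k \<and> \<not> prime k}"
  have fin: "finite ?A" by (rule finite_subset[of _ "{..n}"]) auto
  have "psi n = (\<Sum>k\<in>?A \<union> ?B. mangoldt k)"
    unfolding psi_def
    by (rule sum.mono_neutral_right) (auto simp: mangoldt_def prime_gt_0_nat Suc_le_eq)
  also have "\<dots> = (\<Sum>k\<in>?A. mangoldt k) + (\<Sum>k\<in>?B. mangoldt k)"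
    using fin by (intro sum.union_disjoint) auto
  also have "(\<Sum>k\<in>?A. mangoldt k) = theta n"
    unfolding theta_def by (intro sum.cong) auto
  finally have eq: "psi n = theta n + (\<Sum>k\<in>?B. mangoldt k)" .
  then show "theta n \<le> psi n" by (simp add: sum_nonneg mangoldt_nonneg)
  have sub: "?B \<subseteq> (\<lambda>(b, j). b ^ j) ` ({1..nat \<lfloor>sqrt (real n)\<rfloor>} \<times> {1..nat \<lfloor>log 2 (real n)\<rfloor>})"
  proof
    fix k assume k: "k \<in> ?B"
    then obtain p j where pj: "prime p" "j > 0" "k = p ^ j" by (auto simp: primepow_def)
    have "j \<noteq> 1" using k pj by auto
    then have j: "j \<ge> 2" using pj by simp
    have p2: "p \<ge> 2" using pj(1) by (rule prime_ge_2_nat)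
    have "p ^ 2 \<le> p ^ j" using j p2 by (intro power_increasing) auto
    then have "p ^ 2 \<le> n" using k pj by auto
    then have "real p ^ 2 \<le> real n" by (metis of_nat_le_iff of_nat_power)
    then have "real p \<le> sqrt (real n)" by (rule real_le_rsqrt)
    then have 1: "p \<in> {1..nat \<lfloor>sqrt (real n)\<rfloor>}" using p2 by (auto simp: le_nat_floor)
    have "(2::nat) ^ j \<le> p ^ j" using p2 by (intro power_mono) auto
    also have "p ^ j \<le> n" using k pj by auto
    finally have "2 ^ j \<le> n" .
    then have "real j \<le> log 2 (real n)" by (rule le_log2_of_power)
    then have 2: "j \<in> {1..nat \<lfloor>log 2 (real n)\<rfloor>}" using j by (auto simp: le_nat_floor)
    show "k \<in> (\<lambda>(b, j). b ^ j) ` ({1..nat \<lfloor>sqrt (real n)\<rfloor>} \<times> {1..nat \<lfloor>log 2 (real n)\<rfloor>})"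
      using pj(3) by (intro image_eqI[where x = "(p, j)"] SigmaI 1 2) simp
  qed
  have "card ?B \<le> card ({1..nat \<lfloor>sqrt (real n)\<rfloor>} \<times> {1..nat \<lfloor>log 2 (real n)\<rfloor>})"
    by (rule surj_card_le[OF _ sub]) auto
  then have "real (card ?B) \<le> real (nat \<lfloor>sqrt (real n)\<rfloor> * nat \<lfloor>log 2 (real n)\<rfloor>)"
    by (simp only: card_cartesian_product card_atLeastAtMost of_nat_le_iff) simp
  also have "\<dots> \<le> sqrt (real n) * log 2 (real n)"
    unfolding of_nat_mult using assms by (intro mult_mono) auto
  finally have card: "real (card ?B) \<le> sqrt (real n) * log 2 (real n)" .
  have "(\<Sum>k\<in>?B. mangoldt k) \<le> (\<Sum>k\<in>?B. ln (real n))"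
  proof (rule sum_mono)
    fix k assume "k \<in> ?B"
    then have "k > 0" "k \<le> n" by auto
    then show "mangoldt k \<le> ln (real n)" using mangoldt_le[of k] by (smt (verit) ln_mono of_nat_0_less_iff of_nat_le_iff)
  qed
  also have "\<dots> = real (card ?B) * ln (real n)" by simp
  also have "\<dots> \<le> sqrt (real n) * log 2 (real n) * ln (real n)"
    using assms by (intro mult_right_mono card) auto
  finally show "psi n \<le> theta n + sqrt (real n) * log 2 (real n) * ln (real n)" using eq by simp
qed

theorem prime_number_theorem: "(\<lambda>n. theta n / real n) \<longlonglongrightarrow> 1"
proof (rule tendsto_sandwich)
  show "eventually (\<lambda>n. psi n / real n - sqrt (real n) * log 2 (real n) * ln (real n) / real n \<le> theta n / real n) sequentially"
    using eventually_gt_at_top[of 0]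
  proof eventually_elim
    case (elim n)
    then have "psi n - sqrt (real n) * log 2 (real n) * ln (real n) \<le> theta n"
      using psi_minus_theta(2)[of n] by simp
    then show ?case unfolding diff_divide_distrib[symmetric] by (rule divide_right_mono) simp
  qed
  show "eventually (\<lambda>n. theta n / real n \<le> psi n / real n) sequentially"
    using eventually_gt_at_top[of 0]
  proof eventually_elim
    case (elim n)
    then show ?case using psi_minus_theta(1)[of n] by (simp add: divide_right_mono)
  qed
  have "(\<lambda>n. sqrt (real n) * log 2 (real n) * ln (real n) / real n) \<longlonglongrightarrow> 0" by real_asymp
  from tendsto_diff[OF psi_asymptotics this]
  show "(\<lambda>n. psi n / real n - sqrt (real n) * log 2 (real n) * ln (real n) / real n) \<longlonglongrightarrow> 1" by simp
qed (rule psi_asymptotics)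

section \<open>The exchange inequality for elements of F\<close>

lemma S_pos_iff:
  assumes "n > 0"
  shows "S r n > 0 \<longleftrightarrow> (\<forall>p\<in>prime_factors n. r < p)"
proof -
  have "S r n > 0 \<longleftrightarrow> (\<forall>p\<in>prime_factors n. (if p \<le> r then 0 else p ^ (multiplicity p n - 1) * (p - r)) \<noteq> 0)"
    by (simp add: S_def prod_zero_iff flip: neq0_conv)
  also have "\<dots> \<longleftrightarrow> (\<forall>p\<in>prime_factors n. r < p)"
    by (intro ball_cong) (auto simp: not_le)
  finally show ?thesis .
qed

lemma B_iff: "n \<in> B r \<longleftrightarrow> n > 0 \<and> (\<forall>p. prime p \<longrightarrow> p dvd n \<longrightarrow> r < p)"
  using S_pos_iff[of n r] by (auto simp: B_def prime_factors_dvd)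

text \<open>For \<open>n\<close> in \<open>B r\<close> this is \<open>S r n / n\<close>, which
  depends only on the set of primes of \<open>n\<close>; for \<open>r = 1\<close> it is Euler's
  phi(n) / n.\<close>

definition totient_ratio :: "nat \<Rightarrow> nat set \<Rightarrow> real" where
  "totient_ratio r A = (\<Prod>p\<in>A. 1 - real r / real p)"

lemma S_eq_totient_ratio:
  assumes "n \<in> B r"
  shows "real (S r n) = real n * totient_ratio r (prime_factors n)"
proof -
  have n: "n > 0" "\<And>p. p \<in> prime_factors n \<Longrightarrow> r < p"
    using assms by (auto simp: B_iff prime_factors_dvd)
  have "real (S r n) = (\<Prod>p\<in>prime_factors n. real p ^ multiplicity p n * (1 - real r / real p))"
    unfolding S_def of_nat_prod
  proof (intro prod.cong refl)
    fix p assume p: "p \<in> prime_factors n"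
    then have "r < p" "multiplicity p n > 0" using n by (auto simp: prime_factors_multiplicity)
    then show "real (if p \<le> r then 0 else p ^ (multiplicity p n - 1) * (p - r)) =
        real p ^ multiplicity p n * (1 - real r / real p)"
      by (cases "multiplicity p n") (auto simp: field_simps of_nat_diff)
  qed
  also have "\<dots> = real (\<Prod>p\<in>prime_factors n. p ^ multiplicity p n) * totient_ratio r (prime_factors n)"
    by (simp add: prod.distrib totient_ratio_def)
  also have "(\<Prod>p\<in>prime_factors n. p ^ multiplicity p n) = n"
    using prime_factorization_nat[of n] n by simp
  finally show ?thesis .
qed

lemma totient_ratio_factor: "r < p \<Longrightarrow> 0 < 1 - real r / real p \<and> 1 - real r / real p \<le> 1"
  by (auto simp: field_simps)

lemma totient_ratio_pos: "(\<And>p. p \<in> A \<Longrightarrow> r < p) \<Longrightarrow> totient_ratio r A > 0"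
  unfolding totient_ratio_def by (intro prod_pos) (use totient_ratio_factor in blast)

lemma totient_ratio_le_1: "(\<And>p. p \<in> A \<Longrightarrow> r < p) \<Longrightarrow> totient_ratio r A \<le> 1"
  unfolding totient_ratio_def by (intro prod_le_1) (use totient_ratio_factor less_imp_le in blast)

lemma totient_ratio_Un:
  "finite A \<Longrightarrow> finite C \<Longrightarrow> A \<inter> C = {} \<Longrightarrow> totient_ratio r (A \<union> C) = totient_ratio r A * totient_ratio r C"
  unfolding totient_ratio_def by (rule prod.union_disjoint)

lemma totient_ratio_antimono:
  assumes "finite C" "A \<subseteq> C" "\<And>p. p \<in> C \<Longrightarrow> r < p"
  shows "totient_ratio r C \<le> totient_ratio r A"
proof -
  have "totient_ratio r C = totient_ratio r A * totient_ratio r (C - A)"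
    using totient_ratio_Un[of A "C - A" r] assms by (metis Diff_disjoint Un_Diff_cancel finite_Diff finite_subset subset_Un_eq)
  also have "\<dots> \<le> totient_ratio r A * 1"
    using assms by (intro mult_left_mono totient_ratio_le_1 less_imp_le[OF totient_ratio_pos]) auto
  finally show ?thesis by simp
qed

text \<open>Common primes occur twice on the left, with factors at most 1. The overlap arises when a
  removed prime still divides the remaining cofactor of \<open>n\<close>.\<close>

lemma totient_ratio_Un_ge:
  assumes "finite A" "finite C" "\<And>p. p \<in> A \<union> C \<Longrightarrow> r < p"
  shows "totient_ratio r A * totient_ratio r C \<le> totient_ratio r (A \<union> C)"
proof -
  have "totient_ratio r (A \<union> C) = totient_ratio r A * totient_ratio r (C - A)"
    using totient_ratio_Un[of A "C - A" r] assms by simp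
  moreover have "totient_ratio r C \<le> totient_ratio r (C - A)"
    using assms by (intro totient_ratio_antimono) auto
  ultimately show ?thesis
    using assms totient_ratio_pos[of A r] by (simp add: mult_left_mono)
qed

section \<open>The Jacobsthal function and elements of B in short intervals\<close>

lemma primorial_pos: "primorial r > 0"
  unfolding primorial_def by (intro prod_pos) (auto simp: prime_gt_0_nat)

text \<open>The least element in \<open>jacobsthal\<close> is attained because the primorial itself
  is an admissible length: any block of that many integers contains one congruent to 1.\<close>

lemma
  shows Jr_pos: "Jr r > 0"
    and Jr_coprime: "\<exists>i<Jr r. coprime (x + int i) (int (primorial r))"
proof -
  let ?P = "\<lambda>a. a > 0 \<and> (\<forall>x::int. \<exists>i<a. coprime (x + int i) (int (primorial r)))"
  have "?P (primorial r)"
  proof (intro conjI allI primorial_pos)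
    fix x :: int
    define M where "M = int (primorial r)"
    have M: "M > 0" using primorial_pos by (simp add: M_def)
    define i where "i = nat ((1 - x) mod M)"
    have i: "int i = (1 - x) mod M" using M by (simp add: i_def)
    have "int i < M" unfolding i using M by (rule pos_mod_bound)
    then have "i < primorial r" by (simp add: M_def)
    moreover have "coprime (x + int i) M"
    proof -
      have "(x + int i) mod M = 1 mod M" by (simp add: i mod_simps)
      then show ?thesis by (metis coprime_mod_left_iff coprime_1_left M less_irrefl)
    qed
    ultimately show "\<exists>i<primorial r. coprime (x + int i) (int (primorial r))"
      unfolding M_def by blast
  qed
  then have "?P (Jr r)" unfolding Jr_def jacobsthal_def by (rule LeastI)
  then show "Jr r > 0" "\<exists>i<Jr r. coprime (x + int i) (int (primorial r))" by blast+
qed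

lemma obtain_in_B:
  obtains t where "y < t" "t \<le> y + Jr r" "t \<in> B r"
proof -
  obtain i where i: "i < Jr r" "coprime (int (y + 1) + int i) (int (primorial r))"
    using Jr_coprime[of r "int (y + 1)"] by blast
  define t where "t = y + 1 + i"
  have "coprime t (primorial r)"
    using i(2) unfolding t_def by (metis coprime_int_iff of_nat_add)
  moreover have "p dvd primorial r" if "prime p" "p \<le> r" for p
    unfolding primorial_def using that by (intro dvd_prodI) auto
  ultimately have "r < p" if "prime p" "p dvd t" for p
    using that by (metis coprime_common_divisor not_le not_prime_unit)
  then have "t \<in> B r" by (auto simp: B_iff t_def)
  then show ?thesis using i(1) by (intro that[of t]) (auto simp: t_def)
qed

lemma prod_primes_dvd:
  fixes n :: nat
  assumes "finite A" "\<And>p. p \<in> A \<Longrightarrow> prime p" "\<And>p. p \<in> A \<Longrightarrow> p dvd n"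
  shows "\<Prod>A dvd n"
  using assms
proof (induction A rule: finite_induct)
  case (insert p A)
  have "coprime p (\<Prod>A)"
    using insert by (intro prod_coprime_right) (auto intro!: primes_coprime)
  then show ?case using insert by (simp add: divides_mult)
qed simp

lemma prime_factors_prod_primes:
  fixes A :: "nat set"
  assumes "finite A" "\<And>p. p \<in> A \<Longrightarrow> prime p"
  shows "prime_factors (\<Prod>A) = A"
  using assms
proof (induction A rule: finite_induct)
  case (insert p A)
  have "\<Prod>A \<noteq> 0" using insert.prems[of 0] insert.hyps by auto
  then show ?case using insert by (auto simp: prime_factors_product prime_factorization_prime prime_gt_0_nat)
qed simp

text \<open>
  Trading the primes \<open>A\<close> of \<open>n\<close> for the absent primes \<open>C\<close> and a small cofactor from \<open>B r\<close> produces
  an element of \<open>B r\<close> that barely exceeds \<open>n\<close>; as \<open>n\<close> lies in \<open>F r\<close>, its \<open>S\<close>-value must be larger.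
\<close>

lemma F_exchange:
  assumes n: "n \<in> F r" and A: "A \<subseteq> prime_factors n"
    and C: "finite C" "\<And>q. q \<in> C \<Longrightarrow> prime q \<and> r < q \<and> \<not> q dvd n"
  shows "real (\<Prod>A) * totient_ratio r A < (real (\<Prod>A) + real (Jr r) * real (\<Prod>C)) * totient_ratio r C"
proof -
  have nB: "n \<in> B r" using n by (simp add: F_def)
  then have n0: "n > 0" and np: "\<And>p. p \<in> prime_factors n \<Longrightarrow> r < p" by (auto simp: B_iff prime_factors_dvd)
  have finA: "finite A" using A finite_subset by blast
  have Ap: "\<And>p. p \<in> A \<Longrightarrow> prime p \<and> r < p" using A np by auto
  have "\<Prod>A dvd n" using A by (intro prod_primes_dvd finA) (auto simp: prime_factors_dvd)
  then obtain n1 where n1: "n = n1 * \<Prod>A" by (metis dvdE mult.commute)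
  have n1_0: "n1 > 0" using n0 n1 by auto
  have A0: "\<Prod>A > 0" using Ap by (intro prod_pos) (auto simp: prime_gt_0_nat)
  have C0: "\<Prod>C > 0" using C by (intro prod_pos) (auto simp: prime_gt_0_nat)
  \<comment> \<open>The strict lower bound on \<open>t\<close> makes \<open>m\<close> exceed
    \<open>n\<close>; the upper bound limits the overshoot.\<close>
  obtain t where t: "\<Prod>A div \<Prod>C < t" "t \<le> \<Prod>A div \<Prod>C + Jr r" "t \<in> B r" by (rule obtain_in_B)
  have t0: "t > 0" using t by auto
  define m where "m = n1 * \<Prod>C * t"
  have pf_n: "prime_factors n = prime_factors n1 \<union> A"
    using prime_factors_prod_primes[OF finA] Ap n1_0 A0 by (subst n1, subst prime_factors_product) simp_all
  have pf_m: "prime_factors m = prime_factors n1 \<union> C \<union> prime_factors t"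
    using prime_factors_prod_primes[OF C(1)] C(2) n1_0 C0 t0 unfolding m_def
    by (subst prime_factors_product, simp_all, subst prime_factors_product) auto
  have mp: "r < p" if "p \<in> prime_factors m" for p
    using that pf_m np C(2) t(3) pf_n by (auto simp: B_iff prime_factors_dvd)
  have mB: "m \<in> B r"
    using mp n1_0 C0 t0 by (auto simp: B_iff m_def prime_factors_dvd)
  have "\<Prod>A < t * \<Prod>C"
    using t(1) C0 by (simp add: div_less_iff_less_mult)
  then have "n1 * \<Prod>A < n1 * (t * \<Prod>C)" using n1_0 by simp
  then have "n < m" by (simp add: n1 m_def mult_ac)
  then have "S r n < S r m" using n mB by (simp add: F_def)
  then have "real (S r n) < real (S r m)" by simp
  then have lt: "real n * totient_ratio r (prime_factors n) < real m * totient_ratio r (prime_factors m)"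
    using S_eq_totient_ratio nB mB by simp
  \<comment> \<open>The primes of \<open>t\<close> may overlap with the others; dropping them can
    only enlarge the ratio.\<close>
  have "real m * totient_ratio r (prime_factors m) \<le> real m * totient_ratio r (prime_factors n1 \<union> C)"
    using pf_m mp C(1) by (intro mult_left_mono totient_ratio_antimono) auto
  also have "totient_ratio r (prime_factors n1 \<union> C) = totient_ratio r (prime_factors n1) * totient_ratio r C"
  proof (rule totient_ratio_Un)
    show "prime_factors n1 \<inter> C = {}" using C(2) n1 by (fastforce simp: prime_factors_dvd)
  qed (use C in auto)
  finally have up: "real m * totient_ratio r (prime_factors m) \<le> real m * (totient_ratio r (prime_factors n1) * totient_ratio r C)" .
  have low: "real n * (totient_ratio r (prime_factors n1) * totient_ratio r A) \<le> real n * totient_ratio r (prime_factors n)"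
    unfolding pf_n using finA np pf_n by (intro mult_left_mono totient_ratio_Un_ge) auto
  have d1: "totient_ratio r (prime_factors n1) > 0" using np pf_n by (intro totient_ratio_pos) auto
  have dC: "totient_ratio r C > 0" using C by (intro totient_ratio_pos) auto
  have "real n * (totient_ratio r (prime_factors n1) * totient_ratio r A) < real m * (totient_ratio r (prime_factors n1) * totient_ratio r C)"
    using lt up low by linarith
  then have "(real n1 * totient_ratio r (prime_factors n1)) * (real (\<Prod>A) * totient_ratio r A) <
     (real n1 * totient_ratio r (prime_factors n1)) * (real (\<Prod>C) * real t * totient_ratio r C)"
    by (simp add: n1 m_def mult_ac)
  then have "real (\<Prod>A) * totient_ratio r A < real (\<Prod>C) * real t * totient_ratio r C"
    using n1_0 d1 by (subst (asm) mult_less_cancel_left_pos) auto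
  also have "real (\<Prod>C) * real t \<le> real (\<Prod>A) + real (Jr r) * real (\<Prod>C)"
  proof -
    have "\<Prod>C * t \<le> \<Prod>C * (\<Prod>A div \<Prod>C + Jr r)" using t(2) by simp
    also have "\<dots> \<le> \<Prod>A + Jr r * \<Prod>C" by (simp add: algebra_simps)
    finally have "real (\<Prod>C * t) \<le> real (\<Prod>A + Jr r * \<Prod>C)" by (rule of_nat_mono)
    then show ?thesis by simp
  qed
  then have "real (\<Prod>C) * real t * totient_ratio r C \<le> (real (\<Prod>A) + real (Jr r) * real (\<Prod>C)) * totient_ratio r C"
    using dC by (intro mult_right_mono) auto
  finally show ?thesis .
qed

section \<open>Explicit elements of F\<close>

text \<open>Repeated primes enter \<open>S\<close> only as the plain cofactor \<open>d\<close>, so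
  comparing values reduces to comparing products of \<open>p - r\<close>.\<close>

lemma S_eq_radical:
  assumes "m \<in> B r"
  obtains d where "d > 0" "m = d * \<Prod>(prime_factors m)"
    "real (S r m) = real d * (\<Prod>p\<in>prime_factors m. real p - real r)"
proof -
  let ?T = "prime_factors m"
  have m0: "m > 0" and gt: "\<And>p. p \<in> ?T \<Longrightarrow> r < p" using assms by (auto simp: B_iff prime_factors_dvd)
  have "\<Prod>?T dvd m" by (intro prod_primes_dvd) (auto simp: prime_factors_dvd)
  then obtain d where d: "m = d * \<Prod>?T" by (metis dvdE mult.commute)
  have d0: "d > 0" using m0 d by (metis gr0I mult_0)
  have "real (S r m) = real d * real (\<Prod>?T) * totient_ratio r ?T"
    using S_eq_totient_ratio[OF assms] d by (metis of_nat_mult)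
  also have "\<dots> = real d * (\<Prod>p\<in>?T. real p * (1 - real r / real p))"
    by (simp add: totient_ratio_def prod.distrib)
  also have "(\<Prod>p\<in>?T. real p * (1 - real r / real p)) = (\<Prod>p\<in>?T. real p - real r)"
  proof (rule prod.cong)
    fix p assume "p \<in> ?T"
    then have "p > 0" using gt by fastforce
    then show "real p * (1 - real r / real p) = real p - real r" by (simp add: field_simps)
  qed simp
  finally show ?thesis using d0 d by (intro that)
qed

text \<open>After cancelling the common part, every remaining factor on the left is at most the
  threshold \<open>z\<close> and every one on the right at least \<open>z\<close>. Only two powers
  of \<open>z\<close> are left, and which cardinality must be larger depends on the side of 1 on
  which \<open>z\<close> lies: below for \<open>1 - r / p\<close>, above for
  \<open>p - r\<close>.\<close>

lemma prod_le_initial_segment: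
  fixes f :: "nat \<Rightarrow> real"
  assumes fin: "finite A" "finite T" and z: "0 \<le> z"
    and A: "\<And>p. p \<in> A - T \<Longrightarrow> 0 \<le> f p \<and> f p \<le> z"
    and T: "\<And>p. p \<in> T - A \<Longrightarrow> z \<le> f p"
    and pos: "\<And>p. p \<in> A \<inter> T \<Longrightarrow> 0 \<le> f p"
    and card: "z \<le> 1 \<and> card T \<le> card A \<or> z \<ge> 1 \<and> card A \<le> card T"
  shows "prod f A \<le> prod f T"
proof -
  have cA: "card A = card (A \<inter> T) + card (A - T)" using fin by (metis card_Diff_subset_Int card_mono Int_lower1 finite_Int le_add_diff_inverse)
  have cT: "card T = card (A \<inter> T) + card (T - A)" using fin by (metis Int_commute card_Diff_subset_Int card_mono Int_lower1 finite_Int le_add_diff_inverse)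
  have "prod f (A - T) \<le> (\<Prod>p\<in>A - T. z)" using A by (intro prod_mono) auto
  also have "\<dots> = z ^ card (A - T)" by simp
  also have "\<dots> \<le> z ^ card (T - A)"
    using card cA cT z by (auto intro: power_decreasing power_increasing)
  also have "\<dots> = (\<Prod>p\<in>T - A. z)" by simp
  also have "\<dots> \<le> prod f (T - A)" using T z by (intro prod_mono) auto
  finally have "prod f (A - T) \<le> prod f (T - A)" .
  then have "prod f (A \<inter> T) * prod f (A - T) \<le> prod f (A \<inter> T) * prod f (T - A)"
    using pos by (intro mult_left_mono prod_nonneg) auto
  moreover have "prod f A = prod f (A \<inter> T) * prod f (A - T)"
    using fin by (subst prod.union_disjoint[symmetric]) (auto intro!: prod.cong)
  moreover have "prod f T = prod f (A \<inter> T) * prod f (T - A)"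
    using fin by (subst prod.union_disjoint[symmetric]) (auto intro!: prod.cong)
  ultimately show ?thesis by simp
qed

text \<open>
  With \<open>c = r / (\<tau> - r)\<close> the function \<open>ln (1 - r / x) - c * ln x\<close> has its maximum at \<open>\<tau>\<close>; this is the
  concavity of \<open>ln (1 - r / x)\<close> as a function of \<open>ln x\<close>.
\<close>

definition tilted :: "real \<Rightarrow> real \<Rightarrow> real \<Rightarrow> real" where
  "tilted r \<tau> x = ln (1 - r / x) - r / (\<tau> - r) * ln x"

lemma tilted_deriv:
  assumes "0 \<le> r" "r < x" "r < \<tau>"
  shows "(tilted r \<tau> has_real_derivative r / x * (1 / (x - r) - 1 / (\<tau> - r))) (at x)"
proof -
  have x: "x > 0" "1 - r / x > 0" "x - r > 0" "\<tau> - r > 0" using assms by (auto simp: field_simps)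
  have "(tilted r \<tau> has_real_derivative (r / x^2) / (1 - r / x) - r / (\<tau> - r) * (1 / x)) (at x)"
    unfolding tilted_def[abs_def] using x
    by (auto intro!: derivative_eq_intros simp: power2_eq_square mult.commute)
  moreover have "(r / x^2) / (1 - r / x) - r / (\<tau> - r) * (1 / x) = r / x * (1 / (x - r) - 1 / (\<tau> - r))"
  proof -
    have "(r / x^2) / (1 - r / x) = r / x * (1 / (x - r))"
      using x by (simp add: field_simps power2_eq_square)
    then show ?thesis by (simp add: algebra_simps)
  qed
  ultimately show ?thesis by simp
qed

lemma tilted_mono:
  assumes "0 \<le> r" "r < x" "x \<le> y" "y \<le> \<tau>"
  shows "tilted r \<tau> x \<le> tilted r \<tau> y"
proof (rule DERIV_nonneg_imp_nondecreasing[OF assms(3)])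
  fix u assume u: "x \<le> u" "u \<le> y"
  have "1 / (\<tau> - r) \<le> 1 / (u - r)" using assms u by (intro divide_left_mono) auto
  then show "\<exists>y. (tilted r \<tau> has_real_derivative y) (at u) \<and> 0 \<le> y"
    using assms u by (intro exI[of _ "r / u * (1 / (u - r) - 1 / (\<tau> - r))"] conjI tilted_deriv mult_nonneg_nonneg) auto
qed

lemma tilted_antimono:
  assumes "0 \<le> r" "r < \<tau>" "\<tau> \<le> x"
  shows "tilted r \<tau> x \<le> tilted r \<tau> \<tau>"
proof (rule DERIV_nonpos_imp_nonincreasing[OF assms(3)])
  fix u assume u: "\<tau> \<le> u" "u \<le> x"
  have "1 / (u - r) \<le> 1 / (\<tau> - r)" using assms u by (intro divide_left_mono) auto
  then show "\<exists>y. (tilted r \<tau> has_real_derivative y) (at u) \<and> y \<le> 0"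
    using assms u by (intro exI[of _ "r / u * (1 / (u - r) - 1 / (\<tau> - r))"] conjI tilted_deriv mult_nonneg_nonpos) auto
qed

text \<open>A competitor \<open>m\<close> is classified by its number of primes and its cofactor
  \<open>d\<close>. The hypothesis on \<open>U\<close> says \<open>U - r < 2 * (q - r)\<close>,
  which puts \<open>S r n\<close> below twice the least product of \<open>p - r\<close> over
  \<open>card A + 1\<close> primes.\<close>

lemma F_memI:
  assumes r: "r > 0" and q: "prime q" "r < q" and U: "prime U" "q \<le> U" "U + r < 2 * q"
    and A: "A = {p. prime p \<and> r < p \<and> p < q}"
  shows "U * \<Prod>A \<in> F r" and "prime_factors (U * \<Prod>A) = insert U A"
proof -
  let ?n = "U * \<Prod>A"
  have finA: "finite A" unfolding A by (rule finite_subset[of _ "{..q}"]) auto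
  have UA: "U \<notin> A" "q \<notin> A" using U A by auto
  have Ap: "prime p" "r < p" if "p \<in> insert U A" for p using that U q A by auto
  have n_eq: "?n = \<Prod>(insert U A)" using finA UA by simp
  show pf: "prime_factors ?n = insert U A"
    unfolding n_eq using Ap finA by (intro prime_factors_prod_primes) auto
  have n0: "?n > 0" unfolding n_eq using Ap by (intro prod_pos) (auto simp: prime_gt_0_nat)
  have nB: "?n \<in> B r"
    unfolding B_iff using Ap pf n0 by (auto simp: prime_factors_dvd simp del: mult_eq_0_iff)
  let ?f = "\<lambda>p. real p - real r"
  have Sn: "real (S r ?n) = prod ?f A * (real U - real r)"
  proof -
    have "real (S r ?n) = real ?n * totient_ratio r (insert U A)"
      using S_eq_totient_ratio[OF nB] unfolding pf .
    also have "\<dots> = (\<Prod>p\<in>insert U A. real p * (1 - real r / real p))"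
      unfolding n_eq by (simp add: totient_ratio_def prod.distrib)
    also have "\<dots> = prod ?f (insert U A)"
    proof (rule prod.cong)
      fix p assume "p \<in> insert U A"
      then have "p > 0" using Ap by (auto simp: prime_gt_0_nat)
      then show "real p * (1 - real r / real p) = real p - real r" by (simp add: field_simps)
    qed simp
    finally show ?thesis using finA UA by (simp add: mult.commute)
  qed
  have fA: "prod ?f A > 0" using Ap by (intro prod_pos) auto
  have Sn_less: "real (S r ?n) < 2 * prod ?f (insert q A)"
  proof -
    have "real (U + r) < real (2 * q)" using U(3) by (simp only: of_nat_less_iff)
    then have "real U - real r < 2 * (real q - real r)" by simp
    then show ?thesis unfolding Sn using fA finA UA by (simp add: mult.commute)
  qed
  have "S r ?n < S r m" if m: "m \<in> B r" "?n < m" for m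
  proof -
    let ?T = "prime_factors m"
    have Tp: "prime p" "r < p" if "p \<in> ?T" for p using that m(1) by (auto simp: B_iff prime_factors_dvd)
    have T_ge: "q \<le> p" if "p \<in> ?T - A" for p using that Tp A by auto
    have Tq: "q < p" if "p \<in> ?T - insert q A" for p using that Tp A T_ge[of p] by auto
    obtain d where d: "d > 0" "m = d * \<Prod>?T" "real (S r m) = real d * prod ?f ?T"
      using S_eq_radical[OF m(1)] .
    \<comment> \<open>Among sets of at least \<open>card A + 1\<close> primes above
      \<open>r\<close>, the initial segment minimises the product. The subset \<open>C\<close>
      allows the largest prime of \<open>m\<close> to be set aside.\<close>
    have big: "prod ?f (insert q A) \<le> prod ?f C"
      if C: "C \<subseteq> ?T" "card (insert q A) \<le> card C" for C
    proof (rule prod_le_initial_segment[where z = "real q - real r"])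
      show "finite C" using C finite_subset by blast
      show "real q - real r \<le> 1 \<and> card C \<le> card (insert q A) \<or> 1 \<le> real q - real r \<and> card (insert q A) \<le> card C"
        using C q by auto
      show "real q - real r \<le> real p - real r" if "p \<in> C - insert q A" for p
        using that C Tq[of p] by auto
      show "0 \<le> real p - real r \<and> real p - real r \<le> real q - real r" if "p \<in> insert q A - C" for p
        using that q A by auto
      show "0 \<le> real p - real r" if "p \<in> insert q A \<inter> C" for p using that q A by auto
    qed (use finA q in auto)
    have Tpos: "prod ?f ?T > 0" using Tp by (intro prod_pos) auto
    have cq: "card (insert q A) = card A + 1" using finA UA by simp
    consider (small) "card ?T \<le> card A" | (large) "card ?T \<ge> card A + 2"
      | (multiple) "card ?T = card A + 1" "d \<ge> 2" | (main) "card ?T = card A + 1" "d = 1"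
      using d(1) by linarith
    then have "real (S r ?n) < real (S r m)"
    proof cases
      \<comment> \<open>With at most \<open>card A\<close> primes no ratio is below that of the
        initial segment \<open>A\<close>, so \<open>m > n\<close> already decides.\<close>
      case small
      have "totient_ratio r A \<le> totient_ratio r ?T"
        unfolding totient_ratio_def
      proof (rule prod_le_initial_segment[where z = "1 - real r / real q"])
        show "1 - real r / real q \<le> 1 \<and> card ?T \<le> card A \<or> 1 - real r / real q \<ge> 1 \<and> card A \<le> card ?T"
          using small by simp
        show "0 \<le> 1 - real r / real p \<and> 1 - real r / real p \<le> 1 - real r / real q" if "p \<in> A - ?T" for p
          using that A totient_ratio_factor[of r p] by (auto intro!: divide_left_mono)
        show "1 - real r / real q \<le> 1 - real r / real p" if "p \<in> ?T - A" for p
          using T_ge[OF that] q by (auto intro!: divide_left_mono)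
        show "0 \<le> 1 - real r / real p" if "p \<in> A \<inter> ?T" for p using that A by auto
      qed (use finA q in auto)
      moreover have "totient_ratio r (insert U A) \<le> totient_ratio r A"
        using finA Ap by (intro totient_ratio_antimono) auto
      moreover have pos: "totient_ratio r (insert U A) > 0" using Ap by (intro totient_ratio_pos)
      moreover have "real ?n < real m" using m(2) by (simp only: of_nat_less_iff)
      ultimately have "real ?n * totient_ratio r (insert U A) < real m * totient_ratio r ?T"
        by (intro mult_less_le_imp_less of_nat_0_le_iff) linarith+
      then show ?thesis using S_eq_totient_ratio[OF nB] S_eq_totient_ratio[OF m(1)] pf by simp
    next
      case large
      \<comment> \<open>Setting the largest prime aside still leaves enough primes for
        \<open>big\<close>, and \<open>t - r\<close> is at least 2 because another prime of
        \<open>m\<close> lies strictly between \<open>r\<close> and \<open>t\<close>.\<close>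
      define t where "t = Max ?T"
      have t: "t \<in> ?T" unfolding t_def using large by (intro Max_in) auto
      have "card (?T - {t}) = card ?T - 1" using t by simp
      then have c: "card (insert q A) \<le> card (?T - {t})" using large cq by simp
      then have "?T - {t} \<noteq> {}" using cq by (metis Suc_eq_plus1 card.empty le_zero_eq nat.simps(3))
      then obtain s where s: "s \<in> ?T" "s \<noteq> t" by auto
      then have "s < t" unfolding t_def by (metis Max_ge finite_set_mset le_neq_implies_less)
      then have "real t - real r \<ge> 2" using Tp(2)[OF s(1)] by linarith
      then have "prod ?f (insert q A) * 2 \<le> prod ?f (?T - {t}) * (real t - real r)"
        using big[OF _ c] Tp(2) by (intro mult_mono prod_nonneg) (auto simp: less_imp_le)
      also have "\<dots> = prod ?f ?T" using t by (simp add: prod.remove[of ?T t] mult.commute)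
      also have "\<dots> \<le> real d * prod ?f ?T" using d(1) Tpos by (simp add: mult_le_cancel_right1)
      finally show ?thesis using Sn_less d(3) by simp
    next
      case multiple
      have "2 * prod ?f (insert q A) \<le> real d * prod ?f ?T"
        using multiple big[of ?T] cq q(2) Ap(2) by (intro mult_mono prod_nonneg) (auto simp: less_imp_le)
      then show ?thesis using Sn_less d(3) by simp
    next
      case main
      \<comment> \<open>The tilt is centred at the largest prime of \<open>m\<close>: below
        \<open>t\<close> the function increases, so exchanging primes under \<open>q\<close> for
        larger ones of \<open>m\<close> raises the sum, and at \<open>t\<close> it is maximal, so
        \<open>g U \<le> g t\<close> on whichever side \<open>U\<close> lies.\<close>
      define t where "t = Max ?T"
      have T0: "?T \<noteq> {}" using main by auto
      have tT: "t \<in> ?T" unfolding t_def using T0 by (intro Max_in) auto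
      have t_max: "p \<le> t" if "p \<in> ?T" for p unfolding t_def using that by simp
      have "\<not> ?T \<subseteq> A" using main card_mono[OF finA, of ?T] by auto
      then obtain s where "s \<in> ?T - A" by auto
      then have "q \<le> t" using T_ge t_max by fastforce
      then have tA: "t \<in> ?T - A" using tT A by auto
      have rt: "r < t" using Tp tT by auto
      define g where "g = (\<lambda>p::nat. tilted (real r) (real t) (real p))"
      have card_eq: "card (?T - A - {t}) = card (A - ?T)"
      proof -
        have "card (?T - A - {t}) = card (?T - A) - 1" using tA by simp
        moreover have "card ?T = card (?T \<inter> A) + card (?T - A)"
          by (metis card_Diff_subset_Int card_mono Int_lower1 finite_Int finite_set_mset le_add_diff_inverse)
        moreover have "card A = card (?T \<inter> A) + card (A - ?T)"
          using finA by (metis Int_commute card_Diff_subset_Int card_mono Int_lower1 finite_Int le_add_diff_inverse)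
        ultimately show ?thesis using main by linarith
      qed
      have "sum g (A - ?T) \<le> (\<Sum>p\<in>A - ?T. g q)"
        using A \<open>q \<le> t\<close> unfolding g_def by (intro sum_mono tilted_mono) auto
      also have "\<dots> = (\<Sum>p\<in>?T - A - {t}. g q)" using card_eq by simp
      also have "\<dots> \<le> sum g (?T - A - {t})"
        using T_ge t_max q unfolding g_def by (intro sum_mono tilted_mono) auto
      finally have "sum g (A - ?T) \<le> sum g (?T - A - {t})" .
      moreover have "g U \<le> g t"
      proof (cases "U \<le> t")
        case True
        then show ?thesis unfolding g_def using U q by (intro tilted_mono) auto
      next
        case False
        then show ?thesis unfolding g_def using rt by (intro tilted_antimono) auto
      qed
      moreover have "sum g (insert U A) = g U + sum g (A \<inter> ?T) + sum g (A - ?T)"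
        using finA UA by (simp add: sum.Int_Diff[of A g ?T])
      moreover have "sum g ?T = sum g (A \<inter> ?T) + (g t + sum g (?T - A - {t}))"
        using tA by (simp add: sum.Int_Diff[of ?T g A] Int_commute sum.remove[of "?T - A" t])
      ultimately have g_le: "sum g (insert U A) \<le> sum g ?T" by linarith
      \<comment> \<open>Since \<open>ln (p - r) = g p + (1 + c) * ln p\<close>, the comparison of
        the \<open>g\<close>-sums combines with \<open>ln n < ln m\<close> to give the
        claim.\<close>
      define c where "c = real r / (real t - real r)"
      have c0: "c \<ge> 0" using rt by (simp add: c_def)
      have ln_S: "ln (\<Prod>p\<in>X. ?f p) = sum g X + (1 + c) * ln (real (\<Prod>X))"
        if X: "finite X" "\<And>p. p \<in> X \<Longrightarrow> r < p" for X
      proof -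
        have "ln (\<Prod>p\<in>X. ?f p) = (\<Sum>p\<in>X. ln (?f p))" using X by (intro ln_prod) auto
        also have "\<dots> = (\<Sum>p\<in>X. g p + (1 + c) * ln (real p))"
        proof (rule sum.cong)
          fix p assume p: "p \<in> X"
          then have p0: "real p > 0" "1 - real r / real p > 0" using X(2)[OF p] by (auto simp: field_simps)
          have "?f p = real p * (1 - real r / real p)" using p0 by (simp add: field_simps)
          then have "ln (?f p) = ln (real p) + ln (1 - real r / real p)" using p0 by (simp add: ln_mult)
          then show "ln (?f p) = g p + (1 + c) * ln (real p)" by (simp add: g_def tilted_def c_def algebra_simps)
        qed simp
        also have "\<dots> = sum g X + (1 + c) * (\<Sum>p\<in>X. ln (real p))" by (simp add: sum.distrib sum_distrib_left)
        also have "(\<Sum>p\<in>X. ln (real p)) = ln (real (\<Prod>X))"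
        proof -
          have "ln (\<Prod>p\<in>X. real p) = (\<Sum>p\<in>X. ln (real p))" using X by (intro ln_prod) force+
          then show ?thesis by simp
        qed
        finally show ?thesis .
      qed
      have m_eq: "m = \<Prod>?T" using main d by simp
      have "ln (real ?n) < ln (real m)" using n0 m(2) by (subst ln_less_cancel_iff) (auto simp del: of_nat_mult of_nat_prod)
      then have "(1 + c) * ln (real (\<Prod>(insert U A))) < (1 + c) * ln (real (\<Prod>?T))"
        using c0 unfolding n_eq m_eq[symmetric] by (intro mult_strict_left_mono) auto
      then have "ln (\<Prod>p\<in>insert U A. ?f p) < ln (\<Prod>p\<in>?T. ?f p)"
        using g_le ln_S[of "insert U A"] ln_S[of ?T] finA Ap Tp by auto
      then have "(\<Prod>p\<in>insert U A. ?f p) < (\<Prod>p\<in>?T. ?f p)"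
        using Tpos Ap by (subst (asm) ln_less_cancel_iff) (auto intro!: prod_pos simp del: prod.insert)
      then show ?thesis using Sn d(3) main finA UA by (simp add: mult.commute)
    qed
    then show ?thesis by simp
  qed
  then show "?n \<in> F r" using nB by (simp add: F_def)
qed

section \<open>Asymptotics\<close>

lemma theta_eventually:
  assumes "\<epsilon> > 0"
  shows "eventually (\<lambda>n. (1 - \<epsilon>) * real n \<le> theta n \<and> theta n \<le> (1 + \<epsilon>) * real n) sequentially"
  using tendstoD[OF prime_number_theorem assms] eventually_gt_at_top[of 0]
proof eventually_elim
  case (elim n)
  then have "1 - \<epsilon> \<le> theta n / real n" "theta n / real n \<le> 1 + \<epsilon>" by (auto simp: dist_real_def)
  with elim show ?case by (simp add: field_simps)
qed

lemma ln_of_nat_nonneg: "ln (real n) \<ge> 0"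
  by (cases "n = 0") auto

text \<open>An interval free of primes would make \<open>theta\<close> agree at its two ends,
  against the prime number theorem. With \<open>\<epsilon> = \<eta> / 3\<close> the contradiction is
  \<open>(1 + \<epsilon>) * (1 - 3 * \<epsilon>) < 1 - \<epsilon>\<close>.\<close>

lemma eventually_prime_in_interval:
  assumes \<eta>: "0 < \<eta>" "\<eta> < 1"
  shows "eventually (\<lambda>x. \<exists>p. prime p \<and> (1 - \<eta>) * real x < real p \<and> p \<le> x) sequentially"
proof -
  define \<epsilon> where "\<epsilon> = \<eta> / 3"
  have \<epsilon>: "\<epsilon> > 0" using \<eta> by (simp add: \<epsilon>_def)
  have lim: "filterlim (\<lambda>x. nat \<lfloor>(1 - \<eta>) * real x\<rfloor>) at_top sequentially"
    using \<eta> by real_asymp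
  show ?thesis
    using theta_eventually[OF \<epsilon>] eventually_compose_filterlim[OF theta_eventually[OF \<epsilon>] lim] eventually_gt_at_top[of 0]
  proof eventually_elim
    case (elim x)
    define y where "y = nat \<lfloor>(1 - \<eta>) * real x\<rfloor>"
    have nn: "(1 - \<eta>) * real x \<ge> 0" using \<eta> by simp
    then have y: "real y \<le> (1 - \<eta>) * real x" unfolding y_def by linarith
    show ?case
    proof (rule ccontr)
      assume no: "\<not> ?thesis"
      have "p \<le> y" if p: "prime p" "p \<le> x" for p
      proof -
        have "real p \<le> (1 - \<eta>) * real x" using no p by (meson not_le)
        then show ?thesis unfolding y_def by (rule le_nat_floor)
      qed
      then have "theta x \<le> theta y" unfolding theta_def
        by (intro sum_mono2) (auto simp: ln_of_nat_nonneg intro: finite_subset[of _ "{..y}"])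
      also have "\<dots> \<le> (1 + \<epsilon>) * real y" using elim by (simp add: y_def)
      also have "\<dots> \<le> (1 + \<epsilon>) * ((1 - \<eta>) * real x)" using y \<epsilon> by (intro mult_left_mono) auto
      also have "\<dots> = ((1 + \<epsilon>) * (1 - \<eta>)) * real x" by simp
      also have "\<dots> < (1 - \<epsilon>) * real x"
      proof (rule mult_strict_right_mono)
        have "\<eta> = 3 * \<epsilon>" by (simp add: \<epsilon>_def)
        then have "(1 + \<epsilon>) * (1 - \<eta>) = 1 - 2 * \<epsilon> - 3 * (\<epsilon> * \<epsilon>)" by (simp add: algebra_simps)
        also have "\<dots> < 1 - \<epsilon>" using \<epsilon> mult_pos_pos[OF \<epsilon> \<epsilon>] by linarith
        finally show "(1 + \<epsilon>) * (1 - \<eta>) < 1 - \<epsilon>" .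
      qed (use elim in simp)
      also have "\<dots> \<le> theta x" using elim by simp
      finally show False by simp
    qed
  qed
qed

section \<open>Size of the absent primes\<close>

abbreviation absent_primes :: "nat \<Rightarrow> nat \<Rightarrow> nat set" where
  "absent_primes r n \<equiv> {p. prime p \<and> r < p \<and> \<not> p dvd n}"

lemma infinite_absent_primes:
  assumes "n > 0"
  shows "infinite (absent_primes r n)"
proof
  assume "finite (absent_primes r n)"
  moreover have "{p. prime p} \<subseteq> absent_primes r n \<union> {..r} \<union> {p. p dvd n}" by auto
  ultimately have "finite {p::nat. prime p}"
    using assms by (elim finite_subset) auto
  then show False using primes_infinite by simp
qed

text \<open>\<open>enumerate\<close> counts from 0, so \<open>Q r k n\<close> has index
  \<open>k - 1\<close> and is itself the last of the \<open>k\<close> primes counted.\<close>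

lemma absent_primes_le_Q:
  assumes "n > 0" "k > 0"
  shows "{p \<in> absent_primes r n. p \<le> Q r k n} = enumerate (absent_primes r n) ` {..<k}"
    "card {p \<in> absent_primes r n. p \<le> Q r k n} = k" "Q r k n \<in> absent_primes r n"
proof -
  let ?X = "absent_primes r n"
  have inf: "infinite ?X" by (rule infinite_absent_primes[OF assms(1)])
  have mono: "strict_mono (enumerate ?X)" using inf by (intro strict_monoI enumerate_mono)
  show eq: "{p \<in> ?X. p \<le> Q r k n} = enumerate ?X ` {..<k}"
  proof (intro equalityI subsetI)
    fix p assume p: "p \<in> {p \<in> ?X. p \<le> Q r k n}"
    then obtain j where j: "p = enumerate ?X j" using enumerate_Ex[OF inf, of p] by auto
    with p have "enumerate ?X j \<le> enumerate ?X (k - 1)" by (simp add: Q_def)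
    then have "j \<le> k - 1" using strict_mono_less_eq[OF mono] by blast
    then show "p \<in> enumerate ?X ` {..<k}" using j assms(2) by (intro image_eqI[where x = j]) auto
  next
    fix p assume "p \<in> enumerate ?X ` {..<k}"
    then obtain j where j: "j < k" "p = enumerate ?X j" by auto
    then have "p \<le> enumerate ?X (k - 1)" using strict_mono_less_eq[OF mono] by simp
    then show "p \<in> {p \<in> ?X. p \<le> Q r k n}" using j enumerate_in_set[OF inf, of j] by (simp add: Q_def)
  qed
  show "card {p \<in> ?X. p \<le> Q r k n} = k"
    unfolding eq using strict_mono_imp_inj_on[OF mono] by (subst card_image) (auto intro: inj_on_subset)
  show "Q r k n \<in> ?X" unfolding Q_def by (rule enumerate_in_set[OF inf])
qed

text \<open>A prime up to \<open>Q\<close> is at most \<open>r\<close>, or divides \<open>n\<close>,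
  or is one of \<open>k\<close> absent ones; those dividing \<open>n\<close> contribute at most
  \<open>ln n\<close> because their product divides \<open>n\<close>.\<close>

lemma theta_Q_le:
  assumes "n > 0" "k > 0"
  shows "theta (Q r k n) \<le> theta r + ln (real n) + real k * ln (real (Q r k n))"
proof -
  define q where "q = Q r k n"
  define X where "X = {p \<in> absent_primes r n. p \<le> q}"
  define Y where "Y = {p. prime p \<and> p dvd n}"
  define Z where "Z = {p::nat. prime p \<and> p \<le> r}"
  have "Y \<subseteq> {..n}" using assms by (auto simp: Y_def dest: dvd_imp_le)
  moreover have "X \<subseteq> {..q}" "Z \<subseteq> {..r}" by (auto simp: X_def Z_def)
  ultimately have fin: "finite X" "finite Y" "finite Z"
    using finite_subset[OF _ finite_atMost] by blast+
  note nn = ln_of_nat_nonneg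
  have sum_Un: "(\<Sum>p\<in>G \<union> H. ln (real p)) \<le> (\<Sum>p\<in>G. ln (real p)) + (\<Sum>p\<in>H. ln (real p))"
    if "finite G" "finite H" for G H :: "nat set"
    using that sum.union_inter[of G H "\<lambda>p. ln (real p)"] sum_nonneg[of "G \<inter> H" "\<lambda>p. ln (real p)"] nn by simp
  have "theta q \<le> (\<Sum>p\<in>Z \<union> Y \<union> X. ln (real p))"
    unfolding theta_def using fin nn by (intro sum_mono2) (auto simp: X_def Y_def Z_def)
  also have "\<dots> \<le> (\<Sum>p\<in>Z. ln (real p)) + (\<Sum>p\<in>Y. ln (real p)) + (\<Sum>p\<in>X. ln (real p))"
    using sum_Un[of "Z \<union> Y" X] sum_Un[of Z Y] fin by simp
  also have "(\<Sum>p\<in>Z. ln (real p)) = theta r" by (simp add: theta_def Z_def)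
  also have "(\<Sum>p\<in>Y. ln (real p)) \<le> ln (real n)"
  proof -
    have "\<Prod>Y dvd n" using fin by (intro prod_primes_dvd) (auto simp: Y_def)
    then have le: "\<Prod>Y \<le> n" using assms by (intro dvd_imp_le)
    have "(\<Sum>p\<in>Y. ln (real p)) = ln (\<Prod>p\<in>Y. real p)"
      using fin by (intro ln_prod[symmetric]) (auto simp: Y_def prime_gt_0_nat)
    also have "\<dots> = ln (real (\<Prod>Y))" by simp
    also have "\<dots> \<le> ln (real n)"
    proof (rule ln_mono)
      show "real (\<Prod>Y) \<le> real n" using le by (simp only: of_nat_le_iff)
      have "\<Prod>Y > 0" by (intro prod_pos) (auto simp: Y_def prime_gt_0_nat)
      then show "real (\<Prod>Y) > 0" by (simp only: of_nat_0_less_iff)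
    qed
    finally show ?thesis .
  qed
  also have "(\<Sum>p\<in>X. ln (real p)) \<le> (\<Sum>p\<in>X. ln (real q))"
    by (intro sum_mono) (auto simp: X_def prime_gt_0_nat)
  also have "\<dots> = real k * ln (real q)"
    using absent_primes_le_Q(2)[OF assms, of r] by (simp add: X_def q_def)
  finally show ?thesis by (simp add: q_def)
qed

text \<open>For large \<open>Q\<close> the prime number theorem turns \<open>theta_Q_le\<close> into
  a linear inequality, with \<eta> chosen so that
  \<open>1 - 2 * \<eta> = 1 / (1 + \<delta>)\<close>; a \<open>Q\<close> below the threshold
  \<open>X0\<close> is eventually below \<open>ln n\<close> up to the factor.\<close>

lemma eventually_Q_le:
  assumes "k > 0" "\<delta> > 0"
  shows "eventually (\<lambda>n. real (Q r k n) \<le> (1 + \<delta>) * ln (real n)) sequentially"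
proof -
  define \<eta> where "\<eta> = \<delta> / (2 * (1 + \<delta>))"
  have \<eta>: "\<eta> > 0" "1 - 2 * \<eta> = 1 / (1 + \<delta>)" using assms by (auto simp: \<eta>_def field_simps)
  have "(\<lambda>x. (theta r + real k * ln (real x)) / real x) \<longlonglongrightarrow> 0" by real_asymp
  from tendstoD[OF this \<eta>(1)]
  have "eventually (\<lambda>x. theta r + real k * ln (real x) \<le> \<eta> * real x) sequentially"
    using eventually_gt_at_top[of 0]
  proof eventually_elim
    case (elim x)
    then have "\<bar>(theta r + real k * ln (real x)) / real x\<bar> < \<eta>" by (simp add: dist_real_def)
    then have "(theta r + real k * ln (real x)) / real x \<le> \<eta>" by linarith
    with elim show ?case by (simp add: field_simps)
  qed
  from eventually_conj[OF this theta_eventually[OF \<eta>(1)]] obtain X0 where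
    X0: "\<And>x. x \<ge> X0 \<Longrightarrow> theta r + real k * ln (real x) \<le> \<eta> * real x \<and> (1 - \<eta>) * real x \<le> theta x"
    by (auto simp: eventually_sequentially)
  have "eventually (\<lambda>n. real X0 \<le> (1 + \<delta>) * ln (real n)) sequentially"
    using assms by real_asymp
  then show ?thesis using eventually_gt_at_top[of 0]
  proof eventually_elim
    case (elim n)
    let ?q = "Q r k n"
    show ?case
    proof (cases "?q \<ge> X0")
      case True
      from X0[OF True] theta_Q_le[OF elim(2) assms(1), of r]
      have "(1 - \<eta>) * real ?q \<le> \<eta> * real ?q + ln (real n)" by linarith
      then have "(1 - 2 * \<eta>) * real ?q \<le> ln (real n)" by (simp add: algebra_simps)
      then show ?thesis using assms unfolding \<eta>(2) by (simp add: field_simps)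
    next
      case False
      then show ?thesis using elim(1) by linarith
    qed
  qed
qed

section \<open>Epsilon criteria for limsup bounds\<close>

lemma Limsup_le_realI:
  assumes "\<And>\<delta>. \<delta> > 0 \<Longrightarrow> eventually (\<lambda>n. f n \<le> C + \<delta>) G"
  shows "Limsup G (\<lambda>n. ereal (f n)) \<le> ereal C"
proof (rule ereal_le_epsilon2)
  fix \<delta> :: real assume "\<delta> > 0"
  then have "Limsup G (\<lambda>n. ereal (f n)) \<le> ereal (C + \<delta>)"
    by (intro Limsup_bounded eventually_mono[OF assms]) auto
  then show "Limsup G (\<lambda>n. ereal (f n)) \<le> ereal C + ereal \<delta>" by simp
qed

lemma Limsup_ge_realI:
  assumes "\<And>\<delta> N::nat. \<delta> > 0 \<Longrightarrow> \<exists>n\<in>A. n \<ge> N \<and> f n \<ge> C - \<delta>"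
  shows "ereal C \<le> Limsup (inf at_top (principal A)) (\<lambda>n. ereal (f n))"
proof (rule ccontr)
  assume "\<not> ?thesis"
  then have "Limsup (inf at_top (principal A)) (\<lambda>n. ereal (f n)) < ereal C" by simp
  then obtain y where y: "Limsup (inf at_top (principal A)) (\<lambda>n. ereal (f n)) < ereal y" "ereal y < ereal C"
    using ereal_dense2 by blast
  from Limsup_lessD[OF y(1)] obtain N where N: "\<And>n. n \<ge> N \<Longrightarrow> n \<in> A \<Longrightarrow> f n < y"
    by (auto simp: eventually_inf_principal eventually_at_top_linorder)
  obtain n where "n \<in> A" "n \<ge> N" "f n \<ge> C - (C - y)" using assms[of "C - y" N] y(2) by auto
  with N[of n] show False by simp
qed

text \<open>The logarithm of the constructed element is at most \<open>theta q\<close> plus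
  \<open>ln U\<close>, and \<open>U < 2 * q\<close> makes the latter negligible.\<close>

lemma eventually_F_member:
  assumes r: "r > 0" and \<delta>: "\<delta> > 0"
  shows "eventually (\<lambda>q. prime q \<longrightarrow> (\<forall>U. prime U \<and> q \<le> U \<and> U + r < 2 * q \<longrightarrow>
    (\<exists>n\<in>F r. n \<ge> q \<and> ln (real n) \<le> (1 + \<delta>) * real q \<and>
       prime_factors n = insert U {p. prime p \<and> r < p \<and> p < q}))) sequentially"
proof -
  have "eventually (\<lambda>q::nat. ln (2 * real q) \<le> \<delta> / 2 * real q) sequentially"
    using \<delta> by real_asymp
  moreover have "\<delta> / 2 > 0" using \<delta> by simp
  note theta_eventually[OF this]
  ultimately show ?thesis using eventually_gt_at_top[of r]
  proof eventually_elim
    case (elim q)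
    show ?case
    proof (intro impI allI)
      fix U assume q: "prime q" and "prime U \<and> q \<le> U \<and> U + r < 2 * q"
      then have U: "prime U" "q \<le> U" "U + r < 2 * q" by auto
      define A where "A = {p. prime p \<and> r < p \<and> p < q}"
      have fin: "finite A" unfolding A_def by (rule finite_subset[of _ "{..q}"]) auto
      have n: "U * \<Prod>A \<in> F r" "prime_factors (U * \<Prod>A) = insert U A"
        using F_memI[OF r q _ U A_def] elim by auto
      have A0: "\<Prod>A > 0" by (intro prod_pos) (auto simp: A_def prime_gt_0_nat)
      have U0: "U > 0" using U by (simp add: prime_gt_0_nat)
      have "q * 1 \<le> U * \<Prod>A" using A0 U by (intro mult_mono) (simp_all add: Suc_le_eq)
      then have ge: "q \<le> U * \<Prod>A" by simp
      have "ln (real (U * \<Prod>A)) = ln (real U * (\<Prod>p\<in>A. real p))" by simp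
      also have "\<dots> = ln (real U) + ln (\<Prod>p\<in>A. real p)"
        using U0 by (intro ln_mult_pos prod_pos) (auto simp: A_def prime_gt_0_nat)
      also have "ln (\<Prod>p\<in>A. real p) = (\<Sum>p\<in>A. ln (real p))"
        using fin by (intro ln_prod) (auto simp: A_def prime_gt_0_nat)
      also have "\<dots> \<le> theta q"
        unfolding theta_def A_def by (intro sum_mono2) (auto simp: ln_of_nat_nonneg intro: finite_subset[of _ "{..q}"])
      also have "ln (real U) \<le> ln (2 * real q)" using U U0 by (intro ln_mono) auto
      finally have "ln (real (U * \<Prod>A)) \<le> ln (2 * real q) + theta q" by simp
      also have "\<dots> \<le> \<delta> / 2 * real q + (1 + \<delta> / 2) * real q" using elim by (intro add_mono) auto
      also have "\<dots> = (1 + \<delta>) * real q" by (simp add: algebra_simps)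
      finally show "\<exists>n\<in>F r. n \<ge> q \<and> ln (real n) \<le> (1 + \<delta>) * real q \<and>
         prime_factors n = insert U {p. prime p \<and> r < p \<and> p < q}"
        using n ge unfolding A_def by blast
    qed
  qed
qed

text \<open>Replaces list access in \<open>P\<close> by a set: \<open>A\<close> holds the first
  \<open>k\<close> entries of the descending list of primes.\<close>

lemma largest_prime_factors:
  assumes k: "1 \<le> k" "k \<le> omega n"
  shows "\<exists>A. A \<subseteq> prime_factors n \<and> card A = k \<and> P k n \<in> A \<and> (\<forall>p\<in>A. P k n \<le> p) \<and>
    (\<forall>p\<in>prime_factors n - A. p \<le> P k n)"
proof -
  define xs where "xs = rev (sorted_list_of_set (prime_factors n))"
  have len: "length xs = omega n" by (simp add: xs_def omega_def)
  have set: "set xs = prime_factors n" by (simp add: xs_def)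
  have dist: "distinct xs" by (simp add: xs_def)
  have sorted: "sorted_wrt (\<ge>) xs" unfolding xs_def by (simp add: sorted_wrt_rev)
  have P: "P k n = xs ! (k - 1)" by (simp add: P_def xs_def)
  have le: "xs ! j \<le> xs ! i" if "i \<le> j" "j < length xs" for i j
    using that sorted by (cases "i = j") (auto simp: sorted_wrt_iff_nth_less)
  show ?thesis
  proof (intro exI[of _ "set (take k xs)"] conjI ballI)
    show "set (take k xs) \<subseteq> prime_factors n" using set set_take_subset by metis
    show "card (set (take k xs)) = k" using dist len k by (simp add: distinct_card)
    show "P k n \<in> set (take k xs)" unfolding P in_set_conv_nth using k len by (intro exI[of _ "k - 1"]) auto
  next
    fix p assume p: "p \<in> set (take k xs)"
    show "P k n \<le> p"
    proof -
      obtain i where "i < k" "i < length xs" "p = xs ! i" using p by (auto simp: in_set_conv_nth)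
      then show ?thesis unfolding P using k len by (simp add: le)
    qed
  next
    fix p assume p: "p \<in> prime_factors n - set (take k xs)"
    show "p \<le> P k n"
    proof -
      obtain i where i: "i < length xs" "p = xs ! i" using p set by (metis DiffD1 in_set_conv_nth)
      have "\<not> i < k"
      proof
        assume "i < k"
        then have "p \<in> set (take k xs)" unfolding in_set_conv_nth using i by (intro exI[of _ i]) auto
        with p show False by simp
      qed
      then show ?thesis unfolding P i(2) using i by (intro le) auto
    qed
  qed
qed

text \<open>Strict monotonicity on the non-negative reals, with a negative value at 0 and a positive
  one at 1, makes the definite description in \<open>lambda\<close> well defined.\<close>

lemma lambda_root:
  assumes "r > 0" "K \<ge> 2"
  shows "lambda K r > 0" "real (Jr r) / real r * lambda K r ^ K + real K * lambda K r - (real K - 1) = 0"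
proof -
  define f where "f = (\<lambda>x::real. real (Jr r) / real r * x ^ K + real K * x - (real K - 1))"
  have mono: "f x < f y" if "0 \<le> x" "x < y" for x y
  proof -
    have "real (Jr r) / real r * x ^ K \<le> real (Jr r) / real r * y ^ K"
      using that by (intro mult_left_mono power_mono) auto
    moreover have "real K * x < real K * y" using that assms by simp
    ultimately show ?thesis by (simp add: f_def)
  qed
  have "continuous_on {0..1} f" unfolding f_def by (intro continuous_intros)
  moreover have "f 0 \<le> 0" "0 \<le> f 1" using assms by (auto simp: f_def power_0_left)
  ultimately obtain x where x: "0 \<le> x" "x \<le> 1" "f x = 0" using IVT'[of f 0 0 1] by auto
  have "f 0 < 0" using assms by (simp add: f_def power_0_left)
  then have "x > 0" using x by (cases "x = 0") auto
  then have "\<exists>!x. x > 0 \<and> f x = 0"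
  proof (intro ex1I[of _ x])
    fix y assume "y > 0 \<and> f y = 0"
    then show "y = x" using mono[of x y] mono[of y x] x by (cases x y rule: linorder_cases) auto
  qed (use x in auto)
  from theI'[OF this] have "lambda K r > 0 \<and> f (lambda K r) = 0"
    unfolding lambda_def f_def by simp
  then show "lambda K r > 0" "real (Jr r) / real r * lambda K r ^ K + real K * lambda K r - (real K - 1) = 0"
    by (simp_all add: f_def)
qed

text \<open>The second-order counterpart of Bernoulli's inequality, controlling the error in the
  expansion in 1 / Q.\<close>

lemma one_minus_power_le:
  fixes u :: real
  assumes "0 \<le> u" "u \<le> 1"
  shows "(1 - u) ^ k \<le> 1 - real k * u + (real k * u)\<^sup>2"
proof (induction k)
  case (Suc k)
  have "(1 - u) ^ Suc k \<le> (1 - u) * (1 - real k * u + (real k * u)\<^sup>2)"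
    using Suc assms by (auto intro: mult_left_mono)
  also have "\<dots> = 1 - real (Suc k) * u + (real k * u)\<^sup>2 + real k * u\<^sup>2 - u * (real k * u)\<^sup>2"
    by (simp add: algebra_simps power2_eq_square)
  also have "\<dots> \<le> 1 - real (Suc k) * u + (real (Suc k) * u)\<^sup>2"
  proof -
    have "(real (Suc k) * u)\<^sup>2 = (real k * u)\<^sup>2 + 2 * (real k * u\<^sup>2) + u\<^sup>2"
      by (simp add: algebra_simps power2_eq_square)
    moreover have "0 \<le> u * (real k * u)\<^sup>2" "0 \<le> real k * u\<^sup>2" "0 \<le> u\<^sup>2" using assms by auto
    ultimately show ?thesis by linarith
  qed
  finally show ?case .
qed simp

text \<open>Removed primes are at least \<open>p\<close> and inserted ones at most \<open>q\<close>,
  so products and ratios may be replaced by powers. The factor \<open>q\<close> is there to make the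
  left side tend to \<open>r * (K - 1)\<close> as \<open>q\<close> grows; what results is the
  positivity of the polynomial behind \<open>lambda\<close> at \<open>q / p\<close>.\<close>

lemma F_P_Q_inequality:
  assumes n: "n \<in> F r" and K: "K \<ge> 2" "K \<le> omega n"
    and p_def: "p = real (P K n)" and q_def: "q = real (Q r (K - 1) n)"
  shows "real r < p" "real r < q"
    "q * (1 - (1 - real r / q) ^ (K - 1)) < real r * real K * (q / p) + real (Jr r) * (q / p) ^ K"
proof -
  have nB: "n \<in> B r" using n by (simp add: F_def)
  then have n0: "n > 0" and np: "\<And>p. p \<in> prime_factors n \<Longrightarrow> r < p" by (auto simp: B_iff prime_factors_dvd)
  obtain A where A: "A \<subseteq> prime_factors n" "card A = K" "P K n \<in> A" "\<And>p. p \<in> A \<Longrightarrow> P K n \<le> p"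
    using largest_prime_factors[of K n] K by auto
  have finA: "finite A" using A(1) finite_subset by blast
  define C where "C = {p \<in> absent_primes r n. p \<le> Q r (K - 1) n}"
  have k0: "K - 1 > 0" using K by simp
  have C: "card C = K - 1" "Q r (K - 1) n \<in> absent_primes r n"
    using absent_primes_le_Q[OF n0 k0, of r] by (auto simp: C_def)
  have finC: "finite C" unfolding C_def by (rule finite_subset[of _ "{..Q r (K - 1) n}"]) auto
  show p: "real r < p" using np A by (auto simp: p_def)
  show q: "real r < q" using C by (simp add: q_def)
  have pos: "p > 0" "q > 0" using p q by linarith+
  have fracp: "0 \<le> real r / p" "real r / p \<le> 1" using p pos by (auto simp: field_simps)
  have ex: "real (\<Prod>A) * totient_ratio r A < (real (\<Prod>A) + real (Jr r) * real (\<Prod>C)) * totient_ratio r C"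
    by (rule F_exchange[OF n A(1) finC]) (auto simp: C_def)
  have pA: "p ^ K \<le> real (\<Prod>A)"
  proof -
    have "(\<Prod>x\<in>A. p) \<le> (\<Prod>x\<in>A. real x)" using A(4) pos by (intro prod_mono) (auto simp: p_def)
    then show ?thesis using A(2) by simp
  qed
  have qC: "real (\<Prod>C) \<le> q ^ (K - 1)"
  proof -
    have "(\<Prod>x\<in>C. real x) \<le> (\<Prod>x\<in>C. q)" by (intro prod_mono) (auto simp: C_def q_def)
    then show ?thesis using C(1) by simp
  qed
  have wA: "(1 - real r / p) ^ K \<le> totient_ratio r A"
  proof -
    have "(\<Prod>x\<in>A. 1 - real r / p) \<le> (\<Prod>x\<in>A. 1 - real r / real x)"
    proof (rule prod_mono)
      fix x assume "x \<in> A"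
      then have "p \<le> real x" using A(4) by (simp add: p_def)
      then have "real r / real x \<le> real r / p" using pos by (intro divide_left_mono) auto
      then show "0 \<le> 1 - real r / p \<and> 1 - real r / p \<le> 1 - real r / real x" using fracp by simp
    qed
    then show ?thesis using A(2) by (simp add: totient_ratio_def)
  qed
  have wC: "totient_ratio r C \<le> (1 - real r / q) ^ (K - 1)"
  proof -
    have "(\<Prod>x\<in>C. 1 - real r / real x) \<le> (\<Prod>x\<in>C. 1 - real r / q)"
    proof (rule prod_mono)
      fix x assume "x \<in> C"
      then have "r < x" "x \<le> Q r (K - 1) n" by (auto simp: C_def)
      then show "0 \<le> 1 - real r / real x \<and> 1 - real r / real x \<le> 1 - real r / q"
        using totient_ratio_factor[of r x] by (auto simp: q_def intro!: divide_left_mono)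
    qed
    then show ?thesis using C(1) by (simp add: totient_ratio_def)
  qed
  have wCpos: "totient_ratio r C > 0" by (rule totient_ratio_pos) (auto simp: C_def)
  have A0: "real (\<Prod>A) > 0" using pA zero_less_power[OF pos(1), of K] by linarith
  have "1 - real K * (real r / p) \<le> (1 - real r / p) ^ K"
    using Bernoulli_inequality[of "- (real r / p)" K] fracp by simp
  also have "\<dots> \<le> totient_ratio r A" by (rule wA)
  also have "\<dots> < (1 + real (Jr r) * (real (\<Prod>C) / real (\<Prod>A))) * totient_ratio r C"
    using ex A0 by (simp add: field_simps del: of_nat_prod)
  also have "\<dots> = totient_ratio r C + real (Jr r) * (real (\<Prod>C) / real (\<Prod>A)) * totient_ratio r C"
    by (simp add: algebra_simps)
  also have "\<dots> \<le> (1 - real r / q) ^ (K - 1) + real (Jr r) * (q ^ (K - 1) / p ^ K) * 1"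
  proof (intro add_mono wC mult_mono)
    show "real (\<Prod>C) / real (\<Prod>A) \<le> q ^ (K - 1) / p ^ K"
      using pA qC pos by (intro frac_le) auto
    show "totient_ratio r C \<le> 1" by (rule totient_ratio_le_1) (auto simp: C_def)
    show "0 \<le> real (\<Prod>C) / real (\<Prod>A)" by (intro divide_nonneg_nonneg of_nat_0_le_iff)
  qed (use pos wCpos in auto)
  finally have "1 - (1 - real r / q) ^ (K - 1) < real K * (real r / p) + real (Jr r) * (q ^ (K - 1) / p ^ K)"
    by simp
  then have "q * (1 - (1 - real r / q) ^ (K - 1)) < q * (real K * (real r / p) + real (Jr r) * (q ^ (K - 1) / p ^ K))"
    using pos by (intro mult_strict_left_mono) auto
  also have "\<dots> = real r * real K * (q / p) + real (Jr r) * (q * q ^ (K - 1) / p ^ K)"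
    by (simp add: algebra_simps)
  also have "q * q ^ (K - 1) = q ^ K" using K by (cases K) auto
  finally show "q * (1 - (1 - real r / q) ^ (K - 1)) < real r * real K * (q / p) + real (Jr r) * (q / p) ^ K"
    by (simp add: power_divide)
qed

lemma omega_pos: "n > 1 \<Longrightarrow> 1 \<le> omega n"
  using prime_factor_nat[of n] by (auto simp: omega_def Suc_le_eq card_gt_0_iff prime_factors_dvd set_eq_iff)

text \<open>Trading one prime for one, the overshoot of about \<open>Jr r * q\<close> must outweigh
  a loss of about \<open>r * p / q\<close>; hence \<open>p\<close> is at most quadratic in
  \<open>q\<close>.\<close>

lemma F_P1_bound:
  assumes n: "n \<in> F r" "n > 1" and r: "r > 0"
  shows "real (P 1 n) \<le> real (Jr r) / real r * real (Q r 1 n) ^ 2 + real (Q r 1 n)"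
proof -
  have nB: "n \<in> B r" using n by (simp add: F_def)
  then have np: "\<And>p. p \<in> prime_factors n \<Longrightarrow> r < p" by (auto simp: B_iff prime_factors_dvd)
  define p where "p = real (P 1 n)"
  define q where "q = real (Q r 1 n)"
  have "P 1 n \<in> prime_factors n"
    using largest_prime_factors[of 1 n] omega_pos[OF n(2)] by blast
  moreover have Q: "Q r 1 n \<in> absent_primes r n"
    using absent_primes_le_Q(3)[of n 1 r] n by simp
  ultimately have "real (\<Prod>{P 1 n}) * totient_ratio r {P 1 n} <
      (real (\<Prod>{P 1 n}) + real (Jr r) * real (\<Prod>{Q r 1 n})) * totient_ratio r {Q r 1 n}"
    by (intro F_exchange[OF n(1)]) auto
  then have "p * (1 - real r / p) < (p + real (Jr r) * q) * (1 - real r / q)"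
    by (simp add: totient_ratio_def p_def q_def)
  moreover have p0: "p > 0" and q0: "q > 0"
    using np[OF \<open>P 1 n \<in> prime_factors n\<close>] Q by (auto simp: p_def q_def)
  ultimately have "p - real r < p + real (Jr r) * q - real r * p / q - real (Jr r) * real r"
    by (simp add: algebra_simps)
  then have "real r * p / q < real (Jr r) * q + real r - real (Jr r) * real r" by simp
  also have "\<dots> \<le> real (Jr r) * q + real r" by simp
  finally have "real r * p < (real (Jr r) * q + real r) * q" using q0 by (simp add: field_simps)
  then have "p < (real (Jr r) * q + real r) * q / real r" using r by (simp add: field_simps)
  also have "\<dots> = real (Jr r) / real r * q ^ 2 + q" using r by (simp add: field_simps power2_eq_square)
  finally show ?thesis by (simp add: p_def q_def)
qed

lemma limsup_P1_ge:
  assumes r: "r > 0"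
  shows "2 \<le> Limsup (inf at_top (principal (F r))) (\<lambda>n. ereal (real (P 1 n) / ln (real n)))"
proof -
  have "ereal 2 \<le> Limsup (inf at_top (principal (F r))) (\<lambda>n. ereal (real (P 1 n) / ln (real n)))"
  proof (rule Limsup_ge_realI)
    fix \<delta> :: real and N :: nat assume "\<delta> > 0"
    \<comment> \<open>The bound 1 / 4 ensures \<open>(1 - \<eta>) * (2 - \<eta>) \<ge> 1\<close>,
      hence \<open>q \<le> U\<close>; the bound \<open>\<delta> / 6\<close> ensures \<open>(2 -
      \<delta>) * (1 + \<eta>) \<le> (1 - \<eta>) * (2 - \<eta>)\<close>.\<close>
    define \<eta> where "\<eta> = min (\<delta> / 6) (1 / 4)"
    have \<eta>: "0 < \<eta>" "\<eta> < 1" "\<eta> \<le> 1 / 4" "6 * \<eta> \<le> \<delta>" using \<open>\<delta> > 0\<close> by (auto simp: \<eta>_def)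
    \<comment> \<open>\<open>2 * q - r - 1\<close> is the largest \<open>U\<close> with
      \<open>U + r < 2 * q\<close>.\<close>
    have lim: "filterlim (\<lambda>q::nat. 2 * q - r - 1) at_top sequentially"
    proof (rule filterlim_at_top_mono)
      show "filterlim (\<lambda>q::nat. q) at_top sequentially" by (rule filterlim_ident)
      show "eventually (\<lambda>q. q \<le> 2 * q - r - 1) sequentially"
        using eventually_ge_at_top[of "r + 1"] by eventually_elim simp
    qed
    have "eventually (\<lambda>q::nat. real r + 1 \<le> \<eta> * real q) sequentially"
      using \<eta> by real_asymp
    from eventually_conj[OF this eventually_conj[OF eventually_F_member[OF r \<eta>(1)]
        eventually_compose_filterlim[OF eventually_prime_in_interval[OF \<eta>(1,2)] lim]]]
    obtain q0 where q0: "\<And>q. q \<ge> q0 \<Longrightarrow> real r + 1 \<le> \<eta> * real q \<and> (prime q \<longrightarrow> (\<forall>U. prime U \<and> q \<le> U \<and> U + r < 2 * q \<longrightarrow>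
      (\<exists>n\<in>F r. n \<ge> q \<and> ln (real n) \<le> (1 + \<eta>) * real q \<and>
       prime_factors n = insert U {p. prime p \<and> r < p \<and> p < q}))) \<and>
      (\<exists>p. prime p \<and> (1 - \<eta>) * real (2 * q - r - 1) < real p \<and> p \<le> 2 * q - r - 1)"
      unfolding eventually_sequentially by blast
    obtain q where q: "prime q" "q > max N (max q0 (r + 1))" using bigger_prime by blast
    then have "q \<ge> q0" by simp
    note q0 = q0[OF this]
    obtain U where U: "prime U" "(1 - \<eta>) * real (2 * q - r - 1) < real U" "U \<le> 2 * q - r - 1" using q0 by blast
    have "real (2 * q - r - 1) = 2 * real q - (real r + 1)" using q by (simp add: of_nat_diff)
    then have "(2 - \<eta>) * real q \<le> real (2 * q - r - 1)" using q0 by (simp add: algebra_simps)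
    then have "(1 - \<eta>) * ((2 - \<eta>) * real q) \<le> (1 - \<eta>) * real (2 * q - r - 1)"
      using \<eta> by (intro mult_left_mono) auto
    then have U2: "(1 - \<eta>) * (2 - \<eta>) * real q < real U" using U(2) by simp
    have "1 * real q \<le> (1 - \<eta>) * (2 - \<eta>) * real q"
    proof (intro mult_right_mono)
      have "(3 / 4) * (7 / 4) \<le> (1 - \<eta>) * (2 - \<eta>)" using \<eta> by (intro mult_mono) auto
      then show "1 \<le> (1 - \<eta>) * (2 - \<eta>)" by simp
    qed simp
    then have "q \<le> U" using U2 by linarith
    moreover have "U + r < 2 * q" using U(3) q by linarith
    ultimately obtain n where n: "n \<in> F r" "n \<ge> q" "ln (real n) \<le> (1 + \<eta>) * real q"
      "prime_factors n = insert U {p. prime p \<and> r < p \<and> p < q}" using q0 q(1) U(1) by blast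
    have n1: "n > 1" using n(2) prime_gt_1_nat[OF q(1)] by simp
    obtain A where A: "A \<subseteq> prime_factors n" "card A = 1" "P 1 n \<in> A" "\<And>p. p \<in> prime_factors n - A \<Longrightarrow> p \<le> P 1 n"
      using largest_prime_factors[of 1 n] omega_pos[OF n1] by blast
    have "U \<le> P 1 n"
    proof (cases "U \<in> A")
      case True
      with A(2,3) show ?thesis by (auto simp: card_1_singleton_iff)
    next
      case False
      then show ?thesis using A(4)[of U] n(4) by auto
    qed
    then have "(1 - \<eta>) * (2 - \<eta>) * real q \<le> real (P 1 n)" using U2 by linarith
    have lnpos: "ln (real n) > 0" using n1 by simp
    have "(2 - \<delta>) * ln (real n) \<le> real (P 1 n)"
    proof (cases "2 - \<delta> \<le> 0")
      case True
      then have "(2 - \<delta>) * ln (real n) \<le> 0" using lnpos by (intro mult_nonpos_nonneg) auto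
      then show ?thesis by (rule order_trans) simp
    next
      case False
      then have "(2 - \<delta>) * ln (real n) \<le> (2 - \<delta>) * ((1 + \<eta>) * real q)"
        using n(3) by (intro mult_left_mono) auto
      also have "\<dots> = (2 - \<delta>) * (1 + \<eta>) * real q" by simp
      also have "\<dots> \<le> (1 - \<eta>) * (2 - \<eta>) * real q"
      proof (rule mult_right_mono)
        have "(2 - \<delta>) * (1 + \<eta>) \<le> (2 - 6 * \<eta>) * (1 + \<eta>)" using \<eta> by (intro mult_right_mono) auto
        also have "\<dots> \<le> (1 - \<eta>) * (2 - \<eta>)"
          using \<eta> by (simp add: algebra_simps)
        finally show "(2 - \<delta>) * (1 + \<eta>) \<le> (1 - \<eta>) * (2 - \<eta>)" .
      qed simp
      finally show ?thesis using \<open>(1 - \<eta>) * (2 - \<eta>) * real q \<le> real (P 1 n)\<close> by linarith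
    qed
    then have "real (P 1 n) / ln (real n) \<ge> 2 - \<delta>" using lnpos by (simp add: field_simps)
    then show "\<exists>n\<in>F r. N \<le> n \<and> 2 - \<delta> \<le> real (P 1 n) / ln (real n)"
      using n q by (intro bexI[of _ n]) auto
  qed
  then show ?thesis by simp
qed

lemma limsup_Q_ge:
  assumes r: "r > 0" and L: "L > 0"
  shows "1 \<le> Limsup (inf at_top (principal (F r))) (\<lambda>n. ereal (real (Q r L n) / ln (real n)))"
proof -
  have "ereal 1 \<le> Limsup (inf at_top (principal (F r))) (\<lambda>n. ereal (real (Q r L n) / ln (real n)))"
  proof (rule Limsup_ge_realI)
    fix \<delta> :: real and N :: nat assume \<delta>: "\<delta> > 0"
    obtain q0 where q0: "\<And>q. q \<ge> q0 \<Longrightarrow> prime q \<longrightarrow> (\<forall>U. prime U \<and> q \<le> U \<and> U + r < 2 * q \<longrightarrow>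
      (\<exists>n\<in>F r. n \<ge> q \<and> ln (real n) \<le> (1 + \<delta>) * real q \<and>
       prime_factors n = insert U {p. prime p \<and> r < p \<and> p < q}))"
      using eventually_F_member[OF r \<delta>] unfolding eventually_sequentially by blast
    obtain q where q: "prime q" "q > max N (max q0 (r + 1))" using bigger_prime by blast
    then obtain n where n: "n \<in> F r" "n \<ge> q" "ln (real n) \<le> (1 + \<delta>) * real q"
      "prime_factors n = insert q {p. prime p \<and> r < p \<and> p < q}"
      using q0[of q] by auto
    have n1: "n > 1" using n(2) prime_gt_1_nat[OF q(1)] by simp
    \<comment> \<open>All primes in the range from \<open>r\<close> to \<open>q\<close> divide
      \<open>n\<close>, so even the first absent prime lies beyond; the same \<open>n\<close> serves
      every \<open>L\<close>.\<close>
    have "Q r L n \<in> absent_primes r n" using absent_primes_le_Q(3) n1 L by simp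
    then have "Q r L n \<notin> prime_factors n" "prime (Q r L n)" "r < Q r L n" by auto
    then have qQ: "q \<le> Q r L n" unfolding n(4) by auto
    have lnpos: "ln (real n) > 0" using n1 by simp
    have "(1 - \<delta>) * ln (real n) \<le> real (Q r L n)"
    proof (cases "1 - \<delta> \<le> 0")
      case True
      then have "(1 - \<delta>) * ln (real n) \<le> 0" using lnpos by (intro mult_nonpos_nonneg) auto
      then show ?thesis by (rule order_trans) simp
    next
      case False
      then have "(1 - \<delta>) * ln (real n) \<le> (1 - \<delta>) * ((1 + \<delta>) * real q)"
        using n(3) by (intro mult_left_mono) auto
      also have "\<dots> = (1 - \<delta> * \<delta>) * real q" by (simp add: algebra_simps)
      also have "\<dots> \<le> 1 * real q" by (intro mult_right_mono) auto
      finally show ?thesis using qQ by simp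
    qed
    then have "real (Q r L n) / ln (real n) \<ge> 1 - \<delta>" using lnpos by (simp add: field_simps)
    then show "\<exists>n\<in>F r. N \<le> n \<and> 1 - \<delta> \<le> real (Q r L n) / ln (real n)"
      using n q by (intro bexI[of _ n]) auto
  qed
  then show ?thesis by (simp add: one_ereal_def)
qed

lemma limsup_Q_le:
  assumes L: "L > 0"
  shows "Limsup (inf at_top (principal (F r))) (\<lambda>n. ereal (real (Q r L n) / ln (real n))) \<le> 1"
proof -
  have "Limsup (inf at_top (principal (F r))) (\<lambda>n. ereal (real (Q r L n) / ln (real n))) \<le> ereal 1"
  proof (rule Limsup_le_realI)
    fix \<delta> :: real assume \<delta>: "\<delta> > 0"
    have "eventually (\<lambda>n. real (Q r L n) / ln (real n) \<le> 1 + \<delta>) sequentially"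
      using eventually_Q_le[OF L \<delta>, of r] eventually_gt_at_top[of 1]
      by eventually_elim (simp add: field_simps)
    then show "eventually (\<lambda>n. real (Q r L n) / ln (real n) \<le> 1 + \<delta>) (inf at_top (principal (F r)))"
      by (auto simp: eventually_inf_principal elim: eventually_mono)
  qed
  then show ?thesis by (simp add: one_ereal_def)
qed

lemma limsup_P1_sq_le:
  assumes r: "r > 0"
  shows "Limsup (inf at_top (principal (F r))) (\<lambda>n. ereal (real (P 1 n) / (ln (real n))^2)) \<le> ereal (real (Jr r) / real r)"
proof (rule Limsup_le_realI)
  fix \<delta> :: real assume \<delta>: "\<delta> > 0"
  define c where "c = real (Jr r) / real r"
  have c: "c > 0" using Jr_pos r by (simp add: c_def)
  \<comment> \<open>For \<open>\<eta> \<le> 1\<close> the square of \<open>1 + \<eta>\<close> is at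
    most \<open>1 + 3 * \<eta>\<close>; the excess \<open>3 * c * \<eta>\<close> takes half of
    \<delta> and the linear term the other half.\<close>
  define \<eta> where "\<eta> = min 1 (\<delta> / (6 * c))"
  have \<eta>: "0 < \<eta>" "\<eta> \<le> 1" "6 * c * \<eta> \<le> \<delta>"
    using \<delta> c by (auto simp: \<eta>_def min_def field_simps)
  have "eventually (\<lambda>n::nat. 2 / ln (real n) \<le> \<delta> / 2) sequentially" using \<delta> by real_asymp
  moreover have "eventually (\<lambda>n. real (Q r 1 n) \<le> (1 + \<eta>) * ln (real n)) sequentially"
    using \<eta> by (intro eventually_Q_le) auto
  ultimately have "eventually (\<lambda>n. n \<in> F r \<longrightarrow> real (P 1 n) / (ln (real n))^2 \<le> c + \<delta>) sequentially"
    using eventually_gt_at_top[of 1]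
  proof eventually_elim
    case (elim n)
    show ?case
    proof
      assume nF: "n \<in> F r"
      define l where "l = ln (real n)"
      have l: "l > 0" using elim by (simp add: l_def)
      have "real (P 1 n) \<le> c * real (Q r 1 n) ^ 2 + real (Q r 1 n)"
        using F_P1_bound[OF nF elim(3) r] by (simp add: c_def)
      also have "\<dots> \<le> c * ((1 + \<eta>) * l) ^ 2 + (1 + \<eta>) * l"
        using elim(2) c unfolding l_def by (intro add_mono mult_left_mono power_mono) auto
      also have "\<dots> \<le> c * ((1 + 3 * \<eta>) * l ^ 2) + 2 * l"
      proof (intro add_mono mult_left_mono mult_right_mono)
        have "\<eta> * \<eta> \<le> 1 * \<eta>" using \<eta> by (intro mult_right_mono) auto
        then have "(1 + \<eta>)\<^sup>2 \<le> 1 + 3 * \<eta>" by (simp add: power2_eq_square algebra_simps)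
        then show "((1 + \<eta>) * l)\<^sup>2 \<le> (1 + 3 * \<eta>) * l\<^sup>2"
          unfolding power_mult_distrib by (intro mult_right_mono) auto
      qed (use c \<eta> l in auto)
      also have "\<dots> = (c + 3 * c * \<eta> + 2 / l) * l ^ 2"
        using l by (simp add: field_simps power2_eq_square)
      also have "\<dots> \<le> (c + \<delta>) * l ^ 2"
        using elim(1) \<eta>(3) by (intro mult_right_mono) (auto simp: l_def)
      finally show "real (P 1 n) / (ln (real n))^2 \<le> c + \<delta>"
        using l by (simp add: l_def pos_divide_le_eq)
    qed
  qed
  then show "eventually (\<lambda>n. real (P 1 n) / (ln (real n))^2 \<le> real (Jr r) / real r + \<delta>) (inf at_top (principal (F r)))"
    by (simp add: eventually_inf_principal c_def)
qed

text \<open>If \<open>p\<close> were too large, \<open>x = q / p\<close> would stay below the root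
  by a fixed margin. Then the second-order error must make up for the margin, which bounds
  \<open>q\<close>; and as \<open>x\<close> cannot be too small, \<open>p\<close> is bounded as
  well, a contradiction for large \<open>n\<close>.\<close>

lemma limsup_PK_le:
  assumes r: "r > 0" and K: "K \<ge> 2"
  shows "Limsup (inf at_top (principal {n \<in> F r. omega n \<ge> K})) (\<lambda>n. ereal (real (P K n) / ln (real n)))
     \<le> ereal (1 / lambda K r)"
proof (rule Limsup_le_realI)
  fix \<delta> :: real assume \<delta>: "\<delta> > 0"
  define J where "J = real (Jr r)"
  define f where "f = (\<lambda>x::real. J / real r * x ^ K + real K * x - (real K - 1))"
  define l where "l = lambda K r"
  have l: "l > 0" "f l = 0" using lambda_root[OF r K] by (simp_all add: l_def f_def J_def)
  have J: "J > 0" using Jr_pos by (simp add: J_def)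
  have mono: "f x \<le> f y" if "0 \<le> x" "x \<le> y" for x y
    unfolding f_def using that J by (intro diff_right_mono add_mono mult_left_mono power_mono) auto
  have strict: "f x < f y" if "0 \<le> x" "x < y" for x y
  proof -
    have "J / real r * x ^ K \<le> J / real r * y ^ K"
      using that J by (intro mult_left_mono power_mono) auto
    moreover have "real K * x < real K * y" using that K by simp
    ultimately show ?thesis by (simp add: f_def)
  qed
  define \<mu> where "\<mu> = 1 / l + \<delta>"
  have \<mu>: "\<mu> > 0" using l \<delta> by (simp add: \<mu>_def add_pos_pos)
  \<comment> \<open>The largest possible \<open>q / p\<close> when \<open>p > \<mu> * ln n\<close>.
    Allowing only half of \<delta> in the bound for \<open>q\<close> keeps it strictly below the
    root.\<close>
  define x0 where "x0 = (1 + l * \<delta> / 2) / \<mu>"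
  have x0: "0 < x0" "x0 < l"
  proof -
    show "0 < x0" using l \<delta> \<mu> by (simp add: x0_def add_pos_pos)
    have "l * \<mu> = 1 + l * \<delta>" using l by (simp add: \<mu>_def field_simps)
    then have "1 + l * \<delta> / 2 < l * \<mu>" using l \<delta> by simp
    then show "x0 < l" using \<mu> by (simp add: x0_def field_simps)
  qed
  define e where "e = - f x0"
  have e: "e > 0" using strict[of x0 l] x0 l by (simp add: e_def)
  \<comment> \<open>Solves \<open>e < (K - 1)\<^sup>2 * r / q\<close> for \<open>q\<close>.\<close>
  define X0 where "X0 = (real K - 1)\<^sup>2 * real r / e"
  \<comment> \<open>For \<open>x \<le> x1 \<le> 1\<close> the right side of the inequality is at
    most \<open>(r * K + J) * x \<le> r\<close>, whereas its left side is at least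
    \<open>r\<close>.\<close>
  define x1 where "x1 = min 1 (real r / (real r * real K + J))"
  have den: "real r * real K + J > 0" using r K J by (intro add_nonneg_pos) auto
  have x1: "0 < x1" "x1 \<le> 1" "(real r * real K + J) * x1 \<le> real r"
  proof -
    show "0 < x1" using r den by (simp add: x1_def)
    show "x1 \<le> 1" by (simp add: x1_def)
    have "(real r * real K + J) * x1 \<le> (real r * real K + J) * (real r / (real r * real K + J))"
      using den by (intro mult_left_mono) (auto simp: x1_def)
    then show "(real r * real K + J) * x1 \<le> real r" using den by simp
  qed
  have "eventually (\<lambda>n. real (Q r (K - 1) n) \<le> (1 + l * \<delta> / 2) * ln (real n)) sequentially"
    using K l \<delta> by (intro eventually_Q_le) auto
  moreover have "eventually (\<lambda>n::nat. X0 / x1 / \<mu> < ln (real n)) sequentially" by real_asymp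
  ultimately have "eventually (\<lambda>n. n \<in> F r \<and> omega n \<ge> K \<longrightarrow> real (P K n) / ln (real n) \<le> \<mu>) sequentially"
    using eventually_gt_at_top[of 1]
  proof eventually_elim
    case (elim n)
    show ?case
    proof (intro impI)
      assume n: "n \<in> F r \<and> omega n \<ge> K"
      define p where "p = real (P K n)"
      define q where "q = real (Q r (K - 1) n)"
      define x where "x = q / p"
      have pq: "real r < p" "real r < q"
        and ineq: "q * (1 - (1 - real r / q) ^ (K - 1)) < real r * real K * x + J * x ^ K"
        using F_P_Q_inequality[OF _ K _ p_def q_def] n by (auto simp: x_def J_def)
      have pos: "p > 0" "q > 0" "x > 0" using pq by (auto simp: x_def intro!: divide_pos_pos)
      define u where "u = real r / q"
      have u: "0 \<le> u" "u \<le> 1" using pq pos by (auto simp: u_def field_simps)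
      have qu: "q * u = real r" using pos by (simp add: u_def)
      have lnpos: "ln (real n) > 0" using elim by simp
      have "p \<le> \<mu> * ln (real n)"
      proof (rule ccontr)
        assume "\<not> p \<le> \<mu> * ln (real n)"
        then have big: "p > \<mu> * ln (real n)" by simp
        have "x \<le> x0"
        proof -
          have "q \<le> (1 + l * \<delta> / 2) * ln (real n)" using elim by (simp add: q_def)
          also have "\<dots> = x0 * (\<mu> * ln (real n))" using \<mu> by (simp add: x0_def)
          also have "\<dots> \<le> x0 * p" using big x0 by (intro mult_left_mono) auto
          finally show ?thesis using pos by (simp add: x_def field_simps)
        qed
        then have fx: "f x \<le> - e" using mono[of x x0] pos by (simp add: e_def)
        have "real r * real K * x + J * x ^ K = real r * f x + real r * (real K - 1)"
          using r by (simp add: f_def field_simps)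
        also have "\<dots> \<le> real r * (real K - 1) - real r * e"
          using mult_left_mono[OF fx, of "real r"] by simp
        finally have up: "q * (1 - (1 - u) ^ (K - 1)) < real r * (real K - 1) - real r * e"
          using ineq unfolding u_def by linarith
        have "q * (real (K - 1) * u - (real (K - 1) * u)\<^sup>2) \<le> q * (1 - (1 - u) ^ (K - 1))"
          using one_minus_power_le[OF u, of "K - 1"] pos by (intro mult_left_mono) auto
        also have "q * (real (K - 1) * u - (real (K - 1) * u)\<^sup>2) = (q * u) * (real (K - 1) - (real (K - 1))\<^sup>2 * u)"
          by (simp add: algebra_simps power2_eq_square)
        also have "\<dots> = real r * (real K - 1) - real r * ((real K - 1)\<^sup>2 * u)"
          unfolding qu using K by (simp add: algebra_simps of_nat_diff)
        finally have "real r * e < real r * ((real K - 1)\<^sup>2 * u)" using up by linarith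
        then have "e < (real K - 1)\<^sup>2 * u" using r by simp
        then have qX: "q < X0" using e pos by (simp add: u_def X0_def field_simps)
        have "real r < real r * real K * x + J * x ^ K"
        proof -
          have "(1 - u) ^ (K - 1) \<le> (1 - u) ^ 1" using u K by (intro power_decreasing) auto
          then have "q * u \<le> q * (1 - (1 - u) ^ (K - 1))" using pos by (intro mult_left_mono) auto
          then show ?thesis using ineq qu unfolding u_def by linarith
        qed
        have "x1 < x"
        proof (rule ccontr)
          assume "\<not> x1 < x"
          then have xx: "x \<le> x1" by simp
          then have "x ^ K \<le> x ^ 1" using x1 pos K by (intro power_decreasing) auto
          then have "real r * real K * x + J * x ^ K \<le> (real r * real K + J) * x"
            using J by (simp add: algebra_simps mult_left_mono)
          also have "\<dots> \<le> (real r * real K + J) * x1" using xx den by (intro mult_left_mono) auto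
          also have "\<dots> \<le> real r" by (rule x1)
          finally show False using \<open>real r < real r * real K * x + J * x ^ K\<close> by linarith
        qed
        then have "p * x1 < q" using pos by (simp add: x_def field_simps)
        then have "p * x1 < X0" using qX by linarith
        then have "p < X0 / x1" using x1 by (simp add: field_simps)
        moreover have "X0 / x1 < \<mu> * ln (real n)" using elim(2) \<mu> by (simp only: pos_divide_less_eq mult.commute)
        ultimately show False using big by linarith
      qed
      then show "real (P K n) / ln (real n) \<le> \<mu>" using lnpos by (simp add: p_def field_simps)
    qed
  qed
  then show "eventually (\<lambda>n. real (P K n) / ln (real n) \<le> 1 / lambda K r + \<delta>) (inf at_top (principal {n \<in> F r. omega n \<ge> K}))"
    by (simp add: eventually_inf_principal \<mu>_def l_def)
qed

theorem theorem3p3: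
  fixes r K L :: nat
  assumes "r > 0" and "K \<ge> 2" and "L > 0"
  shows "Limsup (inf at_top (principal (F r))) (\<lambda>n. ereal (real (P 1 n) / ln (real n))) \<ge> 2
    \<and> Limsup (inf at_top (principal (F r))) (\<lambda>n. ereal (real (Q r L n) / ln (real n))) = 1
    \<and> Limsup (inf at_top (principal {n \<in> F r. omega n \<ge> K}))
           (\<lambda>n. ereal (real (P K n) / ln (real n))) \<le> ereal (1 / lambda K r)
    \<and> Limsup (inf at_top (principal (F r))) (\<lambda>n. ereal (real (P 1 n) / (ln (real n))^2))
           \<le> ereal (real (Jr r) / real r)"
  using limsup_P1_ge[OF assms(1)] limsup_Q_ge[OF assms(1,3)] limsup_Q_le[OF assms(3), of r]
    limsup_PK_le[OF assms(1,2)] limsup_P1_sq_le[OF assms(1)]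
  by (auto intro: antisym)

end
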